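(* Let $K\ge2$, $b\in\mathbb{R}$, and let the random potential satisfy Assumption A1. Then with probability one, for every bounded continuous function $F\in C_b(\mathbb{R})$, $$\lim_{L\to\infty}|\mathcal{T}_L|^{-1}\,\mathrm{Tr}\,F(H_{\mathcal{T}_L})=\int_{\mathbb{R}}F(E)\,n_{\mathcal{C}}(dE).$$
   Context: $\mathcal{T}$ is the rooted tree in which every vertex has exactly $K$ neighbors away from the root $0$; $\mathcal{T}_L=\{x:\mathrm{dist}(0,x)\le L\}$. $H_{\mathcal{T}_L}=A+V+B$ on $\ell^2(\mathcal{T}_L)$, with $A$ the adjacency operator of $\mathcal{T}_L$, $V$ multiplication by i.i.d. random variables $\omega_x$, and $B$ multiplication by $b$ on the sites with $\mathrm{dist}(0,x)=L$ (zero elsewhere). The canopy graph $\mathcal{C}$ is the tree built from an infinite (countable) outermost layer $\partial\mathcal{C}$: each layer is partitioned into sets of $K$ elements and the elements of each set are joined to a common new vertex of the next layer, and so on for infinitely many layers. $H_{\mathcal{C}}=A+V+B$ on $\ell^2(\mathcal{C})$ with $A$ the adjacency operator of $\mathcal{C}$, $V$ multiplication by i.i.d. $\{\omega_x\}_{x\in\mathcal{C}}$ with the same distribution, and $B$ multiplication by $b$ on $\partial\mathcal{C}$ (zero elsewhere). For $x_0\in\partial\mathcal{C}$ let $x_0,x_1,x_2,\dots$ be the unique path from $x_0$ to infinity ($x_n$ at distance $n$ from $\partial\mathcal{C}$). The canopy density of states measure is $n_{\mathcal{C}}(I):=\frac{K-1}{K}\sum_{n\ge0}K^{-n}\,\mathbb{E}[\langle\delta_{x_n},P_I(H_{\mathcal{C}})\delta_{x_n}\rangle]$,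 where $P_I$ is the spectral projection onto the Borel set $I$. Assumption A1: the single-site distribution has a bounded density $\varrho$ with $\int|\omega|^\tau\varrho(\omega)d\omega<\infty$ for some $\tau>0$. *)

theory Defs
  imports "HOL-Probability.Probability" "HOL-Computational_Algebra.Polynomial"
    "HOL-Combinatorics.Permutations"
begin

text \<open>Vertices of the rooted tree are words over the alphabet {0..K-1}; the root 0 is [].
  The children of x are c # x (c < K), so dist(0,x) = length x.\<close>

definition tree_vertices :: "nat \<Rightarrow> nat list set" where
  "tree_vertices K = {xs. set xs \<subseteq> {..<K}}"

definition tree_ball :: "nat \<Rightarrow> nat \<Rightarrow> nat list set" where
  "tree_ball K L = {xs. set xs \<subseteq> {..<K} \<and> length xs \<le> L}"

definition tree_adj :: "nat list \<Rightarrow> nat list \<Rightarrow> bool" where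
  "tree_adj x y \<longleftrightarrow> (\<exists>c. y = c # x) \<or> (\<exists>c. x = c # y)"

definition H_tree :: "nat \<Rightarrow> real \<Rightarrow> nat \<Rightarrow> (nat list \<Rightarrow> real) \<Rightarrow> nat list \<Rightarrow> nat list \<Rightarrow> real" where
  "H_tree K b L w x y =
     (if tree_adj x y then 1 else 0) +
     (if x = y then w x + (if length x = L then b else 0) else 0)"

definition det_on :: "'i set \<Rightarrow> ('i \<Rightarrow> 'i \<Rightarrow> 'a::comm_ring_1) \<Rightarrow> 'a" where
  "det_on S M = (\<Sum>p | p permutes S. of_int (sign p) * (\<Prod>i\<in>S. M i (p i)))"

definition charpoly_on :: "'i set \<Rightarrow> ('i \<Rightarrow> 'i \<Rightarrow> real) \<Rightarrow> real poly" where
  "charpoly_on S M = det_on S (\<lambda>i j. (if i = j then [:0, 1:] else 0) - [:M i j:])"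

text \<open>For a real symmetric matrix H, Tr F(H) = sum of F over the eigenvalues of H,
  counted with (algebraic = geometric) multiplicity.\<close>
definition trace_fun_on :: "'i set \<Rightarrow> (real \<Rightarrow> real) \<Rightarrow> ('i \<Rightarrow> 'i \<Rightarrow> real) \<Rightarrow> real" where
  "trace_fun_on S F M =
     (\<Sum>e\<in>{x. poly (charpoly_on S M) x = 0}. real (order e (charpoly_on S M)) * F e)"

text \<open>Vertices of the canopy graph C are pairs (n, j): layer n (distance n from the boundary
  layer \<partial>C = layer 0) and index j.  The parent (next layer) of (n, j) is (n+1, j div K);
  thus layer n is partitioned into the sets {(n, K*m + i) | i < K}, each joined to (n+1, m).
  The path from x_0 = (0,0) to infinity is x_n = (n, 0).\<close>

definition canopy_adj :: "nat \<Rightarrow> nat \<times> nat \<Rightarrow> nat \<times> nat \<Rightarrow> bool" where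
  "canopy_adj K x y \<longleftrightarrow>
     y = (Suc (fst x), snd x div K) \<or> x = (Suc (fst y), snd y div K)"

text \<open>The equation (A + V + B - z) \<psi> = \<delta>_x, read pointwise at every vertex y
  (each vertex has finitely many neighbours).\<close>
definition canopy_resolvent_eq ::
  "nat \<Rightarrow> real \<Rightarrow> (nat \<times> nat \<Rightarrow> real) \<Rightarrow> complex \<Rightarrow> nat \<times> nat \<Rightarrow> (nat \<times> nat \<Rightarrow> complex) \<Rightarrow> bool" where
  "canopy_resolvent_eq K b w z x \<psi> \<longleftrightarrow>
     (\<forall>y. (\<Sum>y'\<in>{y'. canopy_adj K y y'}. \<psi> y')
          + (complex_of_real (w y + (if fst y = 0 then b else 0)) - z) * \<psi> y
          = (if y = x then 1 else 0))"

text \<open>Spectral measure of H_C = A + V + B (self-adjoint on the domain of V, A being bounded)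
  at \<delta>_x: the unique Borel probability measure \<mu> on \<real> whose Borel transform
  \<integral> 1/(E - z) d\<mu>(E) equals \<langle>\<delta>_x, (H_C - z)\<inverse> \<delta>_x\<rangle> = \<psi>(x) for all non-real z,
  where \<psi> is the (unique) l^2 solution of (H_C - z)\<psi> = \<delta>_x.
  Hence \<mu>(I) = \<langle>\<delta>_x, P_I(H_C) \<delta>_x\<rangle>.\<close>
definition canopy_spec_meas :: "nat \<Rightarrow> real \<Rightarrow> (nat \<times> nat \<Rightarrow> real) \<Rightarrow> nat \<times> nat \<Rightarrow> real measure" where
  "canopy_spec_meas K b w x =
     (THE \<mu>. prob_space \<mu> \<and> sets \<mu> = sets borel \<and>
        (\<forall>z. Im z \<noteq> 0 \<longrightarrow>
           (\<exists>\<psi>. (\<lambda>y. (norm (\<psi> y))\<^sup>2) summable_on UNIV \<and>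
                canopy_resolvent_eq K b w z x \<psi> \<and>
                \<psi> x = integral\<^sup>L \<mu> (\<lambda>E. 1 / (complex_of_real E - z)))))"

definition canopy_space :: "(real \<Rightarrow> real) \<Rightarrow> (nat \<times> nat \<Rightarrow> real) measure" where
  "canopy_space \<rho> = PiM UNIV (\<lambda>_. density lborel (\<lambda>t. ennreal (\<rho> t)))"

definition canopy_dos :: "nat \<Rightarrow> real \<Rightarrow> (real \<Rightarrow> real) \<Rightarrow> real measure" where
  "canopy_dos K b \<rho> = measure_of UNIV (sets borel)
     (\<lambda>I. ennreal ((real K - 1) / real K) *
        (\<Sum>n. ennreal (1 / real K ^ n) *
           (\<integral>\<^sup>+ w. emeasure (canopy_spec_meas K b w (n, 0)) I \<partial>canopy_space \<rho>)))"

end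

theory Submission
  imports Defs "Jordan_Normal_Form.Char_Poly" "HOL-Real_Asymp.Real_Asymp" "HOL-Number_Theory.Cong"
begin

text \<open>
  Both sides are compared through their Stieltjes transforms at \<open>z\<close> in the upper half-plane,
  \<open>\<eta> = Im z\<close>. Let \<open>\<Gamma>\<close> denote the Green function of a finite subtree at its root. By the
  Schur complement recursion, the diagonal Green function at \<open>x\<close> is the sum over the ancestors \<open>r\<close> of \<open>x\<close>
  of the path terms \<open>\<Gamma>(r) \<Prod> \<Gamma>(s)\<^sup>2\<close>, where \<open>s\<close> runs over the path from \<open>x\<close> to \<open>r\<close> without \<open>r\<close>.
  The identity \<open>|\<Gamma>|\<^sup>2 (\<eta> + \<Sum> Im \<Gamma>(child)) = Im \<Gamma>\<close> together with \<open>Im \<Gamma> \<le> 1/\<eta>\<close>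
  makes a path term of length \<open>d\<close> at most \<open>(1 + \<eta>\<^sup>2)\<^sup>-\<^sup>d / \<eta>\<close>. This decay gives existence and uniqueness of
  the square summable resolvent on the canopy graph and the convergence of the finite-volume Green functions.
  Grouping the trace by the top vertex \<open>r\<close> of the path turns it into a sum of bounded local
  functions that are i.i.d. on each level of the tree; a second moment estimate on each
  level gives almost sure convergence, and tree automorphisms identify the limit with the
  canopy average, which is grouped by the bottom vertex. Stieltjes inversion and tightness
  pass from Stieltjes transforms at countably many points to all bounded continuous functions.
\<close>

section \<open>Symmetric matrices on a finite index set\<close>

text \<open>Vertices at height \<open>m\<close> above the leaves keep a positive share of a large
  ball, tending to \<open>(K - 1) / K\<close> times \<open>1 / K ^ m\<close>. The limit is therefore
  seen from the leaves, which produces the canopy graph and the weights of its density of states.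
  Two obstacles shape the estimates. The diagonal Green functions on one level all depend on the
  potential of the whole ball, hence are not independent; collecting path terms with a common top
  vertex leaves a function of the potential below that vertex, and distinct vertices of one level
  have disjoint subtrees. Moreover, the decay of a single path term need not beat the
  \<open>K ^ d\<close> paths of length \<open>d\<close> below a top vertex; their sum is bounded
  through an exact conservation law (\<open>sum_norm_pathprod\<close>) instead. The potential may be
  unbounded, and so may the canopy operator. Its spectral measures are obtained as weak limits of
  those of finite trees, and their measurability in the potential comes from the inversion
  formula.\<close>

definition mprod :: "'i set \<Rightarrow> ('i \<Rightarrow> 'i \<Rightarrow> real) \<Rightarrow> ('i \<Rightarrow> 'i \<Rightarrow> real) \<Rightarrow> 'i \<Rightarrow> 'i \<Rightarrow> real" where
  "mprod S A B x y = (\<Sum>z\<in>S. A x z * B z y)"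

lemma mprod_assoc: "mprod S (mprod S A B) C = mprod S A (mprod S B C)"
proof (intro ext)
  fix x y
  have "mprod S (mprod S A B) C x y = (\<Sum>z\<in>S. \<Sum>w\<in>S. A x w * B w z * C z y)"
    unfolding mprod_def by (simp add: sum_distrib_right)
  also have "\<dots> = (\<Sum>w\<in>S. \<Sum>z\<in>S. A x w * B w z * C z y)" by (rule sum.swap)
  also have "\<dots> = mprod S A (mprod S B C) x y"
    unfolding mprod_def by (simp add: sum_distrib_left mult.assoc)
  finally show "mprod S (mprod S A B) C x y = mprod S A (mprod S B C) x y" .
qed

lemma mprod_cong:
  "\<lbrakk>\<And>z. z \<in> S \<Longrightarrow> A x z = A' x z; \<And>z. z \<in> S \<Longrightarrow> B z y = B' z y\<rbrakk>
   \<Longrightarrow> mprod S A B x y = mprod S A' B' x y"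
  unfolding mprod_def by (rule sum.cong) auto

lemma mprod_id_left:
  assumes "finite S" "x \<in> S" "\<And>z. z \<in> S \<Longrightarrow> A x z = of_bool (x = z)"
  shows "mprod S A B x y = B x y"
proof -
  have "mprod S A B x y = (\<Sum>z\<in>S. if z = x then B x y else 0)"
    unfolding mprod_def by (rule sum.cong) (auto simp: assms(3))
  then show ?thesis using assms by simp
qed

lemma mprod_id_right:
  assumes "finite S" "y \<in> S" "\<And>z. z \<in> S \<Longrightarrow> B z y = of_bool (z = y)"
  shows "mprod S A B x y = A x y"
proof -
  have "mprod S A B x y = (\<Sum>z\<in>S. if z = y then A x y else 0)"
    unfolding mprod_def by (rule sum.cong) (auto simp: assms(3))
  then show ?thesis using assms by simp
qed

text \<open>The characteristic polynomial has a complex root \<open>k\<close>. Pairing the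
  eigenvector with its conjugate shows that \<open>k\<close> times the nonzero squared norm is real,
  so \<open>k\<close> is real and the real and imaginary parts of the eigenvector satisfy the same
  equation; one of them is nonzero.\<close>

lemma symmetric_eigenvector:
  fixes M :: "'i \<Rightarrow> 'i \<Rightarrow> real"
  assumes fin: "finite S" and ne: "S \<noteq> {}"
    and sym: "\<And>x y. x \<in> S \<Longrightarrow> y \<in> S \<Longrightarrow> M x y = M y x"
  shows "\<exists>e v. (\<Sum>x\<in>S. (v x)\<^sup>2) = 1 \<and> (\<forall>x\<in>S. (\<Sum>y\<in>S. M x y * v y) = e * v x)"
proof -
  define n where "n = card S"
  obtain f where f: "bij_betw f {0..<n} S"
    using ex_bij_betw_nat_finite[OF fin] unfolding n_def by blast
  define g where "g = inv_into {0..<n} f"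
  have g: "bij_betw g S {0..<n}" unfolding g_def by (rule bij_betw_inv_into[OF f])
  have gf: "\<And>i. i < n \<Longrightarrow> g (f i) = i"
    unfolding g_def using bij_betw_inv_into_left[OF f] by auto
  have fg: "\<And>x. x \<in> S \<Longrightarrow> f (g x) = x"
    unfolding g_def using bij_betw_inv_into_right[OF f] by auto
  have gn: "\<And>x. x \<in> S \<Longrightarrow> g x < n" using bij_betwE[OF g] by auto
  have n0: "n > 0" unfolding n_def using fin ne by (simp add: card_gt_0_iff)
  define A where "A = mat n n (\<lambda>(i,j). complex_of_real (M (f i) (f j)))"
  have A: "A \<in> carrier_mat n n" unfolding A_def by auto
  have "degree (char_poly A) = n" using degree_monic_char_poly[OF A] by auto
  then have "\<not> constant (poly (char_poly A))" using n0 by (simp add: constant_degree)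
  then obtain k where "poly (char_poly A) k = 0" using fundamental_theorem_of_algebra by blast
  then have "eigenvalue A k" using eigenvalue_root_char_poly[OF A] by blast
  then obtain vc where vc: "vc \<in> carrier_vec n" "vc \<noteq> 0\<^sub>v n" "A *\<^sub>v vc = k \<cdot>\<^sub>v vc"
    unfolding eigenvalue_def eigenvector_def using A by auto
  define \<phi> where "\<phi> x = vec_index vc (g x)" for x
  have eq: "(\<Sum>y\<in>S. complex_of_real (M x y) * \<phi> y) = k * \<phi> x" if x: "x \<in> S" for x
  proof -
    have "k * \<phi> x = vec_index (k \<cdot>\<^sub>v vc) (g x)"
      unfolding \<phi>_def using vc(1) gn[OF x] by simp
    also have "\<dots> = vec_index (A *\<^sub>v vc) (g x)" using vc(3) by simp
    also have "\<dots> = (\<Sum>j = 0..<n. complex_of_real (M x (f j)) * vec_index vc j)"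
      using vc(1) gn[OF x] unfolding A_def by (simp add: scalar_prod_def fg[OF x])
    also have "\<dots> = (\<Sum>y\<in>S. complex_of_real (M x y) * \<phi> y)"
      unfolding sum.reindex_bij_betw[OF f, symmetric] \<phi>_def
      by (rule sum.cong) (auto simp: gf)
    finally show ?thesis by simp
  qed
  have "\<exists>i<n. vec_index vc i \<noteq> 0"
    using vc(1,2) by (auto simp: vec_eq_iff)
  then obtain x1 where x1: "x1 \<in> S" "\<phi> x1 \<noteq> 0"
    unfolding \<phi>_def using bij_betwE[OF f] gf by (metis atLeastLessThan_iff le0)
  have "k * (\<Sum>x\<in>S. cnj (\<phi> x) * \<phi> x) = (\<Sum>x\<in>S. \<Sum>y\<in>S. cnj (\<phi> x) * complex_of_real (M x y) * \<phi> y)"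
    unfolding sum_distrib_left
    by (rule sum.cong) (auto simp: sum_distrib_left[symmetric] eq mult.assoc)
  moreover have T: "cnj (\<Sum>x\<in>S. \<Sum>y\<in>S. cnj (\<phi> x) * complex_of_real (M x y) * \<phi> y)
     = (\<Sum>x\<in>S. \<Sum>y\<in>S. cnj (\<phi> x) * complex_of_real (M x y) * \<phi> y)"
  proof -
    have "cnj (\<Sum>x\<in>S. \<Sum>y\<in>S. cnj (\<phi> x) * complex_of_real (M x y) * \<phi> y)
      = (\<Sum>x\<in>S. \<Sum>y\<in>S. cnj (\<phi> y) * complex_of_real (M y x) * \<phi> x)"
      by (simp add: sym mult.commute mult.left_commute cong: sum.cong)
    then show ?thesis using sum.swap by simp
  qed
  moreover have "(\<Sum>x\<in>S. cnj (\<phi> x) * \<phi> x) = complex_of_real (\<Sum>x\<in>S. (norm (\<phi> x))\<^sup>2)"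
    by (simp add: complex_norm_square mult.commute del: of_real_power)
  moreover have "(\<Sum>x\<in>S. (norm (\<phi> x))\<^sup>2) \<noteq> 0"
    using x1 fin by (simp add: sum_nonneg_eq_0_iff) blast
  ultimately obtain r :: real where "r \<noteq> 0" "cnj (k * complex_of_real r) = k * complex_of_real r"
    using that by metis
  then have "cnj k = k" by simp
  then have kr: "k = complex_of_real (Re k)"
    by (simp add: complex_eq_iff)
  have re: "(\<Sum>y\<in>S. M x y * Re (\<phi> y)) = Re k * Re (\<phi> x)"
    and im: "(\<Sum>y\<in>S. M x y * Im (\<phi> y)) = Re k * Im (\<phi> x)" if "x \<in> S" for x
    using arg_cong[OF eq[OF that], of Re] arg_cong[OF eq[OF that], of Im]
    by (simp_all add: arg_cong[OF kr, of Im])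
  have "\<exists>v. (\<exists>x\<in>S. v x \<noteq> 0) \<and> (\<forall>x\<in>S. (\<Sum>y\<in>S. M x y * v y) = Re k * v x)"
  proof (cases "Re (\<phi> x1) = 0")
    case True
    then have "Im (\<phi> x1) \<noteq> 0" using x1 by (simp add: complex_eq_iff)
    then show ?thesis using x1 im by (intro exI[of _ "\<lambda>x. Im (\<phi> x)"]) auto
  next
    case False
    then show ?thesis using x1 re by (intro exI[of _ "\<lambda>x. Re (\<phi> x)"]) auto
  qed
  then obtain v x2 where v: "x2 \<in> S" "v x2 \<noteq> 0" "\<And>x. x \<in> S \<Longrightarrow> (\<Sum>y\<in>S. M x y * v y) = Re k * v x"
    by blast
  define N where "N = (\<Sum>x\<in>S. (v x)\<^sup>2)"
  have N: "N > 0" unfolding N_def using v fin by (intro sum_pos2[of _ x2]) auto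
  define w where "w x = v x / sqrt N" for x
  have "(\<Sum>x\<in>S. (w x)\<^sup>2) = 1"
    unfolding w_def using N by (simp add: power_divide sum_divide_distrib[symmetric] N_def[symmetric])
  moreover have "\<forall>x\<in>S. (\<Sum>y\<in>S. M x y * w y) = Re k * w x"
    unfolding w_def using v(3) by (simp add: sum_divide_distrib[symmetric])
  ultimately show ?thesis by blast
qed

text \<open>The reflection along \<open>h\<close>, the difference of the unit vectors
  \<open>v\<close> and the one at \<open>x0\<close>, exchanges these two vectors.\<close>

lemma householder:
  fixes v :: "'i \<Rightarrow> real"
  assumes fin: "finite S" and x0: "x0 \<in> S" and v: "(\<Sum>x\<in>S. (v x)\<^sup>2) = 1"
  shows "\<exists>R. (\<forall>x y. R x y = R y x) \<and> (\<forall>x\<in>S. \<forall>y\<in>S. mprod S R R x y = of_bool (x = y))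
     \<and> (\<forall>x\<in>S. R x x0 = v x)"
proof -
  define h where "h x = v x - of_bool (x = x0)" for x
  \<comment> \<open>If \<open>v x0 = 1\<close>, division by zero makes \<open>c = 0\<close> and
    \<open>R\<close> the identity. This is the right choice, since \<open>v\<close> is then the unit
    vector at \<open>x0\<close>.\<close>
  define c where "c = 1 / (1 - v x0)"
  define R where "R x y = of_bool (x = y) - c * h x * h y" for x y
  have hh: "(\<Sum>x\<in>S. h x * h x) = 2 * (1 - v x0)"
  proof -
    have "(\<Sum>x\<in>S. h x * h x) = (\<Sum>x\<in>S. (v x)\<^sup>2) - 2 * (\<Sum>x\<in>S. if x = x0 then v x0 else 0) + (\<Sum>x\<in>S. if x = x0 then 1 else 0)"
      unfolding sum_distrib_left sum_subtractf[symmetric] sum.distrib[symmetric] h_def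
      by (rule sum.cong) (auto simp: power2_eq_square algebra_simps)
    also have "\<dots> = 2 * (1 - v x0)" using v fin x0 by simp
    finally show ?thesis .
  qed
  have c: "c * c * (\<Sum>x\<in>S. h x * h x) = 2 * c"
  proof (cases "v x0 = 1")
    case False
    then have "c * (1 - v x0) = 1" unfolding c_def by simp
    then have "c * c * (2 * (1 - v x0)) = 2 * c * 1"
      by (metis mult.assoc mult.commute)
    then show ?thesis unfolding hh by simp
  qed (simp add: c_def)
  have h0: "h x = 0" if "v x0 = 1" "x \<in> S" for x
    using hh that fin by (simp add: sum_nonneg_eq_0_iff)
  have "mprod S R R x y = of_bool (x = y)" if "x \<in> S" "y \<in> S" for x y
  proof -
    have "mprod S R R x y = (\<Sum>z\<in>S. (if z = x then of_bool (x = y) else 0)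
        - (if z = x then c * h x * h y else 0) - (if z = y then c * h x * h y else 0)
        + c * c * h x * h y * (h z * h z))"
      unfolding mprod_def R_def by (rule sum.cong) (auto simp: algebra_simps)
    also have "\<dots> = of_bool (x = y) - 2 * c * h x * h y + h x * h y * (c * c * (\<Sum>z\<in>S. h z * h z))"
      using fin that by (simp add: sum.distrib sum_subtractf sum_distrib_left algebra_simps)
    also have "\<dots> = of_bool (x = y)" unfolding c by simp
    finally show ?thesis .
  qed
  moreover have "R x x0 = v x" if "x \<in> S" for x
  proof (cases "v x0 = 1")
    case True
    then show ?thesis using h0[OF True that] h0[OF True x0] unfolding R_def h_def by auto
  next
    case False
    then have "c * h x0 = -1" unfolding c_def h_def by (simp add: field_simps)
    then have "R x x0 = of_bool (x = x0) + h x" unfolding R_def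
      by (metis (no_types, opaque_lifting) diff_minus_eq_add mult.assoc mult.commute mult_minus1)
    then show ?thesis unfolding h_def by simp
  qed
  moreover have "R x y = R y x" for x y unfolding R_def by auto
  ultimately show ?thesis by blast
qed

text \<open>Induction by deflation: conjugation with a reflection that takes the unit vector at
  \<open>x0\<close> to an eigenvector decouples \<open>x0\<close> from the other indices, and the
  induction hypothesis diagonalizes the remaining block. Eigenvalues are labelled by
  \<open>S\<close> itself, so no enumeration of \<open>S\<close> is carried along.\<close>

theorem symmetric_spectral:
  fixes M :: "'i \<Rightarrow> 'i \<Rightarrow> real"
  assumes "finite S" and "\<And>x y. x \<in> S \<Longrightarrow> y \<in> S \<Longrightarrow> M x y = M y x"
  shows "\<exists>e U. (\<forall>x\<in>S. \<forall>y\<in>S. (\<Sum>k\<in>S. U x k * U y k) = of_bool (x = y))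
     \<and> (\<forall>k\<in>S. \<forall>l\<in>S. (\<Sum>x\<in>S. U x k * U x l) = of_bool (k = l))
     \<and> (\<forall>x\<in>S. \<forall>y\<in>S. M x y = (\<Sum>k\<in>S. e k * U x k * U y k))"
  using assms
proof (induction S arbitrary: M rule: finite_induct)
  case empty
  then show ?case by auto
next
  case (insert x0 S' M)
  define S where "S = insert x0 S'"
  have fin: "finite S" and x0: "x0 \<in> S" and S': "S' = S - {x0}" using insert unfolding S_def by auto
  have sym: "\<And>x y. x \<in> S \<Longrightarrow> y \<in> S \<Longrightarrow> M x y = M y x"
    using insert.prems unfolding S_def by blast
  obtain e0 v where v: "(\<Sum>x\<in>S. (v x)\<^sup>2) = 1" "\<And>x. x \<in> S \<Longrightarrow> (\<Sum>y\<in>S. M x y * v y) = e0 * v x"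
  proof -
    have "\<exists>e v. (\<Sum>x\<in>S. (v x)\<^sup>2) = 1 \<and> (\<forall>x\<in>S. (\<Sum>y\<in>S. M x y * v y) = e * v x)"
      by (rule symmetric_eigenvector[OF fin]) (use x0 sym in auto)
    then show ?thesis using that by blast
  qed
  obtain R where R: "\<And>x y. R x y = R y x" "\<And>x y. x \<in> S \<Longrightarrow> y \<in> S \<Longrightarrow> mprod S R R x y = of_bool (x = y)"
    "\<And>x. x \<in> S \<Longrightarrow> R x x0 = v x"
    using householder[OF fin x0 v(1)] by blast
  define N where "N = mprod S R (mprod S M R)"
  have N0: "N x x0 = e0 * of_bool (x = x0)" if "x \<in> S" for x
  proof -
    have "N x x0 = mprod S R (\<lambda>a b. e0 * R a b) x x0"
      unfolding N_def
      by (rule mprod_cong) (auto simp: mprod_def R(3) v(2))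
    also have "\<dots> = e0 * mprod S R R x x0"
      unfolding mprod_def by (simp add: sum_distrib_left mult.left_commute)
    finally show ?thesis using R(2)[OF that x0] by simp
  qed
  have Nsym: "N x y = N y x" for x y
  proof -
    have "N x y = (\<Sum>a\<in>S. \<Sum>b\<in>S. R x a * M a b * R b y)"
      unfolding N_def mprod_def by (simp add: sum_distrib_left mult.assoc)
    also have "\<dots> = (\<Sum>a\<in>S. \<Sum>b\<in>S. R y b * M b a * R a x)"
      by (intro sum.cong refl) (simp add: sym R(1)[of x] R(1)[of y])
    also have "\<dots> = (\<Sum>b\<in>S. \<Sum>a\<in>S. R y b * M b a * R a x)" by (rule sum.swap)
    also have "\<dots> = N y x"
      unfolding N_def mprod_def by (simp add: sum_distrib_left mult.assoc)
    finally show ?thesis .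
  qed
  obtain e' U' where U': "\<And>x y. x \<in> S' \<Longrightarrow> y \<in> S' \<Longrightarrow> (\<Sum>k\<in>S'. U' x k * U' y k) = of_bool (x = y)"
    "\<And>k l. k \<in> S' \<Longrightarrow> l \<in> S' \<Longrightarrow> (\<Sum>x\<in>S'. U' x k * U' x l) = of_bool (k = l)"
    "\<And>x y. x \<in> S' \<Longrightarrow> y \<in> S' \<Longrightarrow> N x y = (\<Sum>k\<in>S'. e' k * U' x k * U' y k)"
    using insert.IH[of N] Nsym by blast
  \<comment> \<open>Block form: \<open>x0\<close> also serves as the label of the eigenvalue that
    was split off.\<close>
  define U where "U x k = (if x = x0 then of_bool (k = x0) else if k = x0 then 0 else U' x k)" for x k
  define e where "e k = (if k = x0 then e0 else e' k)" for k
  have split: "(\<Sum>k\<in>S. F k) = F x0 + (\<Sum>k\<in>S'. F k)" for F :: "'i \<Rightarrow> real"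
    unfolding S_def using insert by simp
  have nx: "k \<noteq> x0" if "k \<in> S'" for k using that S' by auto
  have U1: "mprod S U (\<lambda>k y. U y k) x y = of_bool (x = y)" if "x \<in> S" "y \<in> S" for x y
    unfolding mprod_def split using that U'(1)[of x y] nx
    by (cases "x = x0"; cases "y = x0") (auto simp: U_def S_def cong: sum.cong)
  have U2: "mprod S (\<lambda>k y. U y k) U k l = of_bool (k = l)" if "k \<in> S" "l \<in> S" for k l
    unfolding mprod_def split using that U'(2)[of k l] nx
    by (cases "k = x0"; cases "l = x0") (auto simp: U_def S_def cong: sum.cong)
  define D where "D k l = e k * of_bool (k = l)" for k l
  have UD: "mprod S U D x k = e k * U x k" if "k \<in> S" for x k
  proof -
    have "mprod S U D x k = (\<Sum>z\<in>S. if z = k then e k * U x k else 0)"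
      unfolding mprod_def D_def by (rule sum.cong) auto
    then show ?thesis using fin that by simp
  qed
  have U3: "N x y = mprod S (mprod S U D) (\<lambda>k y. U y k) x y" if xy: "x \<in> S" "y \<in> S" for x y
  proof -
    have "mprod S (mprod S U D) (\<lambda>k y. U y k) x y = (\<Sum>k\<in>S. e k * U x k * U y k)"
      unfolding mprod_def[of S "mprod S U D"] by (rule sum.cong) (auto simp: UD)
    also have "\<dots> = N x y"
      unfolding split using that U'(3)[of x y] N0[of x] N0[of y] Nsym[of x y] nx
      by (cases "x = x0"; cases "y = x0") (auto simp: U_def S_def e_def cong: sum.cong)
    finally show ?thesis by simp
  qed
  define V where "V = mprod S R U"
  have VT: "(\<lambda>k y. V y k) = mprod S (\<lambda>k y. U y k) R"
    unfolding V_def mprod_def fun_eq_iff by (subst R(1)) (simp add: mult.commute)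
  have "(\<Sum>k\<in>S. V x k * V y k) = of_bool (x = y)" if "x \<in> S" "y \<in> S" for x y
  proof -
    have "(\<Sum>k\<in>S. V x k * V y k) = mprod S V (\<lambda>k y. V y k) x y" by (simp add: mprod_def)
    also have "\<dots> = mprod S R (mprod S (mprod S U (\<lambda>k y. U y k)) R) x y"
      unfolding VT unfolding V_def by (simp only: mprod_assoc)
    also have "\<dots> = mprod S R R x y"
      by (intro mprod_cong refl mprod_id_left[OF fin] U1)
    finally show ?thesis using R(2)[OF that] by simp
  qed
  moreover have "(\<Sum>x\<in>S. V x k * V x l) = of_bool (k = l)" if "k \<in> S" "l \<in> S" for k l
  proof -
    have "(\<Sum>x\<in>S. V x k * V x l) = mprod S (\<lambda>k y. V y k) V k l" by (simp add: mprod_def)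
    also have "\<dots> = mprod S (\<lambda>k y. U y k) (mprod S (mprod S R R) U) k l"
      unfolding VT unfolding V_def by (simp only: mprod_assoc)
    also have "\<dots> = mprod S (\<lambda>k y. U y k) U k l"
      by (intro mprod_cong refl mprod_id_left[OF fin] R(2))
    finally show ?thesis using U2[OF that] by simp
  qed
  moreover have "M x y = (\<Sum>k\<in>S. e k * V x k * V y k)" if "x \<in> S" "y \<in> S" for x y
  proof -
    have VD: "mprod S V D x k = e k * V x k" if "k \<in> S" for k
    proof -
      have "mprod S V D x k = mprod S R (\<lambda>x k. e k * U x k) x k"
        unfolding V_def mprod_assoc by (intro mprod_cong refl UD that)
      then show ?thesis unfolding V_def mprod_def by (simp add: sum_distrib_left mult.left_commute)
    qed
    \<comment> \<open>\<open>R\<close> is its own inverse on \<open>S\<close>, so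
      \<open>mprod S R R\<close> may be inserted on both sides of \<open>M\<close>.\<close>
    have "M x y = mprod S (mprod S R R) (mprod S M (mprod S R R)) x y"
      using that R(2) by (subst mprod_id_left[OF fin], simp_all) (subst mprod_id_right[OF fin], simp_all)
    also have "\<dots> = mprod S R (mprod S N R) x y"
      unfolding N_def by (simp only: mprod_assoc)
    also have "\<dots> = mprod S R (mprod S (mprod S (mprod S U D) (\<lambda>k y. U y k)) R) x y"
      by (intro mprod_cong refl U3)
    also have "\<dots> = mprod S (mprod S V D) (\<lambda>k y. V y k) x y"
      unfolding VT unfolding V_def by (simp only: mprod_assoc)
    also have "\<dots> = (\<Sum>k\<in>S. e k * V x k * V y k)"
      unfolding mprod_def[of S "mprod S V D"] by (rule sum.cong) (auto simp: VD)
    finally show ?thesis .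
  qed
  ultimately show ?case unfolding S_def by blast
qed

section \<open>Characteristic polynomial and trace in terms of the eigenvalues\<close>

lemma det_on_reindex:
  assumes f: "bij_betw f {0..<n} S"
  shows "det_on S M = Determinant.det (mat n n (\<lambda>(i,j). M (f i) (f j)))"
proof -
  let ?g = "\<lambda>p x. if x \<in> S then f (p (inv_into {0..<n} f x)) else x"
  have inj: "inj_on f {0..<n}" and img: "f ` {0..<n} = S" using f by (auto simp: bij_betw_def)
  have "det_on S M = (\<Sum>p | p permutes {0..<n}. of_int (sign (?g p)) * (\<Prod>x\<in>S. M x (?g p x)))"
    unfolding det_on_def by (rule sum.reindex_bij_betw[OF bij_betw_permutations[OF f], symmetric])
  also have "\<dots> = (\<Sum>p | p permutes {0..<n}. of_int (sign p) * (\<Prod>i=0..<n. M (f i) (f (p i))))"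
  proof (rule sum.cong[OF refl])
    fix p assume "p \<in> {p. p permutes {0..<n}}"
    then have p: "p permutes {0..<n}" by simp
    have "?g p = map_permutation {0..<n} f p"
      unfolding map_permutation_def restrict_id_def img by (auto simp: fun_eq_iff)
    then have "sign (?g p) = sign p" using sign_map_permutation[OF inj p] by simp
    moreover have "(\<Prod>x\<in>S. M x (?g p x)) = (\<Prod>i=0..<n. M (f i) (f (p i)))"
      unfolding prod.reindex_bij_betw[OF f, symmetric]
      using bij_betwE[OF f] bij_betw_inv_into_left[OF f] by (intro prod.cong) auto
    ultimately show "of_int (sign (?g p)) * (\<Prod>x\<in>S. M x (?g p x)) =
      of_int (sign p) * (\<Prod>i=0..<n. M (f i) (f (p i)))" by simp
  qed
  also have "\<dots> = Determinant.det (mat n n (\<lambda>(i,j). M (f i) (f j)))"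
  proof -
    have "p i < n" if "p permutes {0..<n}" "i < n" for p i
      using permutes_in_image[OF that(1), of i] that(2) by auto
    then show ?thesis by (subst det_def'[of _ n]) (auto intro!: sum.cong prod.cong)
  qed
  finally show ?thesis .
qed

text \<open>The eigenvector equation reads \<open>?A * ?U = ?U * ?D\<close> for matrices over the
  polynomial ring. The determinant of the constant matrix \<open>?U\<close> is nonzero by
  orthogonality and cancels, leaving the diagonal determinant.\<close>

lemma charpoly_on_spectral:
  fixes M :: "'i \<Rightarrow> 'i \<Rightarrow> real"
  assumes fin: "finite S"
    and U2: "\<And>k l. k \<in> S \<Longrightarrow> l \<in> S \<Longrightarrow> (\<Sum>x\<in>S. U x k * U x l) = of_bool (k = l)"
    and eig: "\<And>x l. x \<in> S \<Longrightarrow> l \<in> S \<Longrightarrow> (\<Sum>y\<in>S. M x y * U y l) = e l * U x l"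
  shows "charpoly_on S M = (\<Prod>k\<in>S. [:- e k, 1:])"
proof -
  define n where "n = card S"
  obtain f where f: "bij_betw f {0..<n} S"
    using ex_bij_betw_nat_finite[OF fin] unfolding n_def by blast
  have fS: "f i \<in> S" if "i < n" for i using bij_betwE[OF f] that by auto
  have inj: "f i = f j \<longleftrightarrow> i = j" if "i < n" "j < n" for i j
    using f that unfolding bij_betw_def inj_on_def by auto
  let ?A = "mat n n (\<lambda>(i,j). (if f i = f j then [:0,1:] else 0) - [:M (f i) (f j):])"
  let ?U = "mat n n (\<lambda>(i,j). [:U (f i) (f j):])"
  let ?UT = "mat n n (\<lambda>(i,j). [:U (f j) (f i):])"
  let ?D = "mat n n (\<lambda>(i,j). if i = j then [:- e (f i), 1:] else 0)"
  have AU: "?A * ?U = ?U * ?D"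
  proof (rule eq_matI)
    fix i j assume "i < dim_row (?U * ?D)" "j < dim_col (?U * ?D)"
    then have ij: "i < n" "j < n" by auto
    have "(?A * ?U) $$ (i,j) = (\<Sum>k=0..<n. ((if f i = f k then [:0,1:] else 0) - [:M (f i) (f k):]) * [:U (f k) (f j):])"
      using ij by (simp add: scalar_prod_def)
    also have "\<dots> = (\<Sum>x\<in>S. ((if f i = x then [:0,1:] else 0) - [:M (f i) x:]) * [:U x (f j):])"
      by (rule sum.reindex_bij_betw[OF f])
    also have "\<dots> = (\<Sum>x\<in>S. (if x = f i then [:0,1:] * [:U (f i) (f j):] else 0) - [:M (f i) x * U x (f j):])"
      by (rule sum.cong) (auto simp: algebra_simps)
    also have "\<dots> = [:0,1:] * [:U (f i) (f j):] - [:\<Sum>x\<in>S. M (f i) x * U x (f j):]"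
    proof -
      have "(\<Sum>x\<in>S. [:M (f i) x * U x (f j):]) = [:\<Sum>x\<in>S. M (f i) x * U x (f j):]"
        by (simp add: sum_to_poly)
      then show ?thesis
      using fin fS[OF ij(1)] by (simp add: sum_subtractf)
    qed
    also have "\<dots> = [:U (f i) (f j):] * [:- e (f j), 1:]"
      using eig[OF fS[OF ij(1)] fS[OF ij(2)]] by simp
    also have "\<dots> = (\<Sum>k=0..<n. if k = j then [:U (f i) (f j):] * [:- e (f j), 1:] else 0)"
      using ij by simp
    also have "\<dots> = (\<Sum>k=0..<n. [:U (f i) (f k):] * (if k = j then [:- e (f k), 1:] else 0))"
      by (rule sum.cong) auto
    also have "\<dots> = (?U * ?D) $$ (i,j)"
      using ij by (simp add: scalar_prod_def)
    finally show "(?A * ?U) $$ (i,j) = (?U * ?D) $$ (i,j)" .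
  qed auto
  have UU: "?UT * ?U = 1\<^sub>m n"
  proof (rule eq_matI)
    fix i j assume "i < dim_row (1\<^sub>m n :: real poly mat)" "j < dim_col (1\<^sub>m n:: real poly mat)"
    then have ij: "i < n" "j < n" by auto
    have "(?UT * ?U) $$ (i,j) = (\<Sum>k=0..<n. [:U (f k) (f i) * U (f k) (f j):])"
      using ij by (simp add: scalar_prod_def mult.commute)
    also have "\<dots> = (\<Sum>x\<in>S. [:U x (f i) * U x (f j):])"
      by (rule sum.reindex_bij_betw[OF f])
    also have "\<dots> = [:\<Sum>x\<in>S. U x (f i) * U x (f j):]" by (simp add: sum_to_poly)
    also have "\<dots> = (1\<^sub>m n) $$ (i,j)"
      using ij U2[OF fS fS, of i j] inj[of i j] by auto
    finally show "(?UT * ?U) $$ (i,j) = (1\<^sub>m n) $$ (i,j)" .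
  qed auto
  have "Determinant.det ?UT * Determinant.det ?U = 1"
    using det_mult[of ?UT n ?U] UU by simp
  then have U0: "Determinant.det ?U \<noteq> 0" by auto
  have "Determinant.det ?A * Determinant.det ?U = Determinant.det ?U * Determinant.det ?D"
    unfolding det_mult[of ?A n ?U, symmetric, OF mat_carrier mat_carrier]
      det_mult[of ?U n ?D, symmetric, OF mat_carrier mat_carrier] AU ..
  then have "Determinant.det ?A = Determinant.det ?D" using U0 by simp
  also have "\<dots> = prod_list (diag_mat ?D)"
    by (rule det_upper_triangular[of _ n]) auto
  also have "\<dots> = (\<Prod>i=0..<n. [:- e (f i), 1:])"
    by (simp add: prod_list_diag_prod)
  also have "\<dots> = (\<Prod>k\<in>S. [:- e k, 1:])"
    by (rule prod.reindex_bij_betw[OF f])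
  finally show ?thesis unfolding charpoly_on_def det_on_reindex[OF f] by simp
qed

text \<open>The order of a root is the number of labels carrying that eigenvalue, so the sum over
  roots is the sum over labels grouped by the fibres of \<open>e\<close>.\<close>

lemma trace_fun_on_spectral:
  fixes M :: "'i \<Rightarrow> 'i \<Rightarrow> real"
  assumes fin: "finite S" and ch: "charpoly_on S M = (\<Prod>k\<in>S. [:- e k, 1:])"
  shows "trace_fun_on S F M = (\<Sum>k\<in>S. F (e k))"
proof -
  have ord: "order x (\<Prod>k\<in>S. [:- e k, 1:]) = card {k\<in>S. e k = x}" for x
  proof -
    have "order x (\<Prod>k\<in>S. [:- e k, 1:]) = (\<Sum>k\<in>S. order x [:- e k, 1:])"
      using fin
    proof (induction S rule: finite_induct)
      case (insert a T)
      have "(\<Prod>k\<in>T. [:- e k, 1:]) \<noteq> 0"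
        using insert by simp
      then have nz: "[:- e a, 1:] * (\<Prod>k\<in>T. [:- e k, 1:]) \<noteq> 0"
        by (metis mult_eq_0_iff pCons_eq_0_iff zero_neq_one)
      have "order x (\<Prod>k\<in>insert a T. [:- e k, 1:]) = order x ([:- e a, 1:] * (\<Prod>k\<in>T. [:- e k, 1:]))"
        by (subst prod.insert[OF insert.hyps(1,2)]) (rule refl)
      also have "\<dots> = order x [:- e a, 1:] + order x (\<Prod>k\<in>T. [:- e k, 1:])"
        by (rule order_mult[OF nz])
      finally show ?case using insert.hyps insert.IH by simp
    qed (simp add: order_0I)
    also have "\<dots> = (\<Sum>k\<in>S. if e k = x then 1 else 0)"
    proof (rule sum.cong[OF refl])
      fix k
      show "order x [:- e k, 1:] = (if e k = x then 1 else 0)"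
        using order_power_n_n[of "e k" 1] by (auto intro: order_0I)
    qed
    also have "\<dots> = card {k\<in>S. e k = x}" using fin by (simp add: sum.If_cases Int_def)
    finally show ?thesis .
  qed
  have roots: "{x. poly (charpoly_on S M) x = 0} = e ` S"
    unfolding ch using fin by (auto simp: poly_prod prod_zero_iff)
  have "trace_fun_on S F M = (\<Sum>x\<in>e ` S. real (card {k\<in>S. e k = x}) * F x)"
    unfolding trace_fun_on_def roots unfolding ch ord ..
  also have "\<dots> = (\<Sum>x\<in>e ` S. \<Sum>k | k \<in> S \<and> e k = x. F (e k))"
    by (rule sum.cong) auto
  also have "\<dots> = (\<Sum>k\<in>S. F (e k))"
    using sum.image_gen[OF fin, of "\<lambda>k. F (e k)" e] by simp
  finally show ?thesis .
qed

section \<open>Stieltjes transforms\<close>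

definition stieltjes :: "real measure \<Rightarrow> complex \<Rightarrow> complex" where
  "stieltjes \<mu> z = (\<integral>E. 1 / (complex_of_real E - z) \<partial>\<mu>)"

lemma norm_cauchy_kernel_le:
  assumes "Im z \<noteq> 0"
  shows "norm (1 / (complex_of_real E - z)) \<le> 1 / \<bar>Im z\<bar>"
proof -
  have "\<bar>Im z\<bar> \<le> norm (complex_of_real E - z)"
    using abs_Im_le_cmod[of "complex_of_real E - z"] by simp
  then show ?thesis using assms by (simp add: norm_divide frac_le)
qed

lemma Im_cauchy_kernel:
  "Im (1 / (complex_of_real E - Complex x \<eta>)) = \<eta> / ((E - x)\<^sup>2 + \<eta>\<^sup>2)"
  by (simp add: Im_divide power2_eq_square)

context real_distribution
begin

lemma integrable_cauchy_kernel:
  assumes "Im z \<noteq> 0"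
  shows "integrable M (\<lambda>E. 1 / (complex_of_real E - z))"
  by (rule integrable_const_bound[where B="1 / \<bar>Im z\<bar>"]) (auto simp: norm_cauchy_kernel_le assms)

lemma stieltjes_cnj: "stieltjes M (cnj z) = cnj (stieltjes M z)"
proof -
  have "(\<lambda>E. 1 / (complex_of_real E - cnj z)) = (\<lambda>E. cnj (1 / (complex_of_real E - z)))"
    by (simp add: fun_eq_iff)
  then show ?thesis unfolding stieltjes_def by (simp only: Bochner_Integration.integral_cnj)
qed

text \<open>The kernel obeys the resolvent identity. The Lipschitz constant does not depend on the
  measure, so convergence at a dense set of points spreads to the whole half-plane.\<close>

lemma stieltjes_diff_le:
  assumes z: "Im z \<noteq> 0" and w: "Im w \<noteq> 0"
  shows "norm (stieltjes M z - stieltjes M w) \<le> norm (z - w) / (\<bar>Im z\<bar> * \<bar>Im w\<bar>)"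
proof -
  have nz: "complex_of_real E \<noteq> z" "complex_of_real E \<noteq> w" for E using z w by auto
  let ?k = "\<lambda>E. (z - w) * (1 / (complex_of_real E - z) * (1 / (complex_of_real E - w)))"
  let ?B = "norm (z - w) / (\<bar>Im z\<bar> * \<bar>Im w\<bar>)"
  have bound: "norm (?k E) \<le> ?B" for E
  proof -
    have "norm (1 / (complex_of_real E - z)) * norm (1 / (complex_of_real E - w)) \<le> 1 / \<bar>Im z\<bar> * (1 / \<bar>Im w\<bar>)"
      by (intro mult_mono norm_cauchy_kernel_le z w) auto
    then have "norm (z - w) * (norm (1 / (complex_of_real E - z)) * norm (1 / (complex_of_real E - w)))
        \<le> norm (z - w) * (1 / \<bar>Im z\<bar> * (1 / \<bar>Im w\<bar>))"
      by (rule mult_left_mono) simp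
    then show ?thesis by (simp add: norm_mult norm_divide)
  qed
  have "stieltjes M z - stieltjes M w = (\<integral>E. 1 / (complex_of_real E - z) - 1 / (complex_of_real E - w) \<partial>M)"
    unfolding stieltjes_def by (rule Bochner_Integration.integral_diff[symmetric]) (rule integrable_cauchy_kernel[OF z] integrable_cauchy_kernel[OF w])+
  also have "(\<lambda>E. 1 / (complex_of_real E - z) - 1 / (complex_of_real E - w)) =
      (\<lambda>E. (z - w) * (1 / (complex_of_real E - z) * (1 / (complex_of_real E - w))))"
    using nz by (simp add: fun_eq_iff field_simps)
  also have "norm (\<integral>E. ?k E \<partial>M) \<le> (\<integral>E. norm (z - w) / (\<bar>Im z\<bar> * \<bar>Im w\<bar>) \<partial>M)"
  proof (rule Bochner_Integration.integral_norm_bound_integral)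
    show "norm (?k E) \<le> ?B" for E by (rule bound)
    show "integrable M ?k"
      by (rule integrable_const_bound[OF AE_I2]) (rule bound, measurable)
  qed simp
  also have "\<dots> = norm (z - w) / (\<bar>Im z\<bar> * \<bar>Im w\<bar>)" using prob_space by simp
  finally show ?thesis .
qed

section \<open>Stieltjes inversion and uniqueness\<close>

lemma Im_stieltjes:
  assumes "\<eta> > 0"
  shows "Im (stieltjes M (Complex x \<eta>)) = (\<integral>E. \<eta> / ((E - x)\<^sup>2 + \<eta>\<^sup>2) \<partial>M)"
    and "integrable M (\<lambda>E. \<eta> / ((E - x)\<^sup>2 + \<eta>\<^sup>2))"
proof -
  have i: "integrable M (\<lambda>E. 1 / (complex_of_real E - Complex x \<eta>))"
    by (rule integrable_cauchy_kernel) (use assms in simp)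
  show "Im (stieltjes M (Complex x \<eta>)) = (\<integral>E. \<eta> / ((E - x)\<^sup>2 + \<eta>\<^sup>2) \<partial>M)"
    unfolding stieltjes_def integral_Im[OF i, symmetric] Im_cauchy_kernel ..
  show "integrable M (\<lambda>E. \<eta> / ((E - x)\<^sup>2 + \<eta>\<^sup>2))"
    using integrable_Im[OF i] unfolding Im_cauchy_kernel .
qed

text \<open>The imaginary part is an integral of Poisson kernels. After exchanging the integrals,
  the inner one has an explicit arctan antiderivative.\<close>

lemma nn_integral_Im_stieltjes:
  assumes \<eta>: "\<eta> > 0" and ac: "a \<le> c"
  shows "(\<integral>\<^sup>+x\<in>{a..c}. ennreal (Im (stieltjes M (Complex x \<eta>))) \<partial>lborel)
     = ennreal (\<integral>E. arctan ((c - E) / \<eta>) - arctan ((a - E) / \<eta>) \<partial>M)"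
proof -
  interpret P: pair_sigma_finite lborel M ..
  have inner: "(\<integral>\<^sup>+x. ennreal (\<eta> / ((E - x)\<^sup>2 + \<eta>\<^sup>2)) * indicator {a..c} x \<partial>lborel)
      = ennreal (arctan ((c - E) / \<eta>) - arctan ((a - E) / \<eta>))" for E
  proof (rule nn_integral_FTC_Icc[where F="\<lambda>x. arctan ((x - E) / \<eta>)"])
    fix x assume "x \<in> {a..c}"
    have "((\<lambda>x. arctan ((x - E) / \<eta>)) has_real_derivative (1 / \<eta> / (1 + ((x - E) / \<eta>)\<^sup>2))) (at x)"
      using \<eta> by (auto intro!: derivative_eq_intros simp: field_simps)
    moreover have "1 / \<eta> / (1 + ((x - E) / \<eta>)\<^sup>2) = \<eta> / ((E - x)\<^sup>2 + \<eta>\<^sup>2)"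
    proof -
      have "(E - x)\<^sup>2 + \<eta>\<^sup>2 > 0" using \<eta> by (simp add: add_nonneg_pos)
      then show ?thesis using \<eta> by (simp add: field_simps power2_eq_square)
    qed
    ultimately show "((\<lambda>x. arctan ((x - E) / \<eta>)) has_real_derivative \<eta> / ((E - x)\<^sup>2 + \<eta>\<^sup>2)) (at x)"
      by simp
  qed (use \<eta> ac in auto)
  have "(\<integral>\<^sup>+x\<in>{a..c}. ennreal (Im (stieltjes M (Complex x \<eta>))) \<partial>lborel)
      = (\<integral>\<^sup>+x. \<integral>\<^sup>+E. ennreal (\<eta> / ((E - x)\<^sup>2 + \<eta>\<^sup>2)) * indicator {a..c} x \<partial>M \<partial>lborel)"
  proof (rule nn_integral_cong)
    fix x :: real
    have "ennreal (Im (stieltjes M (Complex x \<eta>))) = (\<integral>\<^sup>+E. ennreal (\<eta> / ((E - x)\<^sup>2 + \<eta>\<^sup>2)) \<partial>M)"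
      unfolding Im_stieltjes(1)[OF \<eta>]
      by (rule nn_integral_eq_integral[symmetric]) (use Im_stieltjes(2)[OF \<eta>] \<eta> in auto)
    then show "ennreal (Im (stieltjes M (Complex x \<eta>))) * indicator {a..c} x
       = (\<integral>\<^sup>+E. ennreal (\<eta> / ((E - x)\<^sup>2 + \<eta>\<^sup>2)) * indicator {a..c} x \<partial>M)"
      by (simp add: nn_integral_multc)
  qed
  also have "\<dots> = (\<integral>\<^sup>+E. \<integral>\<^sup>+x. ennreal (\<eta> / ((E - x)\<^sup>2 + \<eta>\<^sup>2)) * indicator {a..c} x \<partial>lborel \<partial>M)"
    by (rule P.Fubini'[symmetric]) measurable
  also have "\<dots> = (\<integral>\<^sup>+E. ennreal (arctan ((c - E) / \<eta>) - arctan ((a - E) / \<eta>)) \<partial>M)"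
    unfolding inner ..
  also have "\<dots> = ennreal (\<integral>E. arctan ((c - E) / \<eta>) - arctan ((a - E) / \<eta>) \<partial>M)"
  proof (rule nn_integral_eq_integral)
    show "integrable M (\<lambda>E. arctan ((c - E) / \<eta>) - arctan ((a - E) / \<eta>))"
    proof (rule integrable_const_bound[where B=pi])
      show "AE E in M. norm (arctan ((c - E) / \<eta>) - arctan ((a - E) / \<eta>)) \<le> pi"
      proof (rule AE_I2)
        fix E
        show "norm (arctan ((c - E) / \<eta>) - arctan ((a - E) / \<eta>)) \<le> pi"
          using arctan_bounded[of "(c - E) / \<eta>"] arctan_bounded[of "(a - E) / \<eta>"] by auto
      qed
    qed measurable
    show "AE E in M. 0 \<le> arctan ((c - E) / \<eta>) - arctan ((a - E) / \<eta>)"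
      using ac \<eta> by (auto intro!: AE_I2 simp: arctan_le_iff divide_right_mono)
  qed
  finally show ?thesis .
qed

text \<open>The right end point is moved outwards by \<open>1/n\<close>, which is large compared with \<open>\<eta> = 1/n\<^sup>2\<close>,
  so that an atom at \<open>b\<close> is counted with its full mass.\<close>
theorem stieltjes_inversion:
  "(\<lambda>n. enn2real (\<integral>\<^sup>+x\<in>{- real (Suc n)..b + 1 / real (Suc n)}.
        ennreal (Im (stieltjes M (Complex x (1 / (real (Suc n))\<^sup>2)))) \<partial>lborel) / pi) \<longlonglongrightarrow> cdf M b"
proof -
  define f where "f n E = arctan ((b + 1 / real (Suc n) - E) / (1 / (real (Suc n))\<^sup>2))
     - arctan ((- real (Suc n) - E) / (1 / (real (Suc n))\<^sup>2))" for n E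
  \<comment> \<open>For small \<open>n\<close> the end points of the interval may be in the wrong
    order.\<close>
  have "eventually (\<lambda>n. real n \<ge> - b) sequentially"
    by (rule eventually_sequentiallyI[of "nat \<lceil>- b\<rceil>"]) linarith
  then have ev: "eventually (\<lambda>n. (\<integral>E. f n E \<partial>M) / pi =
     enn2real (\<integral>\<^sup>+x\<in>{- real (Suc n)..b + 1 / real (Suc n)}.
        ennreal (Im (stieltjes M (Complex x (1 / (real (Suc n))\<^sup>2)))) \<partial>lborel) / pi) sequentially"
  proof eventually_elim
    case (elim n)
    have le: "- real (Suc n) \<le> b + 1 / real (Suc n)"
      using elim by (smt (verit) divide_nonneg_nonneg of_nat_0_le_iff of_nat_Suc)
    have "(\<integral>E. f n E \<partial>M) \<ge> 0"
      using le by (intro integral_nonneg_AE AE_I2)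
        (auto simp: f_def arctan_le_iff intro!: mult_right_mono)
    then show ?case
      using nn_integral_Im_stieltjes[OF _ le, of "1 / (real (Suc n))\<^sup>2"] by (simp add: f_def)
  qed
  have lim: "(\<lambda>n. f n E) \<longlonglongrightarrow> pi * indicator {..b} E" for E
  proof -
    have "(\<lambda>n. arctan ((- real (Suc n) - E) / (1 / (real (Suc n))\<^sup>2))) \<longlonglongrightarrow> - (pi/2)"
      by (rule filterlim_compose[OF tendsto_arctan_at_bot]) real_asymp
    moreover have "(\<lambda>n. arctan ((b + 1 / real (Suc n) - E) / (1 / (real (Suc n))\<^sup>2)))
       \<longlonglongrightarrow> (if E \<le> b then pi/2 else - (pi/2))"
    proof (cases "E \<le> b")
      case True
      have "filterlim (\<lambda>n. real (Suc n)) at_top sequentially" by real_asymp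
      moreover have "real (Suc n) \<le> (b + 1 / real (Suc n) - E) / (1 / (real (Suc n))\<^sup>2)" for n
      proof -
        have "(b + 1 / real (Suc n) - E) / (1 / (real (Suc n))\<^sup>2) = (b - E) * (real (Suc n))\<^sup>2 + real (Suc n)"
          by (simp add: field_simps power2_eq_square)
        then show ?thesis using True by simp
      qed
      ultimately have "filterlim (\<lambda>n. (b + 1 / real (Suc n) - E) / (1 / (real (Suc n))\<^sup>2)) at_top sequentially"
        by (auto elim!: filterlim_at_top_mono)
      then show ?thesis using True filterlim_compose[OF tendsto_arctan_at_top] by auto
    next
      case False
      then have "b - E < 0" by simp
      then have "filterlim (\<lambda>n. ((b - E) + 1 / real (Suc n)) / (1 / (real (Suc n))\<^sup>2)) at_bot sequentially"
        by real_asymp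
      then have "filterlim (\<lambda>n. (b + 1 / real (Suc n) - E) / (1 / (real (Suc n))\<^sup>2)) at_bot sequentially"
        by (simp add: algebra_simps)
      then show ?thesis using False filterlim_compose[OF tendsto_arctan_at_bot] by auto
    qed
    ultimately have "(\<lambda>n. f n E) \<longlonglongrightarrow> (if E \<le> b then pi/2 else - (pi/2)) - (- (pi/2))"
      unfolding f_def by (rule tendsto_diff[rotated])
    then show ?thesis by (auto simp: indicator_def)
  qed
  have "(\<lambda>n. \<integral>E. f n E \<partial>M) \<longlonglongrightarrow> (\<integral>E. pi * indicator {..b} E \<partial>M)"
  proof (rule integral_dominated_convergence[where w="\<lambda>_. pi"])
    show "AE E in M. (\<lambda>n. f n E) \<longlonglongrightarrow> pi * indicator {..b} E" by (rule AE_I2) (rule lim)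
    fix n show "AE E in M. norm (f n E) \<le> pi"
    proof (rule AE_I2)
      fix E
      show "norm (f n E) \<le> pi"
        using arctan_bounded[of "(b + 1 / real (Suc n) - E) / (1 / (real (Suc n))\<^sup>2)"]
          arctan_bounded[of "(- real (Suc n) - E) / (1 / (real (Suc n))\<^sup>2)"] unfolding f_def by auto
    qed
    show "f n \<in> borel_measurable M" unfolding f_def by measurable
  qed auto
  then have "(\<lambda>n. (\<integral>E. f n E \<partial>M) / pi) \<longlonglongrightarrow> (\<integral>E. pi * indicator {..b} E \<partial>M) / pi"
    by (rule tendsto_divide) auto
  also have "(\<integral>E. pi * indicator {..b} E \<partial>M) / pi = cdf M b"
    by (simp add: cdf_def)
  finally show ?thesis by (rule Lim_transform_eventually[OF _ ev])
qed

end

lemma stieltjes_unique: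
  assumes \<mu>: "real_distribution \<mu>" and \<nu>: "real_distribution \<nu>"
    and eq: "\<And>z. Im z > 0 \<Longrightarrow> stieltjes \<mu> z = stieltjes \<nu> z"
  shows "\<mu> = \<nu>"
proof (rule cdf_unique[OF \<mu> \<nu>], rule ext)
  fix b
  have "Im (Complex x (1 / (real (Suc n))\<^sup>2)) > 0" for x n by simp
  note e = eq[OF this]
  show "cdf \<mu> b = cdf \<nu> b"
    using LIMSEQ_unique[OF real_distribution.stieltjes_inversion[OF \<mu>, of b, unfolded e]
        real_distribution.stieltjes_inversion[OF \<nu>, of b]] .
qed

section \<open>Weak convergence, tightness and Stieltjes transforms\<close>

lemma weak_conv_stieltjes:
  assumes "\<And>n. real_distribution (\<mu> n)" "real_distribution \<nu>" "weak_conv_m \<mu> \<nu>" and z: "Im z \<noteq> 0"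
  shows "(\<lambda>n. stieltjes (\<mu> n) z) \<longlonglongrightarrow> stieltjes \<nu> z"
  unfolding stieltjes_def
proof (rule weak_conv_imp_integral_bdd_continuous_conv[OF assms(1-3)])
  fix x :: real
  have "complex_of_real x \<noteq> z" using z by auto
  then show "isCont (\<lambda>E. 1 / (complex_of_real E - z)) x" by (intro continuous_intros) auto
  show "norm (1 / (complex_of_real x - z)) \<le> 1 / \<bar>Im z\<bar>" by (rule norm_cauchy_kernel_le[OF z])
qed

text \<open>Tightness provides a weakly convergent subsequence, and its limit must have transform
  \<open>G\<close>. This is how the canopy spectral measures come into existence.\<close>

lemma tight_stieltjes_limit:
  assumes t: "tight \<mu>" and lim: "\<And>z. Im z > 0 \<Longrightarrow> (\<lambda>n. stieltjes (\<mu> n) z) \<longlonglongrightarrow> G z"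
  shows "\<exists>\<nu>. real_distribution \<nu> \<and> (\<forall>z. Im z > 0 \<longrightarrow> stieltjes \<nu> z = G z)"
proof -
  have rd: "\<And>n. real_distribution (\<mu> n)" using t unfolding tight_def by auto
  obtain r \<nu> where r: "strict_mono r" "real_distribution \<nu>" "weak_conv_m (\<mu> \<circ> id \<circ> r) \<nu>"
    using tight_imp_convergent_subsubsequence[OF t strict_mono_id] by blast
  have "stieltjes \<nu> z = G z" if "Im z > 0" for z
  proof -
    have "(\<lambda>n. stieltjes ((\<mu> \<circ> id \<circ> r) n) z) \<longlonglongrightarrow> stieltjes \<nu> z"
      by (rule weak_conv_stieltjes[OF _ r(2,3)]) (use rd that in auto)
    moreover have "(\<lambda>n. stieltjes ((\<mu> \<circ> id \<circ> r) n) z) \<longlonglongrightarrow> G z"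
      using LIMSEQ_subseq_LIMSEQ[OF lim[OF that] r(1)] by (simp add: comp_def)
    ultimately show ?thesis by (rule LIMSEQ_unique)
  qed
  then show ?thesis using r(2) by blast
qed

text \<open>The function \<open>y * h E\<close> lies between 0 and 1 and is at most 1/2 outside
  \<open>{-y..y}\<close>, so \<open>2 * (1 - y * h E)\<close> dominates the indicator of the
  complement.\<close>

lemma (in real_distribution) mass_outside_le:
  assumes y: "y > 0"
  shows "1 - measure M {-y..y} \<le> 2 * (1 - y * Im (stieltjes M (Complex 0 y)))"
proof -
  define h where "h E = y / ((E - 0)\<^sup>2 + y\<^sup>2)" for E
  have i: "integrable M h"
    unfolding h_def by (rule Im_stieltjes(2)[OF y])
  have "1 - measure M {-y..y} = measure M (space M - {-y..y})"
    by (subst prob_compl) auto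
  also have "\<dots> = (\<integral>E. indicator (space M - {-y..y}) E \<partial>M)" by simp
  also have "\<dots> \<le> (\<integral>E. 2 * (1 - y * h E) \<partial>M)"
  proof (rule integral_mono)
    show "integrable M (\<lambda>E. 2 * (1 - y * h E))"
      using i by (intro integrable_mult_right integrable_diff) auto
    fix E assume "E \<in> space M"
    have p: "E\<^sup>2 + y\<^sup>2 > 0" using y by (simp add: add_nonneg_pos)
    show "indicator (space M - {-y..y}) E \<le> 2 * (1 - y * h E)"
    proof (cases "E \<in> {-y..y}")
      case True
      then show ?thesis using p by (simp add: h_def field_simps power2_eq_square)
    next
      case False
      then have "y\<^sup>2 \<le> E\<^sup>2" using y by (auto simp: abs_le_square_iff[symmetric])
      then show ?thesis using p False by (simp add: h_def field_simps power2_eq_square)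
    qed
  qed (auto intro!: integrable_real_indicator simp: less_top[symmetric])
  also have "\<dots> = 2 * (1 - y * Im (stieltjes M (Complex 0 y)))"
    unfolding Im_stieltjes(1)[OF y] h_def[symmetric] using i prob_space by simp
  finally show ?thesis .
qed

lemma (in real_distribution) stieltjes_at_top:
  "((\<lambda>n. real (Suc n) * Im (stieltjes M (Complex 0 (real (Suc n))))) \<longlonglongrightarrow> 1)"
proof -
  have "(\<lambda>n. \<integral>E. real (Suc n) * (real (Suc n) / ((E - 0)\<^sup>2 + (real (Suc n))\<^sup>2)) \<partial>M) \<longlonglongrightarrow> (\<integral>E. 1 \<partial>M)"
  proof (rule integral_dominated_convergence[where w="\<lambda>_. 1"])
    show "AE E in M. (\<lambda>n. real (Suc n) * (real (Suc n) / ((E - 0)\<^sup>2 + (real (Suc n))\<^sup>2))) \<longlonglongrightarrow> 1"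
      by (rule AE_I2) real_asymp
    show "AE E in M. norm (real (Suc n) * (real (Suc n) / ((E - 0)\<^sup>2 + (real (Suc n))\<^sup>2))) \<le> 1" for n
    proof (rule AE_I2)
      fix E :: real
      have "E\<^sup>2 + (real (Suc n))\<^sup>2 > 0" by (simp add: add_nonneg_pos)
      then show "norm (real (Suc n) * (real (Suc n) / ((E - 0)\<^sup>2 + (real (Suc n))\<^sup>2))) \<le> 1"
        by (simp add: power2_eq_square abs_mult)
    qed
  qed auto
  then show ?thesis
    using prob_space by (simp add: Im_stieltjes(1) del: of_nat_Suc times_divide_eq_right)
qed

text \<open>The transform at one point high on the imaginary axis controls the tail mass. Its
  convergence therefore gives a common interval for all large \<open>n\<close>; the finitely many
  remaining measures only enlarge it.\<close>

lemma tight_of_stieltjes: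
  assumes \<mu>: "\<And>n. real_distribution (\<mu> n)" and \<nu>: "real_distribution \<nu>"
    and lim: "\<And>z. Im z > 0 \<Longrightarrow> (\<lambda>n. stieltjes (\<mu> n) z) \<longlonglongrightarrow> stieltjes \<nu> z"
  shows "tight \<mu>"
  unfolding tight_def
proof (intro conjI allI impI \<mu>)
  fix \<epsilon> :: real assume e: "\<epsilon> > 0"
  \<comment> \<open>Two errors below \<open>\<epsilon> / 4\<close>, this one and that of the
    convergence in \<open>n\<close>, are doubled by \<open>mass_outside_le\<close> and stay below
    \<open>\<epsilon>\<close>.\<close>
  have "eventually (\<lambda>k. \<bar>real (Suc k) * Im (stieltjes \<nu> (Complex 0 (real (Suc k)))) - 1\<bar> < \<epsilon> / 4) sequentially"
    using tendstoD[OF real_distribution.stieltjes_at_top[OF \<nu>], of "\<epsilon>/4"] e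
    unfolding dist_real_def by (metis zero_less_divide_iff zero_less_numeral)
  then obtain k where k: "\<bar>real (Suc k) * Im (stieltjes \<nu> (Complex 0 (real (Suc k)))) - 1\<bar> < \<epsilon> / 4"
    using eventually_happens'[OF sequentially_bot] by blast
  define y where "y = real (Suc k)"
  have y: "y > 0" unfolding y_def by simp
  have l: "(\<lambda>n. y * Im (stieltjes (\<mu> n) (Complex 0 y))) \<longlonglongrightarrow> y * Im (stieltjes \<nu> (Complex 0 y))"
    by (intro tendsto_intros lim) (use y in simp)
  have "eventually (\<lambda>n. \<bar>y * Im (stieltjes (\<mu> n) (Complex 0 y)) - y * Im (stieltjes \<nu> (Complex 0 y))\<bar> < \<epsilon> / 4) sequentially"
    using tendstoD[OF l, of "\<epsilon>/4"] e unfolding dist_real_def by simp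
  then obtain N where N: "\<And>n. n \<ge> N \<Longrightarrow> \<bar>y * Im (stieltjes (\<mu> n) (Complex 0 y)) - y * Im (stieltjes \<nu> (Complex 0 y))\<bar> < \<epsilon> / 4"
    unfolding eventually_sequentially by blast
  have big: "measure (\<mu> n) {-y..y} > 1 - \<epsilon>" if "n \<ge> N" for n
  proof -
    have arith: "1 - \<epsilon> < m" if "1 - m \<le> 2 * (1 - s)" "\<bar>s - s0\<bar> < \<epsilon> / 4" "\<bar>s0 - 1\<bar> < \<epsilon> / 4" for m s s0
      using that unfolding abs_less_iff by argo
    show ?thesis
      by (rule arith[OF real_distribution.mass_outside_le[OF \<mu> y] N[OF that] k[folded y_def]])
  qed
  have small: "eventually (\<lambda>Y. measure (\<mu> n) {-Y<..Y} > 1 - \<epsilon>) at_top" for n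
  proof -
    interpret real_distribution "\<mu> n" by (rule \<mu>)
    have "((\<lambda>Y. cdf (\<mu> n) Y - cdf (\<mu> n) (-Y)) \<longlongrightarrow> 1 - 0) at_top"
      by (intro tendsto_diff cdf_lim_at_top_prob filterlim_compose[OF cdf_lim_at_bot] filterlim_uminus_at_bot_at_top)
    then have "eventually (\<lambda>Y. cdf (\<mu> n) Y - cdf (\<mu> n) (-Y) > 1 - \<epsilon>) at_top"
      using order_tendstoD(1)[of _ 1 at_top "1 - \<epsilon>"] e by simp
    with eventually_gt_at_top[of 0] show ?thesis
    proof eventually_elim
      case (elim Y)
      then show ?case using cdf_diff_eq[of "-Y" Y] by simp
    qed
  qed
  have "eventually (\<lambda>Y. \<forall>n\<in>{..<N}. measure (\<mu> n) {-Y<..Y} > 1 - \<epsilon>) at_top"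
    by (rule eventually_ball_finite) (auto intro: small)
  with eventually_gt_at_top[of y] have "eventually (\<lambda>Y. y < Y \<and> (\<forall>n\<in>{..<N}. measure (\<mu> n) {-Y<..Y} > 1 - \<epsilon>)) at_top"
    by eventually_elim simp
  then obtain Y where Y: "y < Y" "\<And>n. n < N \<Longrightarrow> measure (\<mu> n) {-Y<..Y} > 1 - \<epsilon>"
    using eventually_happens'[OF trivial_limit_at_top_linorder] by blast
  have "measure (\<mu> n) {-Y<..Y} > 1 - \<epsilon>" for n
  proof (cases "n < N")
    case False
    interpret real_distribution "\<mu> n" by (rule \<mu>)
    have "measure (\<mu> n) {-y..y} \<le> measure (\<mu> n) {-Y<..Y}"
      by (rule finite_measure_mono) (use Y(1) in auto)
    then show ?thesis using big[of n] False by simp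
  qed (use Y in auto)
  moreover have "-Y < Y" using Y(1) y by simp
  ultimately show "\<exists>a b. a < b \<and> (\<forall>n. measure (\<mu> n) {a<..b} > 1 - \<epsilon>)" by blast
qed

text \<open>Countability lets the exceptional null sets at all these points be united into one null
  set.\<close>

definition rat_upper_half_plane :: "complex set" where
  "rat_upper_half_plane = {Complex x y | x y. x \<in> \<rat> \<and> y \<in> \<rat> \<and> y > 0}"

lemma countable_rat_upper_half_plane: "countable rat_upper_half_plane"
proof -
  have "rat_upper_half_plane \<subseteq> (\<lambda>(x, y). Complex x y) ` (\<rat> \<times> \<rat>)"
    unfolding rat_upper_half_plane_def by auto
  then show ?thesis by (rule countable_subset) (intro countable_image countable_SIGMA countable_rat)
qed

text \<open>The approximating point is taken above \<open>z\<close>, so that both imaginary parts in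
  \<open>stieltjes_diff_le\<close> are at least \<open>Im z\<close>.\<close>

lemma rat_upper_half_plane_dense:
  assumes z: "Im z > 0" and d: "\<delta> > 0"
  shows "\<exists>w\<in>rat_upper_half_plane. norm (z - w) < \<delta> \<and> Im w > Im z"
proof -
  obtain x where x: "x \<in> \<rat>" "Re z < x" "x < Re z + \<delta>/2"
    using Rats_dense_in_real[of "Re z" "Re z + \<delta>/2"] d by auto
  obtain y where y: "y \<in> \<rat>" "Im z < y" "y < Im z + \<delta>/2"
    using Rats_dense_in_real[of "Im z" "Im z + \<delta>/2"] d by auto
  have "norm (z - Complex x y) \<le> \<bar>Re z - x\<bar> + \<bar>Im z - y\<bar>"
    using cmod_le[of "z - Complex x y"] by simp
  also have "\<dots> < \<delta>" using x y by simp
  finally show ?thesis unfolding rat_upper_half_plane_def using x y z by (intro bexI[of _ "Complex x y"]) auto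
qed

text \<open>The Lipschitz bound extends the convergence to the open half-plane. Tightness follows,
  and uniqueness identifies every weak subsequential limit.\<close>

theorem stieltjes_continuity:
  assumes \<mu>: "\<And>n. real_distribution (\<mu> n)" and \<nu>: "real_distribution \<nu>"
    and lim: "\<And>z. z \<in> rat_upper_half_plane \<Longrightarrow> (\<lambda>n. stieltjes (\<mu> n) z) \<longlonglongrightarrow> stieltjes \<nu> z"
  shows "weak_conv_m \<mu> \<nu>"
proof -
  have lim': "(\<lambda>n. stieltjes (\<mu> n) z) \<longlonglongrightarrow> stieltjes \<nu> z" if z: "Im z > 0" for z
  proof (rule LIMSEQ_I)
    fix r :: real assume r: "r > 0"
    \<comment> \<open>With this radius, moving from \<open>z\<close> to \<open>w\<close> costs less
      than \<open>r / 3\<close> for each of the two measures.\<close>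
    define \<delta> where "\<delta> = r * (Im z)\<^sup>2 / 3"
    have d: "\<delta> > 0" unfolding \<delta>_def using r z by simp
    obtain w where w: "w \<in> rat_upper_half_plane" "norm (z - w) < \<delta>" "Im w > Im z"
      using rat_upper_half_plane_dense[OF z d] by blast
    have close: "norm (stieltjes \<kappa> z - stieltjes \<kappa> w) < r / 3" if "real_distribution \<kappa>" for \<kappa>
    proof -
      have "norm (stieltjes \<kappa> z - stieltjes \<kappa> w) \<le> norm (z - w) / (\<bar>Im z\<bar> * \<bar>Im w\<bar>)"
        by (rule real_distribution.stieltjes_diff_le[OF that]) (use z w in auto)
      also have "\<dots> \<le> norm (z - w) / (Im z)\<^sup>2"
        using z w by (intro divide_left_mono) (auto simp: power2_eq_square intro!: mult_left_mono)
      also have "\<dots> < \<delta> / (Im z)\<^sup>2" using w z by (intro divide_strict_right_mono) auto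
      also have "\<dots> = r / 3" unfolding \<delta>_def using z by simp
      finally show ?thesis .
    qed
    obtain N where N: "\<And>n. n \<ge> N \<Longrightarrow> norm (stieltjes (\<mu> n) w - stieltjes \<nu> w) < r / 3"
      using LIMSEQ_D[OF lim[OF w(1)], of "r/3"] r by auto
    show "\<exists>N. \<forall>n\<ge>N. norm (stieltjes (\<mu> n) z - stieltjes \<nu> z) < r"
    proof (intro exI allI impI)
      fix n assume "n \<ge> N"
      then show "norm (stieltjes (\<mu> n) z - stieltjes \<nu> z) < r"
        using close[OF \<mu>, of n] close[OF \<nu>] N[of n] 
          norm_triangle_ineq[of "stieltjes (\<mu> n) z - stieltjes (\<mu> n) w" "stieltjes (\<mu> n) w - stieltjes \<nu> w"]
          norm_triangle_ineq4[of "stieltjes (\<mu> n) z - stieltjes \<nu> w" "stieltjes \<nu> z - stieltjes \<nu> w"]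
        by simp
    qed
  qed
  show ?thesis
  proof (rule tight_subseq_weak_converge[OF \<mu> \<nu> tight_of_stieltjes[OF \<mu> \<nu> lim']])
    fix s \<kappa> assume s: "strict_mono s" and \<kappa>: "real_distribution \<kappa>" and w: "weak_conv_m (\<mu> \<circ> s) \<kappa>"
    have "stieltjes \<kappa> z = stieltjes \<nu> z" if "Im z > 0" for z
    proof (rule LIMSEQ_unique)
      show "(\<lambda>n. stieltjes ((\<mu> \<circ> s) n) z) \<longlonglongrightarrow> stieltjes \<kappa> z"
        by (rule weak_conv_stieltjes[OF _ \<kappa> w]) (use \<mu> that in auto)
      show "(\<lambda>n. stieltjes ((\<mu> \<circ> s) n) z) \<longlonglongrightarrow> stieltjes \<nu> z"
        using LIMSEQ_subseq_LIMSEQ[OF lim'[OF that] s] by (simp add: comp_def)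
    qed
    then have "\<kappa> = \<nu>" by (rule stieltjes_unique[OF \<kappa> \<nu>])
    then show "weak_conv_m (\<mu> \<circ> s) \<nu>" using w by simp
  qed
qed

section \<open>Spectral measures of finite symmetric matrices\<close>

lemma
  assumes fin: "finite S" and p: "\<And>k. k \<in> S \<Longrightarrow> 0 \<le> p k"
    and one: "(\<Sum>k\<in>S. p k) = 1"
  shows point_masses_real_distribution: "real_distribution (distr (point_measure S (\<lambda>k. ennreal (p k))) borel (e :: 'i \<Rightarrow> real))"
    and integral_point_masses: "\<And>f :: real \<Rightarrow> 'b::{banach, second_countable_topology}. f \<in> borel_measurable borel \<Longrightarrow>
      integral\<^sup>L (distr (point_measure S (\<lambda>k. ennreal (p k))) borel e) f = (\<Sum>k\<in>S. p k *\<^sub>R f (e k))"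
    and integrable_point_masses: "\<And>f :: real \<Rightarrow> 'b. f \<in> borel_measurable borel \<Longrightarrow>
      integrable (distr (point_measure S (\<lambda>k. ennreal (p k))) borel e) f"
proof -
  let ?P = "point_measure S (\<lambda>k. ennreal (p k))"
  have e: "e \<in> measurable ?P borel" by (simp add: point_measure_def)
  have "emeasure ?P S = 1"
    using fin p one by (simp add: emeasure_point_measure_finite sum_ennreal)
  then interpret prob_space ?P by (intro prob_spaceI) (simp add: space_point_measure)
  show "real_distribution (distr ?P borel e)" by (rule real_distribution_distr[OF e])
  show "integral\<^sup>L (distr ?P borel e) f = (\<Sum>k\<in>S. p k *\<^sub>R f (e k))" if f: "f \<in> borel_measurable borel"
    for f :: "real \<Rightarrow> 'b"
    using fin p by (subst integral_distr[OF e f]) (simp add: lebesgue_integral_point_measure_finite)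
  show "integrable (distr ?P borel e) f" if f: "f \<in> borel_measurable borel" for f :: "real \<Rightarrow> 'b"
    using fin by (subst integrable_distr_eq[OF e f]) (simp add: integrable_point_measure_finite)
qed

definition diagonalizes :: "'i set \<Rightarrow> ('i \<Rightarrow> 'i \<Rightarrow> real) \<Rightarrow> ('i \<Rightarrow> real) \<times> ('i \<Rightarrow> 'i \<Rightarrow> real) \<Rightarrow> bool" where
  "diagonalizes S M = (\<lambda>(e, U). (\<forall>x\<in>S. \<forall>y\<in>S. (\<Sum>k\<in>S. U x k * U y k) = of_bool (x = y))
     \<and> (\<forall>k\<in>S. \<forall>l\<in>S. (\<Sum>x\<in>S. U x k * U x l) = of_bool (k = l))
     \<and> (\<forall>x\<in>S. \<forall>y\<in>S. M x y = (\<Sum>k\<in>S. e k * U x k * U y k)))"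

text \<open>\<open>eigval\<close> and \<open>eigvec\<close> are the two components of one chosen
  pair, so eigenvalues and eigenvectors belong together.\<close>

definition eigval :: "'i set \<Rightarrow> ('i \<Rightarrow> 'i \<Rightarrow> real) \<Rightarrow> 'i \<Rightarrow> real" where
  "eigval S M = fst (SOME d. diagonalizes S M d)"

definition eigvec :: "'i set \<Rightarrow> ('i \<Rightarrow> 'i \<Rightarrow> real) \<Rightarrow> 'i \<Rightarrow> 'i \<Rightarrow> real" where
  "eigvec S M = snd (SOME d. diagonalizes S M d)"

text \<open>The kernel of the resolvent of \<open>M\<close> at \<open>z\<close>, in spectral
  form.\<close>

definition green :: "'i set \<Rightarrow> ('i \<Rightarrow> 'i \<Rightarrow> real) \<Rightarrow> complex \<Rightarrow> 'i \<Rightarrow> 'i \<Rightarrow> complex" where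
  "green S M z x y = (\<Sum>k\<in>S. complex_of_real (eigvec S M x k * eigvec S M y k) / (complex_of_real (eigval S M k) - z))"

text \<open>The spectral measure of \<open>M\<close> at the unit vector of \<open>x\<close>.\<close>

definition vertex_meas :: "'i set \<Rightarrow> ('i \<Rightarrow> 'i \<Rightarrow> real) \<Rightarrow> 'i \<Rightarrow> real measure" where
  "vertex_meas S M x = distr (point_measure S (\<lambda>k. ennreal ((eigvec S M x k)\<^sup>2))) borel (eigval S M)"

definition ev_dist :: "'i set \<Rightarrow> ('i \<Rightarrow> 'i \<Rightarrow> real) \<Rightarrow> real measure" where
  "ev_dist S M = distr (point_measure S (\<lambda>k. ennreal (1 / real (card S)))) borel (eigval S M)"

locale symmetric_on =
  fixes S :: "'i set" and M :: "'i \<Rightarrow> 'i \<Rightarrow> real"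
  assumes fin: "finite S" and sym: "\<And>x y. x \<in> S \<Longrightarrow> y \<in> S \<Longrightarrow> M x y = M y x"
begin

abbreviation "e \<equiv> eigval S M"
abbreviation "U \<equiv> eigvec S M"

lemma diag: "diagonalizes S M (e, U)"
proof -
  have "\<exists>d. diagonalizes S M d"
    using symmetric_spectral[OF fin sym] unfolding diagonalizes_def by auto
  then have "diagonalizes S M (SOME d. diagonalizes S M d)" by (rule someI_ex)
  then show ?thesis unfolding eigval_def eigvec_def by simp
qed

lemma rows: "x \<in> S \<Longrightarrow> y \<in> S \<Longrightarrow> (\<Sum>k\<in>S. U x k * U y k) = of_bool (x = y)"
  and cols: "k \<in> S \<Longrightarrow> l \<in> S \<Longrightarrow> (\<Sum>x\<in>S. U x k * U x l) = of_bool (k = l)"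
  and M_eq: "x \<in> S \<Longrightarrow> y \<in> S \<Longrightarrow> M x y = (\<Sum>k\<in>S. e k * U x k * U y k)"
  using diag unfolding diagonalizes_def by auto

lemma eigvec_eq:
  assumes "x \<in> S" "l \<in> S"
  shows "(\<Sum>y\<in>S. M x y * U y l) = e l * U x l"
proof -
  have "(\<Sum>y\<in>S. M x y * U y l) = (\<Sum>y\<in>S. \<Sum>k\<in>S. e k * U x k * (U y k * U y l))"
    using assms by (simp add: M_eq sum_distrib_right mult.assoc)
  also have "\<dots> = (\<Sum>k\<in>S. e k * U x k * (\<Sum>y\<in>S. U y k * U y l))"
    by (subst sum.swap) (simp add: sum_distrib_left)
  also have "\<dots> = (\<Sum>k\<in>S. if k = l then e l * U x l else 0)"
    using assms by (intro sum.cong) (auto simp: cols)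
  finally show ?thesis using fin assms by simp
qed

lemma green_sym: "green S M z x y = green S M z y x"
  unfolding green_def by (simp add: mult.commute)

lemma green_eq:
  assumes z: "Im z \<noteq> 0" and x: "x \<in> S" and y: "y \<in> S"
  shows "(\<Sum>y'\<in>S. complex_of_real (M y y') * green S M z x y') - z * green S M z x y = of_bool (y = x)"
proof -
  have nz: "complex_of_real (e k) \<noteq> z" for k using z by auto
  have "(\<Sum>y'\<in>S. complex_of_real (M y y') * green S M z x y')
     = (\<Sum>k\<in>S. complex_of_real (U x k * (\<Sum>y'\<in>S. M y y' * U y' k)) / (complex_of_real (e k) - z))"
    unfolding green_def sum_distrib_left of_real_sum sum_divide_distrib
    by (subst sum.swap) (simp add: mult_ac)
  also have "\<dots> = (\<Sum>k\<in>S. complex_of_real (U x k * (e k * U y k)) / (complex_of_real (e k) - z))"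
    by (intro sum.cong refl) (simp add: eigvec_eq y)
  finally have "(\<Sum>y'\<in>S. complex_of_real (M y y') * green S M z x y') - z * green S M z x y
    = (\<Sum>k\<in>S. complex_of_real (U x k * (e k * U y k)) / (complex_of_real (e k) - z)
        - z * (complex_of_real (U x k * U y k) / (complex_of_real (e k) - z)))"
    unfolding green_def sum_distrib_left by (simp add: sum_subtractf)
  also have "\<dots> = (\<Sum>k\<in>S. complex_of_real (U y k * U x k))"
  proof (rule sum.cong[OF refl])
    fix k
    have cancel: "a * E / (E - z) - z * (a / (E - z)) = a" if "E \<noteq> z" for a E :: complex
      using that by (simp add: divide_simps) (simp add: algebra_simps)
    show "complex_of_real (U x k * (e k * U y k)) / (complex_of_real (e k) - z)
        - z * (complex_of_real (U x k * U y k) / (complex_of_real (e k) - z)) = complex_of_real (U y k * U x k)"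
      using cancel[OF nz[of k], of "complex_of_real (U x k * U y k)"] by (simp add: mult_ac)
  qed
  also have "\<dots> = complex_of_real (\<Sum>k\<in>S. U y k * U x k)" by simp
  also have "\<dots> = of_bool (y = x)" by (simp add: rows x y)
  finally show ?thesis .
qed

text \<open>Parseval's identity for the eigenbasis; it serves both the resolvent bound and the
  second moment.\<close>

lemma sum_sq_real: "(\<Sum>y\<in>S. (\<Sum>k\<in>S. a k * U y k)\<^sup>2) = (\<Sum>k\<in>S. (a k)\<^sup>2)"
proof -
  have "(\<Sum>y\<in>S. (\<Sum>k\<in>S. a k * U y k)\<^sup>2) = (\<Sum>y\<in>S. \<Sum>k\<in>S. \<Sum>l\<in>S. a k * a l * (U y k * U y l))"
    by (simp add: power2_eq_square sum_product mult_ac)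
  also have "\<dots> = (\<Sum>k\<in>S. \<Sum>y\<in>S. \<Sum>l\<in>S. a k * a l * (U y k * U y l))" by (rule sum.swap)
  also have "\<dots> = (\<Sum>k\<in>S. \<Sum>l\<in>S. \<Sum>y\<in>S. a k * a l * (U y k * U y l))"
    by (rule sum.cong[OF refl]) (rule sum.swap)
  also have "\<dots> = (\<Sum>k\<in>S. \<Sum>l\<in>S. if l = k then (a k)\<^sup>2 else 0)"
    by (intro sum.cong refl) (auto simp: sum_distrib_left[symmetric] cols power2_eq_square)
  also have "\<dots> = (\<Sum>k\<in>S. (a k)\<^sup>2)" using fin by simp
  finally show ?thesis .
qed

text \<open>The bound is independent of the size of \<open>S\<close>; it becomes square summability
  in infinite volume.\<close>

lemma green_norm_sum:
  assumes z: "Im z \<noteq> 0" and x: "x \<in> S"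
  shows "(\<Sum>y\<in>S. (norm (green S M z x y))\<^sup>2) \<le> 1 / (Im z)\<^sup>2"
proof -
  define a where "a k = complex_of_real (U x k) / (complex_of_real (e k) - z)" for k
  have g: "Re (green S M z x y) = (\<Sum>k\<in>S. Re (a k) * U y k)" "Im (green S M z x y) = (\<Sum>k\<in>S. Im (a k) * U y k)" for y
  proof -
    have "green S M z x y = (\<Sum>k\<in>S. a k * complex_of_real (U y k))"
      unfolding green_def a_def by (simp add: field_simps)
    then show "Re (green S M z x y) = (\<Sum>k\<in>S. Re (a k) * U y k)" "Im (green S M z x y) = (\<Sum>k\<in>S. Im (a k) * U y k)"
      by simp_all
  qed
  have "(\<Sum>y\<in>S. (norm (green S M z x y))\<^sup>2) = (\<Sum>k\<in>S. (Re (a k))\<^sup>2) + (\<Sum>k\<in>S. (Im (a k))\<^sup>2)"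
    unfolding cmod_power2 g sum.distrib sum_sq_real ..
  also have "\<dots> = (\<Sum>k\<in>S. (norm (a k))\<^sup>2)" by (simp add: cmod_power2 sum.distrib)
  also have "\<dots> \<le> (\<Sum>k\<in>S. U x k * U x k * (1 / (Im z)\<^sup>2))"
  proof (rule sum_mono)
    fix k
    have "norm (1 / (complex_of_real (e k) - z)) \<le> 1 / \<bar>Im z\<bar>" by (rule norm_cauchy_kernel_le[OF z])
    then have "(norm (1 / (complex_of_real (e k) - z)))\<^sup>2 \<le> (1 / \<bar>Im z\<bar>)\<^sup>2" by (rule power_mono) simp
    then have "(U x k)\<^sup>2 * (norm (1 / (complex_of_real (e k) - z)))\<^sup>2 \<le> (U x k)\<^sup>2 * (1 / \<bar>Im z\<bar>)\<^sup>2"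
      by (rule mult_left_mono) simp
    then show "(norm (a k))\<^sup>2 \<le> U x k * U x k * (1 / (Im z)\<^sup>2)"
      unfolding a_def by (simp add: norm_divide power_divide power2_eq_square)
  qed
  also have "\<dots> = 1 / (Im z)\<^sup>2" unfolding sum_distrib_right[symmetric] using rows[OF x x] by simp
  finally show ?thesis .
qed

lemma norm_green_le:
  assumes z: "Im z \<noteq> 0" and x: "x \<in> S" and y: "y \<in> S"
  shows "norm (green S M z x y) \<le> 1 / \<bar>Im z\<bar>"
proof -
  have "(norm (green S M z x y))\<^sup>2 \<le> (\<Sum>y\<in>S. (norm (green S M z x y))\<^sup>2)"
    using fin y by (intro member_le_sum) auto
  also have "\<dots> \<le> 1 / (Im z)\<^sup>2" by (rule green_norm_sum[OF z x])
  finally have "(norm (green S M z x y))\<^sup>2 \<le> (1 / \<bar>Im z\<bar>)\<^sup>2" by (simp add: power_divide)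
  then show ?thesis by (rule power2_le_imp_le) simp
qed

lemma vertex_weights:
  assumes x: "x \<in> S"
  shows "(\<Sum>k\<in>S. (U x k)\<^sup>2) = 1"
  using rows[OF x x] by (simp add: power2_eq_square)

lemma vertex_meas_real_distribution:
  assumes x: "x \<in> S"
  shows "real_distribution (vertex_meas S M x)"
  unfolding vertex_meas_def by (rule point_masses_real_distribution[OF fin]) (auto simp: vertex_weights x)

lemma vertex_meas_stieltjes:
  assumes x: "x \<in> S"
  shows "stieltjes (vertex_meas S M x) z = green S M z x x"
proof -
  have "stieltjes (vertex_meas S M x) z = (\<Sum>k\<in>S. (U x k)\<^sup>2 *\<^sub>R (1 / (complex_of_real (e k) - z)))"
    unfolding stieltjes_def vertex_meas_def
    by (rule integral_point_masses[OF fin]) (auto simp: vertex_weights x)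
  then show ?thesis unfolding green_def by (simp add: scaleR_conv_of_real power2_eq_square)
qed

text \<open>The second moment is the squared norm of \<open>M\<close> applied to the unit vector at
  \<open>x\<close>. For tree operators only the sites next to \<open>x\<close> enter, which gives
  tightness uniformly in the volume.\<close>

lemma vertex_meas_second_moment:
  assumes x: "x \<in> S"
  shows "(\<integral>E. E\<^sup>2 \<partial>vertex_meas S M x) = (\<Sum>y\<in>S. (M x y)\<^sup>2)"
    and "integrable (vertex_meas S M x) (\<lambda>E. E\<^sup>2)"
proof -
  have "(\<integral>E. E\<^sup>2 \<partial>vertex_meas S M x) = (\<Sum>k\<in>S. (U x k)\<^sup>2 *\<^sub>R (e k)\<^sup>2)"
    unfolding vertex_meas_def by (rule integral_point_masses[OF fin]) (auto simp: vertex_weights x)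
  also have "\<dots> = (\<Sum>k\<in>S. (e k * U x k)\<^sup>2)" by (simp add: power_mult_distrib mult.commute)
  also have "\<dots> = (\<Sum>y\<in>S. (\<Sum>k\<in>S. e k * U x k * U y k)\<^sup>2)" by (rule sum_sq_real[symmetric])
  also have "\<dots> = (\<Sum>y\<in>S. (M x y)\<^sup>2)" by (simp add: M_eq x)
  finally show "(\<integral>E. E\<^sup>2 \<partial>vertex_meas S M x) = (\<Sum>y\<in>S. (M x y)\<^sup>2)" .
  show "integrable (vertex_meas S M x) (\<lambda>E. E\<^sup>2)"
    unfolding vertex_meas_def by (rule integrable_point_masses[OF fin]) (auto simp: vertex_weights x)
qed

lemma trace_fun_on_eq: "trace_fun_on S F M = (\<Sum>k\<in>S. F (e k))"
  by (rule trace_fun_on_spectral[OF fin charpoly_on_spectral[OF fin cols eigvec_eq]])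

lemma sum_green_diag: "(\<Sum>x\<in>S. green S M z x x) = (\<Sum>k\<in>S. 1 / (complex_of_real (e k) - z))"
proof -
  have "(\<Sum>x\<in>S. green S M z x x) = (\<Sum>k\<in>S. complex_of_real (\<Sum>x\<in>S. U x k * U x k) / (complex_of_real (e k) - z))"
    unfolding green_def of_real_sum sum_divide_distrib by (rule sum.swap)
  also have "\<dots> = (\<Sum>k\<in>S. 1 / (complex_of_real (e k) - z))"
    by (intro sum.cong refl) (simp add: cols)
  finally show ?thesis .
qed

lemma ev_dist:
  assumes ne: "S \<noteq> {}"
  shows ev_dist_real_distribution: "real_distribution (ev_dist S M)"
    and ev_dist_stieltjes: "stieltjes (ev_dist S M) z = (\<Sum>x\<in>S. green S M z x x) / of_nat (card S)"
    and ev_dist_integral: "F \<in> borel_measurable borel \<Longrightarrow> integral\<^sup>L (ev_dist S M) F = trace_fun_on S F M / real (card S)"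
proof -
  have p: "\<And>k. 0 \<le> 1 / real (card S)" "(\<Sum>k\<in>S. 1 / real (card S)) = 1"
    using fin ne by auto
  show "real_distribution (ev_dist S M)"
    unfolding ev_dist_def by (rule point_masses_real_distribution[OF fin p])
  have "stieltjes (ev_dist S M) z = (\<Sum>k\<in>S. (1 / real (card S)) *\<^sub>R (1 / (complex_of_real (e k) - z)))"
    unfolding stieltjes_def ev_dist_def by (rule integral_point_masses[OF fin p]) simp
  then show "stieltjes (ev_dist S M) z = (\<Sum>x\<in>S. green S M z x x) / of_nat (card S)"
    unfolding sum_green_diag by (simp add: scaleR_conv_of_real sum_divide_distrib mult.commute)
  show "integral\<^sup>L (ev_dist S M) F = trace_fun_on S F M / real (card S)" if "F \<in> borel_measurable borel"
    unfolding ev_dist_def trace_fun_on_eq using integral_point_masses[OF fin p that]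
    by (simp add: sum_divide_distrib)
qed

text \<open>Pairing the equation with the symmetric kernel moves the matrix onto the kernel, where
  \<open>green_eq\<close> collapses the sum. Hence every solution is given by the Green
  function.\<close>

lemma green_solves:
  assumes z: "Im z \<noteq> 0" and y: "y \<in> S"
    and f: "\<And>x. x \<in> S \<Longrightarrow> (\<Sum>x'\<in>S. complex_of_real (M x x') * f x') - z * f x = F x"
  shows "f y = (\<Sum>x\<in>S. green S M z y x * F x)"
proof -
  have "(\<Sum>x\<in>S. green S M z y x * F x)
     = (\<Sum>x\<in>S. \<Sum>x'\<in>S. green S M z y x * (complex_of_real (M x x') * f x')) - (\<Sum>x\<in>S. green S M z y x * (z * f x))"
    by (simp add: f[symmetric] right_diff_distrib sum_subtractf sum_distrib_left)
  also have "(\<Sum>x\<in>S. \<Sum>x'\<in>S. green S M z y x * (complex_of_real (M x x') * f x'))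
     = (\<Sum>x'\<in>S. f x' * (\<Sum>x\<in>S. complex_of_real (M x' x) * green S M z y x))"
    unfolding sum_distrib_left by (subst sum.swap) (intro sum.cong refl, simp add: sym)
  also have "\<dots> = (\<Sum>x'\<in>S. f x' * (of_bool (x' = y) + z * green S M z y x'))"
    by (intro sum.cong refl) (simp add: green_eq[OF z y, symmetric])
  also have "\<dots> = (\<Sum>x'\<in>S. if x' = y then f y else 0) + (\<Sum>x'\<in>S. green S M z y x' * (z * f x'))"
    unfolding sum.distrib[symmetric] by (rule sum.cong) (auto simp: algebra_simps)
  also have "(\<Sum>x'\<in>S. if x' = y then f y else 0) = f y" using fin y by simp
  finally show ?thesis by simp
qed

end

section \<open>Green functions of finite trees\<close>

lemma finite_tree_ball: "finite (tree_ball K L)"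
  unfolding tree_ball_def using finite_lists_length_le[of "{..<K}" L] by simp

lemma tree_ball_0: "tree_ball K 0 = {[]}"
  unfolding tree_ball_def by auto

lemma Nil_in_tree_ball [simp]: "[] \<in> tree_ball K L"
  unfolding tree_ball_def by auto

text \<open>Words are read from the vertex towards the root, so the child of the root through which
  a vertex descends is its last letter.\<close>

lemma sum_tree_ball_Suc:
  "(\<Sum>v\<in>tree_ball K (Suc m). F v) = F [] + (\<Sum>c<K. \<Sum>v\<in>tree_ball K m. F (v @ [c]))"
  for F :: "nat list \<Rightarrow> 'b::comm_monoid_add"
proof -
  have eq: "tree_ball K (Suc m) = insert [] ((\<lambda>(c, v). v @ [c]) ` ({..<K} \<times> tree_ball K m))" (is "_ = insert [] ?B")
  proof (intro equalityI subsetI)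
    fix v assume v: "v \<in> tree_ball K (Suc m)"
    show "v \<in> insert [] ?B"
    proof (cases v rule: rev_cases)
      case (snoc u c)
      then have "(c, u) \<in> {..<K} \<times> tree_ball K m" using v unfolding tree_ball_def by auto
      then show ?thesis using snoc by force
    qed simp
  qed (auto simp: tree_ball_def)
  have inj: "inj_on (\<lambda>(c, v). v @ [c]) ({..<K} \<times> tree_ball K m)" by (auto simp: inj_on_def)
  have "(\<Sum>v\<in>tree_ball K (Suc m). F v) = F [] + sum F ?B"
    unfolding eq by (rule sum.insert) (auto simp: finite_tree_ball)
  also have "sum F ?B = (\<Sum>x\<in>{..<K} \<times> tree_ball K m. F (case x of (c, v) \<Rightarrow> v @ [c]))"
    by (rule sum.reindex_cong[OF inj refl refl])
  also have "\<dots> = (\<Sum>c<K. \<Sum>v\<in>tree_ball K m. F (v @ [c]))"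
    by (simp add: sum.cartesian_product split_def)
  finally show ?thesis .
qed

text \<open>\<open>gam K b z d W v\<close> is the Green function at \<open>v\<close> of the subtree of height \<open>d\<close> below \<open>v\<close>, computed by
  Schur complements from the leaves; \<open>gsum\<close> is the imaginary part that the children contribute to its
  denominator.\<close>
fun gam :: "nat \<Rightarrow> real \<Rightarrow> complex \<Rightarrow> nat \<Rightarrow> (nat list \<Rightarrow> real) \<Rightarrow> nat list \<Rightarrow> complex" where
  "gam K b z 0 W v = 1 / (complex_of_real (W v + b) - z)"
| "gam K b z (Suc d) W v = 1 / (complex_of_real (W v) - z - (\<Sum>c<K. gam K b z d W (c # v)))"

fun gsum :: "nat \<Rightarrow> real \<Rightarrow> complex \<Rightarrow> nat \<Rightarrow> (nat list \<Rightarrow> real) \<Rightarrow> nat list \<Rightarrow> real" where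
  "gsum K b z 0 W v = 0"
| "gsum K b z (Suc d) W v = (\<Sum>c<K. Im (gam K b z d W (c # v)))"

text \<open>In the following, \<open>r\<close> has height \<open>m\<close> above the leaves, and the path leads from \<open>v @ r\<close> up to \<open>r\<close>.\<close>
fun pathprod :: "nat \<Rightarrow> real \<Rightarrow> complex \<Rightarrow> nat \<Rightarrow> (nat list \<Rightarrow> real) \<Rightarrow> nat list \<Rightarrow> nat list \<Rightarrow> complex" where
  "pathprod K b z m W r [] = 1"
| "pathprod K b z m W r (c # v) = (gam K b z (m - Suc (length v)) W (c # v @ r))\<^sup>2 * pathprod K b z m W r v"

text \<open>Corresponds to the closed walks from \<open>v @ r\<close> whose highest vertex is
  \<open>r\<close>: every vertex of the path below \<open>r\<close> contributes its Green function
  twice, \<open>r\<close> once.\<close>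

definition pathterm :: "nat \<Rightarrow> real \<Rightarrow> complex \<Rightarrow> nat \<Rightarrow> (nat list \<Rightarrow> real) \<Rightarrow> nat list \<Rightarrow> nat list \<Rightarrow> complex" where
  "pathterm K b z m W r v = gam K b z m W r * pathprod K b z m W r v"

definition nodesum :: "nat \<Rightarrow> real \<Rightarrow> complex \<Rightarrow> nat \<Rightarrow> (nat list \<Rightarrow> real) \<Rightarrow> nat list \<Rightarrow> complex" where
  "nodesum K b z m W r = (\<Sum>v\<in>tree_ball K m. pathterm K b z m W r v)"

lemma gam_shift: "gam K b z d (\<lambda>u. W (u @ r)) v = gam K b z d W (v @ r)"
  by (induction d arbitrary: v) simp_all

lemma pathprod_shift:
  "pathprod K b z m (\<lambda>u. W (u @ r)) [] v = pathprod K b z m W r v"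
proof (induction v)
  case (Cons c v)
  have "gam K b z (m - Suc (length v)) (\<lambda>u. W (u @ r)) (c # v) = gam K b z (m - Suc (length v)) W (c # v @ r)"
    using gam_shift[of K b z _ W r "c # v"] by simp
  then show ?case using Cons by simp
qed simp

lemma pathterm_shift: "pathterm K b z m (\<lambda>u. W (u @ r)) [] v = pathterm K b z m W r v"
  unfolding pathterm_def pathprod_shift using gam_shift[of K b z m W r "[]"] by simp

lemma nodesum_shift: "nodesum K b z m (\<lambda>u. W (u @ r)) [] = nodesum K b z m W r"
  unfolding nodesum_def pathterm_shift ..

text \<open>The recursion of \<open>pathprod\<close> works at the lower end of the path. Inductions
  on the height need the factor next to \<open>r\<close> split off instead.\<close>

lemma pathprod_snoc:
  assumes "length v \<le> m"
  shows "pathprod K b z (Suc m) W r (v @ [c]) = (gam K b z m W (c # r))\<^sup>2 * pathprod K b z m W (c # r) v"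
  using assms by (induction v) (auto simp: mult.left_commute)

section \<open>Decay and summability of path products\<close>

locale upper_half =
  fixes K :: nat and b :: real and z :: complex
  assumes Im_z: "Im z > 0"
begin

definition q :: real where "q = 1 / (1 + (Im z)\<^sup>2)"

lemma q_pos: "0 < q" and q_less_1: "q < 1"
  unfolding q_def using Im_z by (auto simp: add_pos_pos)

abbreviation "\<Gamma> \<equiv> gam K b z"
abbreviation "\<Sigma> \<equiv> gsum K b z"

lemma Im_inverse_complex: "Im (1 / w) = - Im w * (norm (1 / w))\<^sup>2"
  by (simp add: Im_divide norm_divide power_divide cmod_power2)

text \<open>Each \<Gamma> is \<open>1 / D\<close> with \<open>Im D = - (Im z + \<Sigma>)\<close>,
  and everything follows from \<open>Im (1 / D) = - Im D * (norm (1 / D))\<^sup>2\<close>. The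
  claims are proved together because the sign of \<Sigma> needs the positivity at the
  children.\<close>

lemma gsum_nonneg_gam_pos: "0 \<le> \<Sigma> d W v \<and> 0 < Im (\<Gamma> d W v) \<and> (norm (\<Gamma> d W v))\<^sup>2 * (Im z + \<Sigma> d W v) = Im (\<Gamma> d W v)
    \<and> norm (\<Gamma> d W v) * (Im z + \<Sigma> d W v) \<le> 1"
proof -
  have key: "0 < Im (1 / D) \<and> (norm (1 / D))\<^sup>2 * s = Im (1 / D) \<and> norm (1 / D) * s \<le> 1"
    if "Im D = - s" "s > 0" for D s
  proof -
    have "D \<noteq> 0" using that by auto
    moreover have "s \<le> norm D" using abs_Im_le_cmod[of D] that by simp
    ultimately show ?thesis using that unfolding Im_inverse_complex by (simp add: norm_divide)
  qed
  show ?thesis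
  proof (induction d arbitrary: v)
    case 0
    show ?case using key[of "complex_of_real (W v + b) - z" "Im z"] Im_z by simp
  next
    case (Suc d)
    have "0 \<le> \<Sigma> (Suc d) W v"
      unfolding gsum.simps by (rule sum_nonneg) (use Suc in \<open>auto intro: less_imp_le\<close>)
    then show ?case
      using key[of "complex_of_real (W v) - z - (\<Sum>c<K. \<Gamma> d W (c # v))" "Im z + \<Sigma> (Suc d) W v"] Im_z by simp
  qed
qed

lemma gsum_nonneg: "0 \<le> \<Sigma> d W v"
  and Im_gam_pos: "0 < Im (\<Gamma> d W v)"
  and norm_gam_sq: "(norm (\<Gamma> d W v))\<^sup>2 * (Im z + \<Sigma> d W v) = Im (\<Gamma> d W v)"
  and norm_gam_gsum: "norm (\<Gamma> d W v) * (Im z + \<Sigma> d W v) \<le> 1"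
  using gsum_nonneg_gam_pos by blast+

lemma gam_nonzero: "\<Gamma> d W v \<noteq> 0"
  using Im_gam_pos[of d W v] by auto

lemma norm_gam_le: "norm (\<Gamma> d W v) \<le> 1 / Im z"
proof -
  have "norm (\<Gamma> d W v) * Im z \<le> norm (\<Gamma> d W v) * (Im z + \<Sigma> d W v)"
    using gsum_nonneg by (intro mult_left_mono) auto
  also have "\<dots> \<le> 1" by (rule norm_gam_gsum)
  finally show ?thesis using Im_z by (simp add: field_simps)
qed

lemma Im_gam_le: "Im (\<Gamma> d W v) \<le> 1 / Im z"
  using abs_Im_le_cmod[of "\<Gamma> d W v"] norm_gam_le[of d W v] by linarith

text \<open>Two bounds are added: the imaginary part is one summand of \<Sigma>, and
  \<open>(Im z)\<^sup>2\<close> times it is at most \<open>Im z\<close>. Their sum produces the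
  factor \<open>1 + (Im z)\<^sup>2\<close> whose inverse is \<open>q\<close>.\<close>

lemma Im_gam_child:
  assumes "c < K"
  shows "Im (\<Gamma> d W (c # v)) \<le> q * (Im z + \<Sigma> (Suc d) W v)"
proof -
  have "Im (\<Gamma> d W (c # v)) \<le> \<Sigma> (Suc d) W v"
    unfolding gsum.simps using assms Im_gam_pos by (intro member_le_sum) (auto intro: less_imp_le)
  moreover have "Im (\<Gamma> d W (c # v)) * (Im z)\<^sup>2 \<le> 1 / Im z * (Im z)\<^sup>2"
    by (intro mult_right_mono Im_gam_le) auto
  moreover have "1 / Im z * (Im z)\<^sup>2 = Im z" using Im_z by (simp add: power2_eq_square)
  ultimately have "Im (\<Gamma> d W (c # v)) * (1 + (Im z)\<^sup>2) \<le> Im z + \<Sigma> (Suc d) W v"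
    unfolding distrib_left mult_1_right by linarith
  moreover have "1 + (Im z)\<^sup>2 > 0" by (simp add: add_pos_nonneg)
  ultimately show ?thesis unfolding q_def by (simp add: field_simps)
qed

text \<open>The weight \<open>Im z + \<Sigma>\<close> at the lower end makes the induction close:
  one squared factor turns it into the imaginary part of \<Gamma>, which is at most \<open>q\<close>
  times the weight one step higher.\<close>

lemma pathprod_decay:
  assumes "set v \<subseteq> {..<K}" "length v \<le> m"
  shows "norm (pathprod K b z m W r v) * (Im z + \<Sigma> (m - length v) W (v @ r)) \<le> q ^ length v * (Im z + \<Sigma> m W r)"
  using assms
proof (induction v)
  case (Cons c v)
  have m: "m - length v = Suc (m - Suc (length v))" using Cons.prems by simp
  have "norm (pathprod K b z m W r (c # v)) * (Im z + \<Sigma> (m - length (c # v)) W ((c # v) @ r))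
     = Im (\<Gamma> (m - Suc (length v)) W (c # v @ r)) * norm (pathprod K b z m W r v)"
    unfolding norm_gam_sq[symmetric] by (simp add: norm_mult norm_power)
  also have "\<dots> \<le> q * (Im z + \<Sigma> (m - length v) W (v @ r)) * norm (pathprod K b z m W r v)"
    unfolding m using Cons.prems by (intro mult_right_mono Im_gam_child) auto
  also have "\<dots> = q * (norm (pathprod K b z m W r v) * (Im z + \<Sigma> (m - length v) W (v @ r)))"
    by simp
  also have "\<dots> \<le> q * (q ^ length v * (Im z + \<Sigma> m W r))"
    using Cons q_pos by (intro mult_left_mono) auto
  finally show ?case by (simp add: mult.assoc)
qed simp

lemma norm_pathterm_le:
  assumes "v \<in> tree_ball K m"
  shows "norm (pathterm K b z m W r v) \<le> q ^ length v / Im z"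
proof -
  let ?P = "norm (pathprod K b z m W r v)"
  have "?P * Im z \<le> ?P * (Im z + \<Sigma> (m - length v) W (v @ r))"
    using gsum_nonneg by (intro mult_left_mono) auto
  also have "\<dots> \<le> q ^ length v * (Im z + \<Sigma> m W r)"
    using assms by (intro pathprod_decay) (auto simp: tree_ball_def)
  finally have "norm (\<Gamma> m W r) * (?P * Im z) \<le> norm (\<Gamma> m W r) * (q ^ length v * (Im z + \<Sigma> m W r))"
    by (rule mult_left_mono) simp
  also have "\<dots> = q ^ length v * (norm (\<Gamma> m W r) * (Im z + \<Sigma> m W r))" by simp
  also have "\<dots> \<le> q ^ length v * 1"
    using q_pos by (intro mult_left_mono norm_gam_gsum) auto
  finally show ?thesis using Im_z unfolding pathterm_def by (simp add: norm_mult field_simps)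
qed

text \<open>Without the factor at \<open>r\<close> the decay estimate for path terms does not apply
  directly. One of the two factors of the child next to \<open>r\<close> is used in its place, at
  the cost of one power of \<open>q\<close> and one factor \<open>1 / Im z\<close>.\<close>

lemma norm_pathprod_le:
  assumes "v \<in> tree_ball K m" "v \<noteq> []"
  shows "norm (pathprod K b z m W r v) \<le> q ^ (length v - 1) / (Im z)\<^sup>2"
proof -
  obtain u c where v: "v = u @ [c]" using assms(2) by (cases v rule: rev_cases) auto
  obtain m' where m: "m = Suc m'" using assms v unfolding tree_ball_def by (cases m) auto
  have u: "u \<in> tree_ball K m'" using assms(1) unfolding v m tree_ball_def by auto
  have "pathprod K b z m W r v = \<Gamma> m' W (c # r) * pathterm K b z m' W (c # r) u"
    unfolding v m pathterm_def using u by (subst pathprod_snoc) (auto simp: tree_ball_def power2_eq_square)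
  then have "norm (pathprod K b z m W r v) = norm (\<Gamma> m' W (c # r)) * norm (pathterm K b z m' W (c # r) u)"
    by (simp add: norm_mult)
  also have "\<dots> \<le> 1 / Im z * (q ^ length u / Im z)"
    using Im_z by (intro mult_mono norm_gam_le norm_pathterm_le u) auto
  finally show ?thesis unfolding v by (simp add: power2_eq_square)
qed

text \<open>A conservation law: each child subtree sums to its own weight over \<open>Im z\<close>,
  and the squared factor in front turns that weight into the imaginary part of its \<Gamma>.
  Equality makes the sum over all paths bounded, whatever the relation between \<open>q\<close> and
  \<open>K\<close>.\<close>

lemma sum_norm_pathprod:
  "(\<Sum>v\<in>tree_ball K m. norm (pathprod K b z m W r v)) = (Im z + \<Sigma> m W r) / Im z"
proof (induction m arbitrary: r)
  case 0
  show ?case using Im_z by (simp add: tree_ball_0)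
next
  case (Suc m)
  have "(\<Sum>v\<in>tree_ball K (Suc m). norm (pathprod K b z (Suc m) W r v))
     = 1 + (\<Sum>c<K. \<Sum>v\<in>tree_ball K m. (norm (\<Gamma> m W (c # r)))\<^sup>2 * norm (pathprod K b z m W (c # r) v))"
    unfolding sum_tree_ball_Suc
    by (simp add: pathprod_snoc tree_ball_def norm_mult norm_power)
  also have "\<dots> = 1 + (\<Sum>c<K. Im (\<Gamma> m W (c # r)) / Im z)"
    by (simp add: sum_distrib_left[symmetric] Suc norm_gam_sq)
  finally show ?case using Im_z by (simp add: sum_divide_distrib[symmetric] field_simps)
qed

lemma norm_nodesum_le: "norm (nodesum K b z m W r) \<le> 1 / Im z"
proof -
  have "norm (nodesum K b z m W r) \<le> (\<Sum>v\<in>tree_ball K m. norm (\<Gamma> m W r) * norm (pathprod K b z m W r v))"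
    unfolding nodesum_def pathterm_def norm_mult[symmetric] by (rule norm_sum)
  also have "\<dots> = norm (\<Gamma> m W r) * (Im z + \<Sigma> m W r) / Im z"
    by (simp add: sum_distrib_left[symmetric] sum_norm_pathprod)
  also have "\<dots> \<le> 1 / Im z" using norm_gam_gsum Im_z by (intro divide_right_mono) auto
  finally show ?thesis .
qed

end

section \<open>Expansion of the finite-volume Green function along ancestors\<close>

lemma sum_H_tree:
  fixes \<psi> :: "nat list \<Rightarrow> complex"
  assumes x: "x \<in> tree_ball K L"
  shows "(\<Sum>y\<in>tree_ball K L. complex_of_real (H_tree K b L W x y) * \<psi> y) =
     complex_of_real (W x + (if length x = L then b else 0)) * \<psi> x
     + (if x = [] then 0 else \<psi> (tl x)) + (if length x < L then \<Sum>c<K. \<psi> (c # x) else 0)"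
proof -
  let ?B = "tree_ball K L"
  let ?P = "if x = [] then {} else {tl x}"
  let ?C = "if length x < L then (\<lambda>c. c # x) ` {..<K} else {}"
  have adj: "{y \<in> ?B. tree_adj x y} = ?P \<union> ?C"
    using x unfolding tree_ball_def tree_adj_def by (cases x) auto
  have "(\<Sum>y\<in>?B. complex_of_real (H_tree K b L W x y) * \<psi> y) =
     (\<Sum>y\<in>?B. (if tree_adj x y then \<psi> y else 0)
       + (if y = x then complex_of_real (W x + (if length x = L then b else 0)) * \<psi> x else 0))"
    unfolding H_tree_def by (rule sum.cong) (auto simp: tree_adj_def)
  also have "\<dots> = (\<Sum>y\<in>{y \<in> ?B. tree_adj x y}. \<psi> y)
      + complex_of_real (W x + (if length x = L then b else 0)) * \<psi> x"
    unfolding sum.distrib using x by (simp add: sum.inter_filter[symmetric] finite_tree_ball)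
  also have "(\<Sum>y\<in>{y \<in> ?B. tree_adj x y}. \<psi> y) = sum \<psi> ?P + sum \<psi> ?C"
    unfolding adj by (rule sum.union_disjoint) (auto simp: neq_Nil_conv)
  also have "sum \<psi> ?C = (if length x < L then \<Sum>c<K. \<psi> (c # x) else 0)"
    by (simp add: sum.reindex inj_on_def)
  finally show ?thesis by (simp add: algebra_simps)
qed

lemma H_tree_sym: "H_tree K b L W x y = H_tree K b L W y x"
  unfolding H_tree_def tree_adj_def by auto

locale tree_green = upper_half +
  fixes L :: nat and W :: "nat list \<Rightarrow> real" and g :: "nat list \<Rightarrow> nat list \<Rightarrow> complex"
  assumes g_eq: "\<And>p x. p \<in> tree_ball K L \<Longrightarrow> x \<in> tree_ball K L \<Longrightarrow>
      (\<Sum>y\<in>tree_ball K L. complex_of_real (H_tree K b L W x y) * g p y) - z * g p x = of_bool (x = p)"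
    and g_sym: "\<And>p x. p \<in> tree_ball K L \<Longrightarrow> x \<in> tree_ball K L \<Longrightarrow> g p x = g x p"
begin

lemma g_eq':
  assumes "p \<in> tree_ball K L" "x \<in> tree_ball K L"
  shows "(complex_of_real (W x + (if length x = L then b else 0)) - z) * g p x
     + (if x = [] then 0 else g p (tl x)) + (if length x < L then \<Sum>c<K. g p (c # x) else 0) = of_bool (x = p)"
  using g_eq[OF assms] unfolding sum_H_tree[OF assms(2)] by (simp add: algebra_simps)

lemma gam_eq:
  assumes "length x \<le> L"
  shows "1 / \<Gamma> (L - length x) W x = complex_of_real (W x + (if length x = L then b else 0)) - z
     - (if length x < L then \<Sum>c<K. \<Gamma> (L - Suc (length x)) W (c # x) else 0)"
proof (cases "length x = L")
  case False
  then have "L - length x = Suc (L - Suc (length x))" using assms by simp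
  then show ?thesis using False assms by simp
qed simp

text \<open>The subtree of \<open>x\<close> contains no source, so the equation there is homogeneous
  and is eliminated from the leaves upwards. Only the value at the parent of \<open>x\<close>
  remains.\<close>

lemma g_below:
  assumes p: "p \<in> tree_ball K L" and "x \<in> tree_ball K L" "x \<noteq> []" "\<And>u. p \<noteq> u @ x"
  shows "g p x = - \<Gamma> (L - length x) W x * g p (tl x)"
  using assms(2-)
proof (induction "L - length x" arbitrary: x)
  case 0
  then have l: "length x = L" unfolding tree_ball_def by auto
  have np: "x \<noteq> p" using 0(4)[of "[]"] by auto
  have "g p x / \<Gamma> (L - length x) W x + g p (tl x) = 0"
    using g_eq'[OF p 0(2)] 0(3) l np gam_eq[of x] by (simp add: divide_inverse mult.commute)
  then show ?case using gam_nonzero[of "L - length x" W x] by (simp add: field_simps add_eq_0_iff)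
next
  case (Suc d)
  then have l: "length x < L" by simp
  have np: "x \<noteq> p" using Suc(5)[of "[]"] by auto
  have child: "g p (c # x) = - \<Gamma> (L - Suc (length x)) W (c # x) * g p x" if "c < K" for c
  proof -
    have "g p (c # x) = - \<Gamma> (L - length (c # x)) W (c # x) * g p (tl (c # x))"
    proof (rule Suc(1))
      show "d = L - length (c # x)" using Suc(2) by simp
      show "c # x \<in> tree_ball K L" using Suc(3) l that unfolding tree_ball_def by auto
      show "p \<noteq> u @ c # x" for u using Suc(5)[of "u @ [c]"] by simp
    qed simp
    then show ?thesis by simp
  qed
  have "(\<Sum>c<K. g p (c # x)) = - (\<Sum>c<K. \<Gamma> (L - Suc (length x)) W (c # x)) * g p x"
    by (simp add: child sum_negf sum_distrib_right)
  then have "g p x * (1 / \<Gamma> (L - length x) W x) + g p (tl x) = 0"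
    unfolding gam_eq[OF less_imp_le[OF l]] using g_eq'[OF p Suc(3)] Suc(4) l np
    by (simp add: algebra_simps)
  then show ?case using gam_nonzero[of "L - length x" W x] by (simp add: field_simps add_eq_0_iff)
qed

lemma g_diag:
  assumes p: "p \<in> tree_ball K L"
  shows "g p p = \<Gamma> (L - length p) W p * (1 - (if p = [] then 0 else g p (tl p)))"
proof -
  have child: "g p (c # p) = - \<Gamma> (L - Suc (length p)) W (c # p) * g p p" if "c < K" "length p < L" for c
  proof -
    have "c # p \<in> tree_ball K L" using p that unfolding tree_ball_def by auto
    then have "g p (c # p) = - \<Gamma> (L - length (c # p)) W (c # p) * g p (tl (c # p))"
      by (intro g_below[OF p]) (auto dest: arg_cong[of _ _ length])
    then show ?thesis by simp
  qed
  have l: "length p \<le> L" using p unfolding tree_ball_def by simp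
  have "(\<Sum>c<K. g p (c # p)) = - (\<Sum>c<K. \<Gamma> (L - Suc (length p)) W (c # p)) * g p p" if "length p < L"
    using that by (simp add: child sum_negf sum_distrib_right)
  then have "g p p * (1 / \<Gamma> (L - length p) W p) + (if p = [] then 0 else g p (tl p)) = 1"
    unfolding gam_eq[OF l] using g_eq'[OF p p]
    by (cases "length p < L") (simp_all add: algebra_simps)
  then show ?thesis using gam_nonzero[of "L - length p" W p] by (simp add: field_simps)
qed

lemma tree_ball_ConsD: "c # p \<in> tree_ball K L \<Longrightarrow> p \<in> tree_ball K L"
  unfolding tree_ball_def by auto

text \<open>By symmetry the off-diagonal value next to the source is also the one of the solution
  with source \<open>p\<close>, to which \<open>g_below\<close> applies. The two minus signs
  cancel.\<close>

lemma g_diag_Cons: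
  assumes p: "c # p \<in> tree_ball K L"
  shows "g (c # p) (c # p) = \<Gamma> (L - Suc (length p)) W (c # p) + (\<Gamma> (L - Suc (length p)) W (c # p))\<^sup>2 * g p p"
proof -
  have p': "p \<in> tree_ball K L" using tree_ball_ConsD[OF p] .
  have "g (c # p) p = g p (c # p)" by (rule g_sym[OF p p'])
  also have "\<dots> = - \<Gamma> (L - Suc (length p)) W (c # p) * g p p"
    using g_below[OF p' p] by (auto dest: arg_cong[of _ _ length])
  finally show ?thesis using g_diag[OF p] by (simp add: power2_eq_square algebra_simps)
qed

lemma g_diag_expand:
  assumes "x \<in> tree_ball K L"
  shows "g x x = (\<Sum>i\<le>length x. pathterm K b z (L - length x + i) W (drop i x) (take i x))"
  using assms
proof (induction x)
  case Nil
  then show ?case using g_diag[of "[]"] by (simp add: pathterm_def)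
next
  case (Cons c x)
  have l: "Suc (length x) \<le> L" using Cons.prems unfolding tree_ball_def by simp
  have "(\<Sum>i\<le>length (c # x). pathterm K b z (L - length (c # x) + i) W (drop i (c # x)) (take i (c # x)))
    = \<Gamma> (L - Suc (length x)) W (c # x)
      + (\<Sum>i\<le>length x. pathterm K b z (L - length (c # x) + Suc i) W (drop i x) (c # take i x))"
    unfolding length_Cons sum.atMost_Suc_shift by (simp add: pathterm_def)
  also have "(\<Sum>i\<le>length x. pathterm K b z (L - length (c # x) + Suc i) W (drop i x) (c # take i x))
    = (\<Sum>i\<le>length x. (\<Gamma> (L - Suc (length x)) W (c # x))\<^sup>2 * pathterm K b z (L - length x + i) W (drop i x) (take i x))"
  proof (rule sum.cong[OF refl])
    fix i assume i: "i \<in> {..length x}"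
    \<comment> \<open>Both sides are the height of the same ancestor; the truncated subtraction is
      harmless because \<open>c # x\<close> still lies in the ball.\<close>
    have e: "L - length (c # x) + Suc i = L - length x + i" using l by simp
    have e2: "L - length x + i - Suc (length (take i x)) = L - Suc (length x)" using l i by simp
    show "pathterm K b z (L - length (c # x) + Suc i) W (drop i x) (c # take i x)
       = (\<Gamma> (L - Suc (length x)) W (c # x))\<^sup>2 * pathterm K b z (L - length x + i) W (drop i x) (take i x)"
      unfolding e pathterm_def pathprod.simps e2 by simp
  qed
  also have "\<dots> = (\<Gamma> (L - Suc (length x)) W (c # x))\<^sup>2 * g x x"
    using Cons.IH[OF tree_ball_ConsD[OF Cons.prems]] by (simp add: sum_distrib_left)
  finally show ?case using g_diag_Cons[OF Cons.prems] by simp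
qed

lemma g_trace:
  "(\<Sum>x\<in>tree_ball K L. g x x) = (\<Sum>r\<in>tree_ball K L. nodesum K b z (L - length r) W r)"
proof -
  have "(\<Sum>x\<in>tree_ball K L. g x x)
     = (\<Sum>(x, i)\<in>Sigma (tree_ball K L) (\<lambda>x. {..length x}). pathterm K b z (L - length x + i) W (drop i x) (take i x))"
    by (simp add: g_diag_expand sum.Sigma finite_tree_ball)
  also have "\<dots> = (\<Sum>(r, v)\<in>Sigma (tree_ball K L) (\<lambda>r. tree_ball K (L - length r)). pathterm K b z (L - length r) W r v)"
    by (rule sum.reindex_bij_witness[where i="\<lambda>(r, v). (v @ r, length v)" and j="\<lambda>(x, i). (drop i x, take i x)"])
      (auto simp: tree_ball_def dest: in_set_takeD in_set_dropD)
  also have "\<dots> = (\<Sum>r\<in>tree_ball K L. nodesum K b z (L - length r) W r)"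
    unfolding nodesum_def by (simp add: sum.Sigma finite_tree_ball)
  finally show ?thesis .
qed

text \<open>A path product carries squared factors, so it measures the squared modulus of an
  off-diagonal entry.\<close>

lemma norm_g_path:
  assumes "v @ r \<in> tree_ball K L"
  shows "(norm (g r (v @ r)))\<^sup>2 = norm (pathprod K b z (L - length r) W r v) * (norm (g r r))\<^sup>2"
  using assms
proof (induction v)
  case (Cons c v)
  have vr: "v @ r \<in> tree_ball K L" using tree_ball_ConsD Cons.prems by simp
  have r: "r \<in> tree_ball K L" using Cons.prems unfolding tree_ball_def by auto
  have "g r ((c # v) @ r) = - \<Gamma> (L - length ((c # v) @ r)) W ((c # v) @ r) * g r (tl ((c # v) @ r))"
    by (rule g_below[OF r Cons.prems]) (auto dest: arg_cong[of _ _ length])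
  moreover have "L - length ((c # v) @ r) = L - length r - Suc (length v)" by simp
  ultimately show ?case
    using Cons.IH[OF vr] by (simp add: norm_mult power_mult_distrib norm_power)
qed simp

end

section \<open>The canopy graph\<close>

text \<open>The first letter is the least significant digit, so that passing to the parent is
  \<open>tl\<close> on words and \<open>div K\<close> on indices.\<close>

fun dval :: "nat \<Rightarrow> nat list \<Rightarrow> nat" where
  "dval K [] = 0"
| "dval K (c # v) = c + K * dval K v"

fun dig :: "nat \<Rightarrow> nat \<Rightarrow> nat \<Rightarrow> nat list" where
  "dig K 0 j = []"
| "dig K (Suc d) j = (j mod K) # dig K d (j div K)"

lemma length_dig [simp]: "length (dig K d j) = d"
  by (induction d arbitrary: j) auto

lemma set_dig: "K > 0 \<Longrightarrow> set (dig K d j) \<subseteq> {..<K}"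
  by (induction d arbitrary: j) auto

lemma dval_dig: "j < K ^ d \<Longrightarrow> dval K (dig K d j) = j"
proof (induction d arbitrary: j)
  case (Suc d)
  then have "j div K < K ^ d" by (simp add: less_mult_imp_div_less mult.commute)
  then show ?case using Suc.IH by simp
qed simp

lemma dig_0: "dig K d 0 = replicate d 0"
  by (induction d) auto

lemma dval_replicate_0 [simp]: "dval K (replicate d 0) = 0"
  by (induction d) auto

lemma dval_append: "dval K (u @ v) = dval K u + K ^ length u * dval K v"
  by (induction u) (auto simp: algebra_simps)

lemma dig_dval: "set v \<subseteq> {..<K} \<Longrightarrow> dig K (length v) (dval K v) = v"
  by (induction v) auto

lemma dig_child: "c < K \<Longrightarrow> dig K (Suc d) (K * j + c) = c # dig K d j"
  by simp

text \<open>The potential of the canopy graph on the finite tree of height \<open>m\<close> hanging below \<open>x\<^sub>m = (m, 0)\<close>,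
  transported to words: the vertex \<open>(k, j)\<close> becomes the word of the \<open>m - k\<close> base-\<open>K\<close> digits of \<open>j\<close>.\<close>
definition canopy_pot :: "nat \<Rightarrow> (nat \<times> nat \<Rightarrow> real) \<Rightarrow> nat \<Rightarrow> nat list \<Rightarrow> real" where
  "canopy_pot K w m u = w (m - length u, dval K u)"

text \<open>The tree below \<open>x\<^sub>m\<close> sits inside the tree below
  \<open>x\<^sub>N\<close> as the words ending in \<open>N - m\<close> zeros; its potential does not
  depend on the ambient height.\<close>

lemma canopy_pot_append_zeros:
  assumes "m \<le> N"
  shows "canopy_pot K w N (u @ replicate (N - m) 0) = canopy_pot K w m u"
proof -
  have "N - (length u + (N - m)) = m - length u" using assms by simp
  then show ?thesis unfolding canopy_pot_def by (simp add: dval_append)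
qed

lemma canopy_nbr_sum:
  fixes \<psi> :: "nat \<times> nat \<Rightarrow> complex"
  assumes K: "K > 0"
  shows "(\<Sum>y'\<in>{y'. canopy_adj K (k, j) y'}. \<psi> y')
     = \<psi> (Suc k, j div K) + (if k = 0 then 0 else \<Sum>c<K. \<psi> (k - 1, K * j + c))"
proof -
  let ?C = "if k = 0 then {} else (\<lambda>c. (k - 1, K * j + c)) ` {..<K}"
  have "{y'. canopy_adj K (k, j) y'} = insert (Suc k, j div K) ?C"
  proof (intro equalityI subsetI)
    fix y assume "y \<in> {y'. canopy_adj K (k, j) y'}"
    then consider "y = (Suc k, j div K)" | "k = Suc (fst y)" "j = snd y div K"
      unfolding canopy_adj_def by auto
    then show "y \<in> insert (Suc k, j div K) ?C"
    proof cases
      case 2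
      have "snd y = K * j + snd y mod K" "snd y mod K < K" using 2 K by simp_all
      moreover have "y = (k - 1, snd y)" using 2 by (cases y) auto
      ultimately show ?thesis using 2 by (metis (mono_tags, lifting) imageI insertCI lessThan_iff nat.distinct(1))
    qed simp
  next
    fix y assume "y \<in> insert (Suc k, j div K) ?C"
    then show "y \<in> {y'. canopy_adj K (k, j) y'}"
      using K unfolding canopy_adj_def by (auto split: if_splits)
  qed
  moreover have "(Suc k, j div K) \<notin> ?C" by auto
  moreover have "finite ?C" by simp
  moreover have "sum \<psi> ?C = (if k = 0 then 0 else \<Sum>c<K. \<psi> (k - 1, K * j + c))"
    by (simp add: sum.reindex inj_on_def)
  ultimately show ?thesis by simp
qed

section \<open>The square summable resolvent solution on the canopy graph\<close>

locale canopy = upper_half +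
  fixes w :: "nat \<times> nat \<Rightarrow> real" and n :: nat
  assumes K2: "K \<ge> 2"
begin

lemma K_pos: "K > 0" using K2 by simp

abbreviation "HN N \<equiv> H_tree K b N (canopy_pot K w N)"
abbreviation "gN N \<equiv> green (tree_ball K N) (HN N) z"
abbreviation "xN N \<equiv> replicate (N - n) (0::nat)"

lemma sym: "symmetric_on (tree_ball K N) (H_tree K b N W)"
  by unfold_locales (rule finite_tree_ball, rule H_tree_sym)

lemma Im_z0: "Im z \<noteq> 0" using Im_z by simp

lemma tg: "tree_green K b z N (canopy_pot K w N) (gN N)"
  by unfold_locales (rule symmetric_on.green_eq[OF sym Im_z0], assumption+, rule symmetric_on.green_sym[OF sym])

lemma xN_in: "xN N \<in> tree_ball K N"
  using K_pos unfolding tree_ball_def by auto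

text \<open>Only meaningful when \<open>y\<close> lies in the tree below \<open>x\<^sub>N\<close>,
  which holds for all large \<open>N\<close>.\<close>

definition psiN :: "nat \<Rightarrow> nat \<times> nat \<Rightarrow> complex" where
  "psiN N y = gN N (xN N) (dig K (N - fst y) (snd y))"

text \<open>Restricting the larger problem to the smaller tree only leaves an error at the root,
  where the solution is small.\<close>
lemma psiN_diff:
  assumes N: "n \<le> N" "N < N'" and y: "fst y \<le> N" "snd y < K ^ (N - fst y)"
  shows "norm (psiN N' y - psiN N y) \<le> sqrt (q ^ (N - n)) / (Im z) ^ 3"
proof -
  let ?ext = "\<lambda>v. v @ replicate (N' - N) (0::nat)"
  interpret S: symmetric_on "tree_ball K N" "HN N" by (rule sym)
  interpret S': symmetric_on "tree_ball K N'" "HN N'" by (rule sym)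
  interpret G': tree_green K b z N' "canopy_pot K w N'" "gN N'" by (rule tg)
  define h where "h v = gN N' (xN N') (?ext v)" for v
  define r :: "nat list" where "r = replicate (N' - N - 1) 0"
  \<comment> \<open>The value of the larger solution at the parent of the root of the smaller tree:
    the only coupling between the two problems.\<close>
  define \<beta> where "\<beta> = gN N' (xN N') r"
  have ext_in: "?ext v \<in> tree_ball K N'" if "v \<in> tree_ball K N" for v
    using that N K_pos unfolding tree_ball_def by auto
  have ext0: "?ext [] = 0 # r" unfolding r_def using N by (cases "N' - N") auto
  have xext: "xN N' = ?ext (xN N)" using N by (simp add: replicate_add[symmetric])
  have heq: "(\<Sum>v'\<in>tree_ball K N. complex_of_real (HN N v v') * h v') - z * h v
      = of_bool (v = xN N) - \<beta> * of_bool (v = [])" if v: "v \<in> tree_ball K N" for v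
  proof -
    have l: "length v \<le> N" using v unfolding tree_ball_def by simp
    have lens: "(length (?ext v) = N') = (length v = N)" "(length (?ext v) < N') = (length v < N)"
      using N l by auto
    have par: "gN N' (xN N') (tl (?ext v)) = (if v = [] then \<beta> else h (tl v))"
      unfolding h_def \<beta>_def using ext0 by (cases v) auto
    have W: "canopy_pot K w N' (?ext v) = canopy_pot K w N v"
      by (rule canopy_pot_append_zeros) (use N in simp)
    have ne: "?ext v \<noteq> []" using N by simp
    have hv: "gN N' (xN N') (?ext v) = h v" and hc: "\<And>c. gN N' (xN N') (c # ?ext v) = h (c # v)"
      by (simp_all add: h_def)
    have eqx: "(?ext v = xN N') = (v = xN N)" unfolding xext by (simp only: append_same_eq)
    have "(complex_of_real (canopy_pot K w N v + (if length v = N then b else 0)) - z) * h v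
      + (if v = [] then \<beta> else h (tl v)) + (if length v < N then \<Sum>c<K. h (c # v) else 0) = of_bool (v = xN N)"
      using G'.g_eq'[OF xN_in ext_in[OF v]] ne unfolding lens W par eqx hv hc by (simp only: if_False)
    then show ?thesis unfolding sum_H_tree[OF v] by (auto simp: algebra_simps)
  qed
  define v where "v = dig K (N - fst y) (snd y)"
  have v: "v \<in> tree_ball K N" unfolding v_def tree_ball_def using set_dig[OF K_pos] y by auto
  have psi': "psiN N' y = h v"
  proof -
    have "dig K (N' - fst y) (snd y) = ?ext v"
    proof -
      have "dval K (?ext v) = snd y" unfolding v_def by (simp add: dval_append dval_dig y)
      moreover have "length (?ext v) = N' - fst y" unfolding v_def using N y by simp
      moreover have "set (?ext v) \<subseteq> {..<K}" using v K_pos unfolding tree_ball_def by auto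
      ultimately show ?thesis using dig_dval by metis
    qed
    then show ?thesis unfolding psiN_def h_def by simp
  qed
  have "h v = (\<Sum>x\<in>tree_ball K N. gN N v x * (of_bool (x = xN N) - \<beta> * of_bool (x = [])))"
    by (rule S.green_solves[OF Im_z0 v heq])
  also have "\<dots> = (\<Sum>x\<in>tree_ball K N. (if x = xN N then gN N v (xN N) else 0) - (if x = [] then \<beta> * gN N v [] else 0))"
    by (rule sum.cong) (auto simp: algebra_simps)
  also have "\<dots> = gN N v (xN N) - \<beta> * gN N v []"
    using xN_in[of N] by (simp add: sum_subtractf finite_tree_ball)
  finally have hv: "h v = gN N v (xN N) - \<beta> * gN N v []" .
  have "psiN N' y - psiN N y = - \<beta> * gN N v []"
  proof -
    have "psiN N y = gN N v (xN N)" unfolding psiN_def v_def by (rule S.green_sym)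
    then show ?thesis using psi' hv by simp
  qed
  then have "norm (psiN N' y - psiN N y) = norm \<beta> * norm (gN N v [])" by (simp add: norm_mult)
  also have "\<dots> \<le> (sqrt (q ^ (N - n)) / (Im z)\<^sup>2) * (1 / \<bar>Im z\<bar>)"
  proof (intro mult_mono S.norm_green_le[OF Im_z0 v])
    have r_in: "r \<in> tree_ball K N'" unfolding r_def tree_ball_def using K_pos by auto
    \<comment> \<open>The vertex \<open>r\<close> lies one layer above \<open>x\<^sub>N\<close>, so
      this path has \<open>N - n + 1\<close> letters, and \<open>norm_pathprod_le\<close> yields the
      power \<open>N - n\<close> of \<open>q\<close>.\<close>
    define u :: "nat list" where "u = replicate (Suc (N - n)) 0"
    have "Suc (N - n) + (N' - N - 1) = N' - n" using N by simp
    then have ur: "u @ r = xN N'" unfolding u_def r_def replicate_add[symmetric] by (simp only:)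
    have "(norm \<beta>)\<^sup>2 = (norm (gN N' r (u @ r)))\<^sup>2" unfolding \<beta>_def ur by (subst S'.green_sym) simp
    also have "\<dots> = norm (pathprod K b z (N' - length r) (canopy_pot K w N') r u) * (norm (gN N' r r))\<^sup>2"
      by (rule G'.norm_g_path) (unfold ur, rule xN_in)
    also have "\<dots> \<le> (q ^ (length u - 1) / (Im z)\<^sup>2) * (1 / \<bar>Im z\<bar>)\<^sup>2"
    proof (intro mult_mono norm_pathprod_le power_mono S'.norm_green_le[OF Im_z0 r_in r_in])
      show "u \<in> tree_ball K (N' - length r)" unfolding u_def r_def tree_ball_def using K_pos N by auto
      show "u \<noteq> []" unfolding u_def by simp
    qed (use q_pos in auto)
    also have "\<dots> = (sqrt (q ^ (N - n)) / (Im z)\<^sup>2)\<^sup>2"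
      unfolding u_def using q_pos by (simp add: power_divide power_mult_distrib)
    finally show "norm \<beta> \<le> sqrt (q ^ (N - n)) / (Im z)\<^sup>2"
      by (rule power2_le_imp_le) (use q_pos in auto)
  qed (use q_pos in auto)
  also have "\<dots> = sqrt (q ^ (N - n)) / (Im z) ^ 3"
    using Im_z by (simp add: power2_eq_square power3_eq_cube)
  finally show ?thesis .
qed

text \<open>The strict bound on the layer keeps the parent of \<open>y\<close> inside the tree, so
  that the finite-volume equation at \<open>y\<close> has all its canopy neighbours.\<close>

lemma ev_in_tree: "eventually (\<lambda>N. n \<le> N \<and> fst y < N \<and> snd y < K ^ (N - fst y)) sequentially"
proof (rule eventually_sequentiallyI)
  fix N assume N: "n + Suc (fst y) + snd y \<le> N"
  have "snd y < K ^ snd y" using K2 by (intro power_gt_expt) simp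
  also have "\<dots> \<le> K ^ (N - fst y)" using K_pos N by (intro power_increasing) auto
  finally show "n \<le> N \<and> fst y < N \<and> snd y < K ^ (N - fst y)" using N by simp
qed

lemma psiN_convergent: "convergent (\<lambda>N. psiN N y)"
proof (rule Cauchy_convergent, rule CauchyI')
  fix \<epsilon> :: real assume e: "\<epsilon> > 0"
  have "(\<lambda>i. sqrt (q ^ (i + n - n)) / (Im z) ^ 3) \<longlonglongrightarrow> sqrt 0 / (Im z) ^ 3"
    using q_pos q_less_1 Im_z by (intro tendsto_divide tendsto_real_sqrt) (auto intro!: LIMSEQ_power_zero)
  then have "(\<lambda>N. sqrt (q ^ (N - n)) / (Im z) ^ 3) \<longlonglongrightarrow> 0"
    using LIMSEQ_offset[of "\<lambda>N. sqrt (q ^ (N - n)) / (Im z) ^ 3" n 0] by simp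
  then have "eventually (\<lambda>N. sqrt (q ^ (N - n)) / (Im z) ^ 3 < \<epsilon>) sequentially"
    using e by (rule order_tendstoD(2))
  with ev_in_tree[of y] have "eventually (\<lambda>N. \<forall>N'>N. dist (psiN N y) (psiN N' y) < \<epsilon>) sequentially"
  proof eventually_elim
    case (elim N)
    show ?case
    proof (intro allI impI)
      fix N' assume "N < N'"
      then have "norm (psiN N' y - psiN N y) \<le> sqrt (q ^ (N - n)) / (Im z) ^ 3"
        using elim by (intro psiN_diff) auto
      then show "dist (psiN N y) (psiN N' y) < \<epsilon>" using elim by (simp add: dist_norm norm_minus_commute)
    qed
  qed
  then show "\<exists>M. \<forall>m\<ge>M. \<forall>n>m. dist (psiN m y) (psiN n y) < \<epsilon>"
    unfolding eventually_sequentially .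
qed

definition psi :: "nat \<times> nat \<Rightarrow> complex" where
  "psi y = lim (\<lambda>N. psiN N y)"

lemma psiN_tendsto: "(\<lambda>N. psiN N y) \<longlonglongrightarrow> psi y"
  unfolding psi_def using psiN_convergent by (simp add: convergent_LIMSEQ_iff)

lemma psiN_eq:
  assumes N: "n \<le> N" "k < N" "j < K ^ (N - k)"
  shows "psiN N (Suc k, j div K) + (if k = 0 then 0 else \<Sum>c<K. psiN N (k - 1, K * j + c))
     + (complex_of_real (w (k, j) + (if k = 0 then b else 0)) - z) * psiN N (k, j) = (if (k, j) = (n, 0) then 1 else 0)"
proof -
  interpret G: tree_green K b z N "canopy_pot K w N" "gN N" by (rule tg)
  define x where "x = dig K (N - k) j"
  have x: "x \<in> tree_ball K N" unfolding x_def tree_ball_def using set_dig[OF K_pos] by auto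
  have len: "length x = N - k" unfolding x_def by simp
  have pot: "canopy_pot K w N x = w (k, j)"
    unfolding canopy_pot_def len using N by (simp add: x_def dval_dig)
  have S: "N - k = Suc (N - Suc k)" using N by simp
  have ne: "x \<noteq> []" using len S by auto
  have tl: "tl x = dig K (N - Suc k) (j div K)" unfolding x_def S by simp
  have ch: "c # x = dig K (N - (k - 1)) (K * j + c)" if "k \<noteq> 0" "c < K" for c
  proof -
    have "N - (k - 1) = Suc (N - k)" using N that by simp
    then show ?thesis using dig_child[OF that(2)] unfolding x_def by simp
  qed
  have eqx: "x = xN N \<longleftrightarrow> (k, j) = (n, 0)"
  proof
    assume a: "x = xN N"
    then have "k = n" using len N by simp
    moreover have "j = 0" using a dval_dig[OF N(3)] unfolding x_def by simp
    ultimately show "(k, j) = (n, 0)" by simp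
  qed (simp add: x_def dig_0)
  have lN: "length x = N \<longleftrightarrow> k = 0" "length x < N \<longleftrightarrow> k \<noteq> 0" unfolding len using N by auto
  have p: "psiN N (k, j) = gN N (xN N) x" "psiN N (Suc k, j div K) = gN N (xN N) (tl x)"
    unfolding psiN_def tl unfolding x_def by simp_all
  have s: "(if k \<noteq> 0 then \<Sum>c<K. gN N (xN N) (c # x) else 0) = (if k = 0 then 0 else \<Sum>c<K. psiN N (k - 1, K * j + c))"
    unfolding psiN_def using ch by simp
  show ?thesis
    using G.g_eq'[OF xN_in x] unfolding lN s pot eqx p using ne by (simp add: algebra_simps)
qed

lemma psi_resolvent_eq: "canopy_resolvent_eq K b w z (n, 0) psi"
  unfolding canopy_resolvent_eq_def
proof
  fix y :: "nat \<times> nat"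
  obtain k j where y: "y = (k, j)" by (cases y)
  let ?L = "\<lambda>\<psi>. \<psi> (Suc k, j div K) + (if k = 0 then 0 else \<Sum>c<K. \<psi> (k - 1, K * j + c))
     + (complex_of_real (w (k, j) + (if k = 0 then b else 0)) - z) * \<psi> (k, j)"
  have "(\<lambda>N. ?L (psiN N)) \<longlonglongrightarrow> ?L psi"
    by (cases "k = 0") (auto intro!: tendsto_intros psiN_tendsto)
  moreover have "eventually (\<lambda>N. (if (k, j) = (n, 0) then 1 else 0) = ?L (psiN N)) sequentially"
    using ev_in_tree[of "(k, j)"] by eventually_elim (rule psiN_eq[symmetric], auto)
  then have "(\<lambda>N. ?L (psiN N)) \<longlonglongrightarrow> (if (k, j) = (n, 0) then 1 else 0)"
    by (rule Lim_transform_eventually[OF tendsto_const])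
  ultimately have "?L psi = (if (k, j) = (n, 0) then 1 else 0)" by (rule LIMSEQ_unique)
  then show "(\<Sum>y'\<in>{y'. canopy_adj K y y'}. psi y')
       + (complex_of_real (w y + (if fst y = 0 then b else 0)) - z) * psi y = (if y = (n, 0) then 1 else 0)"
    unfolding y canopy_nbr_sum[OF K_pos] by simp
qed

text \<open>On a finite set the digit map is eventually an injection into the tree, and the
  volume-independent bound \<open>green_norm_sum\<close> survives the pointwise limit.\<close>

lemma psi_finite_sum:
  assumes Y: "finite Y"
  shows "(\<Sum>y\<in>Y. (norm (psi y))\<^sup>2) \<le> 1 / (Im z)\<^sup>2"
proof (rule tendsto_upperbound)
  show "(\<lambda>N. \<Sum>y\<in>Y. (norm (psiN N y))\<^sup>2) \<longlonglongrightarrow> (\<Sum>y\<in>Y. (norm (psi y))\<^sup>2)"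
    by (intro tendsto_intros psiN_tendsto)
  have "eventually (\<lambda>N. \<forall>y\<in>Y. n \<le> N \<and> fst y < N \<and> snd y < K ^ (N - fst y)) sequentially"
    by (rule eventually_ball_finite[OF Y]) (use ev_in_tree in blast)
  then show "eventually (\<lambda>N. (\<Sum>y\<in>Y. (norm (psiN N y))\<^sup>2) \<le> 1 / (Im z)\<^sup>2) sequentially"
  proof eventually_elim
    case (elim N)
    interpret S: symmetric_on "tree_ball K N" "HN N" by (rule sym)
    let ?f = "\<lambda>y. dig K (N - fst y) (snd y)"
    have inj: "inj_on ?f Y"
    proof (rule inj_onI)
      fix y y' assume yy: "y \<in> Y" "y' \<in> Y" "?f y = ?f y'"
      have "N - fst y = N - fst y'" using arg_cong[OF yy(3), of length] by simp
      then have "fst y = fst y'" using elim yy by (metis diff_diff_cancel less_imp_le)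
      moreover have "dval K (?f y) = snd y" "dval K (?f y') = snd y'"
        by (rule dval_dig, use elim yy in blast)+
      then have "snd y = snd y'" using yy(3) by simp
      ultimately show "y = y'" by (simp add: prod_eq_iff)
    qed
    have sub: "?f ` Y \<subseteq> tree_ball K N" unfolding tree_ball_def using set_dig[OF K_pos] by auto
    have "(\<Sum>y\<in>Y. (norm (psiN N y))\<^sup>2) = (\<Sum>v\<in>?f ` Y. (norm (gN N (xN N) v))\<^sup>2)"
      unfolding psiN_def by (simp add: sum.reindex[OF inj])
    also have "\<dots> \<le> (\<Sum>v\<in>tree_ball K N. (norm (gN N (xN N) v))\<^sup>2)"
      by (rule sum_mono2[OF finite_tree_ball sub]) simp
    also have "\<dots> \<le> 1 / (Im z)\<^sup>2" by (rule S.green_norm_sum[OF Im_z0 xN_in])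
    finally show ?case .
  qed
qed simp

lemma psi_summable: "(\<lambda>y. (norm (psi y))\<^sup>2) summable_on UNIV"
proof (rule nonneg_bdd_above_summable_on)
  show "bdd_above (sum (\<lambda>y. (norm (psi y))\<^sup>2) ` {F. F \<subseteq> UNIV \<and> finite F})"
    by (rule bdd_aboveI[of _ "1 / (Im z)\<^sup>2"]) (auto intro: psi_finite_sum)
qed simp

text \<open>The contribution of the top vertex \<open>x\<^sub>k\<close> with
  \<open>k = n + i\<close>. It involves only the potential below that vertex, so it is the same in
  every larger volume.\<close>

definition gterm :: "nat \<Rightarrow> complex" where
  "gterm i = pathterm K b z (n + i) (canopy_pot K w (n + i)) [] (replicate i 0)"

lemma norm_gterm_le: "norm (gterm i) \<le> q ^ i / Im z"
proof -
  have "replicate i 0 \<in> tree_ball K (n + i)" using K_pos unfolding tree_ball_def by auto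
  from norm_pathterm_le[OF this] show ?thesis unfolding gterm_def by simp
qed

lemma psiN_gterm:
  assumes N: "n \<le> N"
  shows "psiN N (n, 0) = (\<Sum>i\<le>N - n. gterm i)"
proof -
  interpret G: tree_green K b z N "canopy_pot K w N" "gN N" by (rule tg)
  have "psiN N (n, 0) = (\<Sum>i\<le>N - n. pathterm K b z (n + i) (canopy_pot K w N) (drop i (xN N)) (take i (xN N)))"
    unfolding psiN_def using N by (simp add: dig_0 G.g_diag_expand[OF xN_in])
  also have "\<dots> = (\<Sum>i\<le>N - n. gterm i)"
  proof (rule sum.cong[OF refl])
    fix i assume i: "i \<in> {..N - n}"
    have "take i (xN N) = replicate i 0" "drop i (xN N) = replicate (N - (n + i)) 0"
      using i by (auto simp: min_def)
    moreover have "canopy_pot K w N (u @ replicate (N - (n + i)) 0) = canopy_pot K w (n + i) u" for u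
      by (rule canopy_pot_append_zeros) (use i N in auto)
    ultimately show "pathterm K b z (n + i) (canopy_pot K w N) (drop i (xN N)) (take i (xN N)) = gterm i"
      unfolding gterm_def pathterm_shift[symmetric, of K b z "n + i" "canopy_pot K w N" "drop i (xN N)"] by simp
  qed
  finally show ?thesis .
qed

lemma gterm_sums: "(\<lambda>i. \<Sum>j\<le>i. gterm j) \<longlonglongrightarrow> psi (n, 0)"
proof -
  have "(\<lambda>i. psiN (i + n) (n, 0)) \<longlonglongrightarrow> psi (n, 0)"
    using LIMSEQ_ignore_initial_segment[OF psiN_tendsto] .
  then show ?thesis by (simp add: psiN_gterm)
qed

lemma psi_eq_suminf: "psi (n, 0) = suminf gterm"
proof -
  have "gterm sums psi (n, 0)" using gterm_sums unfolding sums_def_le .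
  then show ?thesis by (rule sums_unique)
qed

text \<open>Everything below a canopy vertex is finite, so the elimination from the leaves in
  \<open>g_below\<close> works for any solution of the homogeneous equation.\<close>

lemma homogeneous_below:
  assumes hom: "\<And>y. (\<Sum>y'\<in>{y'. canopy_adj K y y'}. D y')
          + (complex_of_real (w y + (if fst y = 0 then b else 0)) - z) * D y = 0"
    and x: "x \<in> tree_ball K N" "x \<noteq> []"
  shows "D (N - length x, dval K x) = - \<Gamma> (N - length x) (canopy_pot K w N) x * D (N - length (tl x), dval K (tl x))"
  using x
proof (induction "N - length x" arbitrary: x)
  case 0
  then have l: "N = length x" unfolding tree_ball_def by auto
  have xc: "x = hd x # tl x" "hd x < K" using 0 unfolding tree_ball_def by (cases x; auto)+
  have "dval K x div K = dval K (tl x)" by (subst xc(1)) (use xc(2) in simp)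
  moreover have "Suc 0 = N - length (tl x)" using xc(1) l by (metis diff_add_inverse2 length_Cons plus_1_eq_Suc One_nat_def)
  ultimately have "D (N - length (tl x), dval K (tl x)) + D (0, dval K x) / \<Gamma> 0 (canopy_pot K w N) x = 0"
    using hom[of "(0, dval K x)"] l unfolding canopy_nbr_sum[OF K_pos]
    by (simp add: canopy_pot_def divide_inverse mult.commute)
  then show ?case using gam_nonzero[of 0 "canopy_pot K w N" x] l
    by (simp add: field_simps add_eq_0_iff2 del: gam.simps)
next
  case (Suc d)
  then have l: "length x < N" "N - length x = Suc d" by simp_all
  have xc: "x = hd x # tl x" "hd x < K" using Suc unfolding tree_ball_def by (cases x; auto)+
  have par: "dval K x div K = dval K (tl x)" by (subst xc(1)) (use xc(2) in simp)
  have lp: "Suc (Suc d) = N - length (tl x)" using xc(1) l by (metis Suc_diff_Suc length_Cons less_SucI Suc_diff_le diff_Suc_Suc less_or_eq_imp_le)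
  have child: "D (d, K * dval K x + c) = - \<Gamma> d (canopy_pot K w N) (c # x) * D (Suc d, dval K x)" if "c < K" for c
  proof -
    have lc: "N - length (c # x) = d" using l by simp
    have "c # x \<in> tree_ball K N" using Suc(3) l that unfolding tree_ball_def by auto
    from Suc(1)[OF _ this] lc show ?thesis by (simp add: l add.commute)
  qed
  have "(\<Sum>c<K. D (d, K * dval K x + c)) = - (\<Sum>c<K. \<Gamma> d (canopy_pot K w N) (c # x)) * D (Suc d, dval K x)"
    by (simp add: child sum_negf sum_distrib_right)
  moreover have "D (N - length (tl x), dval K (tl x)) + (\<Sum>c<K. D (d, K * dval K x + c))
      + (complex_of_real (w (Suc d, dval K x)) - z) * D (Suc d, dval K x) = 0"
    using hom[of "(Suc d, dval K x)"] unfolding canopy_nbr_sum[OF K_pos] par lp by simp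
  moreover have "1 / \<Gamma> (Suc d) (canopy_pot K w N) x
      = complex_of_real (w (Suc d, dval K x)) - z - (\<Sum>c<K. \<Gamma> d (canopy_pot K w N) (c # x))"
    using l by (simp add: canopy_pot_def)
  ultimately have "D (N - length (tl x), dval K (tl x)) + D (Suc d, dval K x) * (1 / \<Gamma> (Suc d) (canopy_pot K w N) x) = 0"
    by (simp add: algebra_simps)
  then show ?case using gam_nonzero[of "Suc d" "canopy_pot K w N" x] l
    by (simp add: field_simps add_eq_0_iff2 del: gam.simps)
qed

text \<open>The value at \<open>x\<^sub>n\<close> is the value far up the path to infinity times a
  factor that decays exponentially. Boundedness at infinity therefore forces it to vanish.\<close>

lemma homogeneous_zero:
  assumes hom: "\<And>y. (\<Sum>y'\<in>{y'. canopy_adj K y y'}. D y')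
          + (complex_of_real (w y + (if fst y = 0 then b else 0)) - z) * D y = 0"
    and bdd: "\<And>y. norm (D y) \<le> B"
  shows "D (n, 0) = 0"
proof -
  have path: "(norm (D (N - length v, dval K v)))\<^sup>2 = norm (pathprod K b z N (canopy_pot K w N) [] v) * (norm (D (N, 0)))\<^sup>2"
    if "v \<in> tree_ball K N" for v N
    using that
  proof (induction v)
    case (Cons c v)
    have v: "v \<in> tree_ball K N" using Cons.prems unfolding tree_ball_def by auto
    have "D (N - length (c # v), dval K (c # v)) = - \<Gamma> (N - length (c # v)) (canopy_pot K w N) (c # v) * D (N - length v, dval K v)"
      using homogeneous_below[OF hom Cons.prems] by simp
    then have "(norm (D (N - length (c # v), dval K (c # v))))\<^sup>2
       = (norm (\<Gamma> (N - length (c # v)) (canopy_pot K w N) (c # v)))\<^sup>2 * (norm (D (N - length v, dval K v)))\<^sup>2"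
      by (simp only: norm_mult norm_minus_cancel power_mult_distrib)
    then show ?case
      unfolding Cons.IH[OF v] by (simp add: norm_mult norm_power)
  qed simp
  have B: "0 \<le> B" using bdd norm_ge_zero order_trans by blast
  have le: "(norm (D (n, 0)))\<^sup>2 \<le> q ^ i / (Im z)\<^sup>2 * B\<^sup>2" for i
  proof -
    \<comment> \<open>One step more than \<open>i\<close>, because \<open>norm_pathprod_le\<close>
      gives away one power of \<open>q\<close>.\<close>
    let ?v = "replicate (Suc i) (0::nat)" and ?N = "n + Suc i"
    have v: "?v \<in> tree_ball K ?N" using K_pos unfolding tree_ball_def by auto
    have "(norm (D (n, 0)))\<^sup>2 = norm (pathprod K b z ?N (canopy_pot K w ?N) [] ?v) * (norm (D (?N, 0)))\<^sup>2"
      using path[OF v] dval_replicate_0[of K "Suc i"] by simp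
    also have "\<dots> \<le> q ^ (length ?v - 1) / (Im z)\<^sup>2 * B\<^sup>2"
      by (intro mult_mono norm_pathprod_le v power_mono bdd) (use q_pos in auto)
    finally show ?thesis by simp
  qed
  have "(\<lambda>i. q ^ i / (Im z)\<^sup>2 * B\<^sup>2) \<longlonglongrightarrow> 0 / (Im z)\<^sup>2 * B\<^sup>2"
    using Im_z q_pos q_less_1 by (intro tendsto_intros LIMSEQ_power_zero) auto
  then have "(norm (D (n, 0)))\<^sup>2 \<le> 0 / (Im z)\<^sup>2 * B\<^sup>2"
    by (rule LIMSEQ_le_const) (use le in blast)
  then show ?thesis by simp
qed

lemma l2_bounded:
  assumes "(\<lambda>y. (norm (\<phi> y))\<^sup>2) summable_on UNIV"
  shows "norm (\<phi> y) \<le> sqrt (infsum (\<lambda>y. (norm (\<phi> y))\<^sup>2) UNIV)"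
proof -
  have "(\<Sum>y\<in>{y}. (norm (\<phi> y))\<^sup>2) \<le> infsum (\<lambda>y. (norm (\<phi> y))\<^sup>2) UNIV"
    by (rule finite_sum_le_infsum[OF assms]) auto
  then show ?thesis by (simp add: real_le_rsqrt)
qed

lemma l2_solution_unique:
  assumes s: "(\<lambda>y. (norm (\<phi> y))\<^sup>2) summable_on UNIV" and e: "canopy_resolvent_eq K b w z (n, 0) \<phi>"
  shows "\<phi> (n, 0) = suminf gterm"
proof -
  have "\<phi> (n, 0) - psi (n, 0) = 0"
  proof (rule homogeneous_zero[of "\<lambda>y. \<phi> y - psi y"])
    fix y
    show "(\<Sum>y'\<in>{y'. canopy_adj K y y'}. \<phi> y' - psi y')
          + (complex_of_real (w y + (if fst y = 0 then b else 0)) - z) * (\<phi> y - psi y) = 0"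
      using e[unfolded canopy_resolvent_eq_def, rule_format, of y]
        psi_resolvent_eq[unfolded canopy_resolvent_eq_def, rule_format, of y]
      by (simp add: sum_subtractf algebra_simps)
    show "norm (\<phi> y - psi y) \<le> sqrt (infsum (\<lambda>y. (norm (\<phi> y))\<^sup>2) UNIV) + sqrt (infsum (\<lambda>y. (norm (psi y))\<^sup>2) UNIV)"
      using norm_triangle_ineq4[of "\<phi> y" "psi y"] l2_bounded[OF s, of y] l2_bounded[OF psi_summable, of y] by linarith
  qed
  then show ?thesis using psi_eq_suminf by simp
qed

end

section \<open>Existence and identification of the canopy spectral measures\<close>

definition canopy_green :: "nat \<Rightarrow> real \<Rightarrow> (nat \<times> nat \<Rightarrow> real) \<Rightarrow> nat \<Rightarrow> complex \<Rightarrow> complex" where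
  "canopy_green K b w n z = (\<Sum>i. pathterm K b z (n + i) (canopy_pot K w (n + i)) [] (replicate i 0))"

lemma H_tree_row_sq:
  assumes x: "x \<in> tree_ball K L"
  shows "(\<Sum>y\<in>tree_ball K L. (H_tree K b L W x y)\<^sup>2) \<le> (\<bar>W x\<bar> + \<bar>b\<bar>)\<^sup>2 + 1 + real K"
proof -
  let ?d = "W x + (if length x = L then b else 0)"
  have nadj: "\<not> tree_adj x x" unfolding tree_adj_def by auto
  \<comment> \<open>\<open>sum_H_tree\<close> is applied with the row of \<open>x\<close> itself as
    the complex-valued function.\<close>
  have "complex_of_real (\<Sum>y\<in>tree_ball K L. (H_tree K b L W x y)\<^sup>2)
      = (\<Sum>y\<in>tree_ball K L. complex_of_real (H_tree K b L W x y) * complex_of_real (H_tree K b L W x y))"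
    by (simp add: power2_eq_square)
  also have "\<dots> = complex_of_real (?d\<^sup>2 + (if x = [] then 0 else 1) + (if length x < L then real K else 0))"
  proof -
    have "H_tree K b L W x (c # x) = 1" for c unfolding H_tree_def tree_adj_def by auto
    moreover have "H_tree K b L W x (tl x) = 1" if "x \<noteq> []"
      using that unfolding H_tree_def tree_adj_def by (cases x) auto
    moreover have "H_tree K b L W x x = ?d" unfolding H_tree_def using nadj by simp
    ultimately show ?thesis
      unfolding sum_H_tree[OF x] by (simp add: power2_eq_square)
  qed
  finally have "(\<Sum>y\<in>tree_ball K L. (H_tree K b L W x y)\<^sup>2) = ?d\<^sup>2 + (if x = [] then 0 else 1) + (if length x < L then real K else 0)"
    by (simp only: of_real_eq_iff)
  moreover have "?d\<^sup>2 \<le> (\<bar>W x\<bar> + \<bar>b\<bar>)\<^sup>2"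
    by (rule power2_le_iff_abs_le[THEN iffD2]) auto
  ultimately show ?thesis by (auto split: if_splits)
qed

text \<open>Chebyshev's inequality with a common second-moment bound.\<close>

lemma tight_second_moment:
  assumes \<mu>: "\<And>n. real_distribution (\<mu> n)" and C: "\<And>n. (\<integral>E. E\<^sup>2 \<partial>\<mu> n) \<le> C"
    and i: "\<And>n. integrable (\<mu> n) (\<lambda>E. E\<^sup>2)"
  shows "tight \<mu>"
  unfolding tight_def
proof (intro conjI allI impI \<mu>)
  fix \<epsilon> :: real assume e: "\<epsilon> > 0"
  define a where "a = sqrt ((\<bar>C\<bar> + 1) / \<epsilon>)"
  have a: "a > 0" "a\<^sup>2 = (\<bar>C\<bar> + 1) / \<epsilon>" unfolding a_def using e by auto
  have "1 - \<epsilon> < measure (\<mu> n) {-a<..a}" for n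
  proof -
    interpret real_distribution "\<mu> n" by (rule \<mu>)
    have "1 - measure (\<mu> n) {-a<..a} = measure (\<mu> n) (space (\<mu> n) - {-a<..a})"
      by (subst prob_compl) auto
    also have "\<dots> = (\<integral>E. indicator (space (\<mu> n) - {-a<..a}) E \<partial>\<mu> n)" by simp
    also have "\<dots> \<le> (\<integral>E. E\<^sup>2 / a\<^sup>2 \<partial>\<mu> n)"
    proof (rule integral_mono)
      fix E
      show "indicator (space (\<mu> n) - {-a<..a}) E \<le> E\<^sup>2 / a\<^sup>2"
      proof (cases "E \<in> {-a<..a}")
        case False
        then have "a \<le> \<bar>E\<bar>" by auto
        then have "a\<^sup>2 \<le> E\<^sup>2" using a(1) power_mono[of a "\<bar>E\<bar>" 2] by simp
        then show ?thesis using a(1) False by (simp add: field_simps)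
      qed simp
    qed (auto intro!: integrable_real_indicator i simp: less_top[symmetric])
    also have "\<dots> \<le> C / a\<^sup>2" using C[of n] by (simp add: divide_right_mono)
    also have "\<dots> < \<epsilon>"
    proof -
      have "C < \<epsilon> * a\<^sup>2" unfolding a(2) using e by simp
      then show ?thesis using a(1) by (simp add: field_simps)
    qed
    finally show ?thesis by simp
  qed
  then show "\<exists>a b. a < b \<and> (\<forall>n. 1 - \<epsilon> < measure (\<mu> n) {a<..b})"
    using a(1) by (intro exI[of _ "-a"] exI[of _ a]) auto
qed

text \<open>The spectral measures at \<open>x\<^sub>n\<close> in growing finite trees are tight,
  because their second moments involve only the potential at \<open>x\<^sub>n\<close>. Their
  transforms converge to the resolvent solution, so no spectral theorem for the infinite operator is
  invoked.\<close>

lemma canopy_spec_exists: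
  assumes K: "K \<ge> 2"
  shows "\<exists>\<mu>. real_distribution \<mu> \<and> (\<forall>z. Im z > 0 \<longrightarrow> stieltjes \<mu> z = canopy_green K b w n z)"
proof -
  let ?N = "\<lambda>i. n + i"
  let ?x = "\<lambda>i. replicate i (0::nat)"
  define \<mu> where "\<mu> i = vertex_meas (tree_ball K (n + i)) (H_tree K b (n + i) (canopy_pot K w (n + i))) (?x i)" for i
  have x: "?x i \<in> tree_ball K (n + i)" for i using K unfolding tree_ball_def by auto
  have sym: "symmetric_on (tree_ball K N) (H_tree K b N W)" for N W
    by unfold_locales (rule finite_tree_ball, rule H_tree_sym)
  have pot: "canopy_pot K w (n + i) (?x i) = w (n, 0)" for i
    using canopy_pot_append_zeros[of n "n + i" K w "[]"] by (simp add: canopy_pot_def)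
  have "tight \<mu>"
  proof (rule tight_second_moment)
    show "real_distribution (\<mu> i)" for i
      unfolding \<mu>_def by (rule symmetric_on.vertex_meas_real_distribution[OF sym x])
    show "integrable (\<mu> i) (\<lambda>E. E\<^sup>2)" for i
      unfolding \<mu>_def by (rule symmetric_on.vertex_meas_second_moment(2)[OF sym x])
    show "(\<integral>E. E\<^sup>2 \<partial>\<mu> i) \<le> (\<bar>w (n, 0)\<bar> + \<bar>b\<bar>)\<^sup>2 + 1 + real K" for i
      unfolding \<mu>_def symmetric_on.vertex_meas_second_moment(1)[OF sym x]
      using H_tree_row_sq[OF x[of i], where b=b and W="canopy_pot K w (n + i)"] unfolding pot .
  qed
  then show ?thesis
  proof (rule tight_stieltjes_limit)
    fix z assume z: "Im z > 0"
    interpret canopy K b z w n by unfold_locales (use z K in auto)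
    have "stieltjes (\<mu> i) z = psiN (i + n) (n, 0)" for i
      unfolding \<mu>_def symmetric_on.vertex_meas_stieltjes[OF sym x] psiN_def
      by (simp add: dig_0 add.commute)
    then have "(\<lambda>i. stieltjes (\<mu> i) z) \<longlonglongrightarrow> psi (n, 0)"
      using LIMSEQ_ignore_initial_segment[OF psiN_tendsto[of "(n, 0)"], of n] by simp
    then show "(\<lambda>i. stieltjes (\<mu> i) z) \<longlonglongrightarrow> canopy_green K b w n z"
      unfolding psi_eq_suminf canopy_green_def gterm_def .
  qed
qed

text \<open>Uniqueness of the square summable solution fixes the transform of every candidate in the
  upper half-plane, so the definite description denotes the measure just constructed.\<close>

lemma canopy_spec_meas:
  assumes K: "K \<ge> 2"
  shows canopy_spec_meas_real_distribution: "real_distribution (canopy_spec_meas K b w (n, 0))"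
    and canopy_spec_meas_stieltjes: "Im z > 0 \<Longrightarrow> stieltjes (canopy_spec_meas K b w (n, 0)) z = canopy_green K b w n z"
proof -
  define P where "P \<mu> \<longleftrightarrow> prob_space \<mu> \<and> sets \<mu> = sets borel \<and>
        (\<forall>z. Im z \<noteq> 0 \<longrightarrow>
           (\<exists>\<psi>. (\<lambda>y. (norm (\<psi> y))\<^sup>2) summable_on UNIV \<and>
                canopy_resolvent_eq K b w z (n, 0) \<psi> \<and>
                \<psi> (n, 0) = integral\<^sup>L \<mu> (\<lambda>E. 1 / (complex_of_real E - z))))" for \<mu> :: "real measure"
  have rd: "real_distribution \<mu>" if "P \<mu>" for \<mu>
    using that unfolding P_def real_distribution_def real_distribution_axioms_def by blast
  have st: "stieltjes \<mu> z = canopy_green K b w n z" if P: "P \<mu>" and z: "Im z > 0" for \<mu> z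
  proof -
    interpret canopy K b z w n by unfold_locales (use z K in auto)
    obtain \<psi> where "(\<lambda>y. (norm (\<psi> y))\<^sup>2) summable_on UNIV" "canopy_resolvent_eq K b w z (n, 0) \<psi>"
      "\<psi> (n, 0) = stieltjes \<mu> z"
      using P Im_z0 unfolding P_def stieltjes_def by blast
    then have "stieltjes \<mu> z = suminf gterm" using l2_solution_unique[of \<psi>] by simp
    then show ?thesis unfolding canopy_green_def gterm_def .
  qed
  obtain \<mu> where \<mu>: "real_distribution \<mu>" "\<And>z. Im z > 0 \<Longrightarrow> stieltjes \<mu> z = canopy_green K b w n z"
    using canopy_spec_exists[OF K] by blast
  have "P \<mu>"
    unfolding P_def stieltjes_def[symmetric]
  proof (intro conjI allI impI)
    show "prob_space \<mu>" "sets \<mu> = sets borel"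
      using \<mu>(1) unfolding real_distribution_def real_distribution_axioms_def by auto
    fix z :: complex assume "Im z \<noteq> 0"
    then consider "Im z > 0" | "Im (cnj z) > 0" by fastforce
    then show "\<exists>\<psi>. (\<lambda>y. (norm (\<psi> y))\<^sup>2) summable_on UNIV \<and>
                canopy_resolvent_eq K b w z (n, 0) \<psi> \<and> \<psi> (n, 0) = stieltjes \<mu> z"
    proof cases
      case 1
      interpret canopy K b z w n by unfold_locales (use 1 K in auto)
      have "psi (n, 0) = stieltjes \<mu> z"
        unfolding psi_eq_suminf \<mu>(2)[OF 1] unfolding canopy_green_def gterm_def ..
      then show ?thesis
        using psi_summable psi_resolvent_eq by blast
    next
      case 2
      \<comment> \<open>The operator is real, so conjugating the solution at \<open>cnj z\<close>
        solves the equation at \<open>z\<close>.\<close>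
      interpret canopy K b "cnj z" w n by unfold_locales (use 2 K in auto)
      have "psi (n, 0) = stieltjes \<mu> (cnj z)"
        unfolding psi_eq_suminf \<mu>(2)[OF 2] unfolding canopy_green_def gterm_def ..
      then have "cnj (psi (n, 0)) = stieltjes \<mu> z"
        using real_distribution.stieltjes_cnj[OF \<mu>(1), of z] by simp
      moreover have "canopy_resolvent_eq K b w z (n, 0) (\<lambda>y. cnj (psi y))"
        unfolding canopy_resolvent_eq_def
      proof
        fix y
        show "(\<Sum>y'\<in>{y'. canopy_adj K y y'}. cnj (psi y'))
          + (complex_of_real (w y + (if fst y = 0 then b else 0)) - z) * cnj (psi y) = (if y = (n, 0) then 1 else 0)"
          using arg_cong[OF psi_resolvent_eq[unfolded canopy_resolvent_eq_def, rule_format, of y], of cnj]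
          by (auto split: if_splits)
      qed
      ultimately show ?thesis using psi_summable by (intro exI[of _ "\<lambda>y. cnj (psi y)"]) simp
    qed
  qed
  moreover have "\<nu> = \<mu>" if "P \<nu>" for \<nu>
    by (rule stieltjes_unique[OF rd[OF that] \<mu>(1)]) (simp add: st[OF that] \<mu>(2))
  ultimately have "canopy_spec_meas K b w (n, 0) = \<mu>"
    unfolding canopy_spec_meas_def P_def[symmetric] by (rule the_equality)
  then show "real_distribution (canopy_spec_meas K b w (n, 0))"
    "Im z > 0 \<Longrightarrow> stieltjes (canopy_spec_meas K b w (n, 0)) z = canopy_green K b w n z"
    using \<mu> by auto
qed

section \<open>Path terms of an i.i.d. potential\<close>

text \<open>The spectral parameter may vary with the point as well: the inversion formula needs
  measurability jointly in the potential and the energy.\<close>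

lemma gam_measurable:
  assumes Z: "Z \<in> borel_measurable N" and W: "\<And>u. u \<in> tree_ball K d \<Longrightarrow> (\<lambda>p. Wf p (u @ v)) \<in> borel_measurable N"
  shows "(\<lambda>p. gam K b (Z p) d (Wf p) v) \<in> borel_measurable N"
  using W
proof (induction d arbitrary: v)
  case 0
  from 0[of "[]"] have "(\<lambda>p. Wf p v) \<in> borel_measurable N" by simp
  with Z show ?case unfolding gam.simps by measurable
next
  case (Suc d)
  from Suc.prems[of "[]"] have [measurable]: "(\<lambda>p. Wf p v) \<in> borel_measurable N" by simp
  have "(\<lambda>p. gam K b (Z p) d (Wf p) (c # v)) \<in> borel_measurable N" if "c < K" for c
  proof (rule Suc.IH)
    fix u assume "u \<in> tree_ball K d"
    then have "u @ [c] \<in> tree_ball K (Suc d)" using that unfolding tree_ball_def by auto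
    from Suc.prems[OF this] show "(\<lambda>p. Wf p (u @ c # v)) \<in> borel_measurable N" by simp
  qed
  then have [measurable]: "(\<lambda>p. \<Sum>c<K. gam K b (Z p) d (Wf p) (c # v)) \<in> borel_measurable N"
    by (intro borel_measurable_sum) auto
  from Z show ?case unfolding gam.simps by measurable
qed

lemma pathprod_measurable:
  assumes Z: "Z \<in> borel_measurable N" and W: "\<And>u. u \<in> tree_ball K m \<Longrightarrow> (\<lambda>p. Wf p (u @ r)) \<in> borel_measurable N"
    and "v \<in> tree_ball K m"
  shows "(\<lambda>p. pathprod K b (Z p) m (Wf p) r v) \<in> borel_measurable N"
  using assms(3)
proof (induction v)
  case (Cons c v)
  have v: "v \<in> tree_ball K m" using Cons.prems unfolding tree_ball_def by auto
  note [measurable] = Cons.IH[OF v]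
  have [measurable]: "(\<lambda>p. gam K b (Z p) (m - Suc (length v)) (Wf p) (c # v @ r)) \<in> borel_measurable N"
  proof (rule gam_measurable[OF Z])
    fix u assume "u \<in> tree_ball K (m - Suc (length v))"
    then have "u @ c # v \<in> tree_ball K m" using Cons.prems unfolding tree_ball_def by auto
    from W[OF this] show "(\<lambda>p. Wf p (u @ c # v @ r)) \<in> borel_measurable N" by simp
  qed
  show ?case unfolding pathprod.simps by measurable
qed simp

lemma pathterm_measurable:
  assumes Z: "Z \<in> borel_measurable N" and W: "\<And>u. u \<in> tree_ball K m \<Longrightarrow> (\<lambda>p. Wf p (u @ r)) \<in> borel_measurable N"
    and v: "v \<in> tree_ball K m"
  shows "(\<lambda>p. pathterm K b (Z p) m (Wf p) r v) \<in> borel_measurable N"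
  unfolding pathterm_def by (intro borel_measurable_times gam_measurable[OF Z] pathprod_measurable[OF Z _ v] W)

lemma nodesum_measurable:
  assumes Z: "Z \<in> borel_measurable N" and W: "\<And>u. u \<in> tree_ball K m \<Longrightarrow> (\<lambda>p. Wf p (u @ r)) \<in> borel_measurable N"
  shows "(\<lambda>p. nodesum K b (Z p) m (Wf p) r) \<in> borel_measurable N"
  unfolding nodesum_def by (intro borel_measurable_sum pathterm_measurable[OF Z]) (use W in auto)

section \<open>Locality and invariance under tree automorphisms\<close>

lemma gam_cong:
  assumes "\<And>u. u \<in> tree_ball K d \<Longrightarrow> W (u @ v) = W' (u @ v)"
  shows "gam K b z d W v = gam K b z d W' v"
  using assms
proof (induction d arbitrary: v)
  case 0
  from 0[of "[]"] show ?case by simp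
next
  case (Suc d)
  have "gam K b z d W (c # v) = gam K b z d W' (c # v)" if "c < K" for c
  proof (rule Suc.IH)
    fix u assume "u \<in> tree_ball K d"
    then have "u @ [c] \<in> tree_ball K (Suc d)" using that unfolding tree_ball_def by auto
    from Suc.prems[OF this] show "W (u @ c # v) = W' (u @ c # v)" by simp
  qed
  then show ?case using Suc.prems[of "[]"] by simp
qed

lemma pathprod_cong:
  assumes W: "\<And>u. u \<in> tree_ball K m \<Longrightarrow> W (u @ r) = W' (u @ r)" and "v \<in> tree_ball K m"
  shows "pathprod K b z m W r v = pathprod K b z m W' r v"
  using assms(2)
proof (induction v)
  case (Cons c v)
  have v: "v \<in> tree_ball K m" using Cons.prems unfolding tree_ball_def by auto
  have "gam K b z (m - Suc (length v)) W (c # v @ r) = gam K b z (m - Suc (length v)) W' (c # v @ r)"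
  proof (rule gam_cong)
    fix u assume "u \<in> tree_ball K (m - Suc (length v))"
    then have "u @ c # v \<in> tree_ball K m" using Cons.prems unfolding tree_ball_def by auto
    from W[OF this] show "W (u @ c # v @ r) = W' (u @ c # v @ r)" by simp
  qed
  then show ?case using Cons.IH[OF v] by simp
qed simp

lemma pathterm_cong:
  assumes "\<And>u. u \<in> tree_ball K m \<Longrightarrow> W (u @ r) = W' (u @ r)" and "v \<in> tree_ball K m"
  shows "pathterm K b z m W r v = pathterm K b z m W' r v"
  unfolding pathterm_def using gam_cong[of K m W r W', OF assms(1)] pathprod_cong[of K m W r W', OF assms] by simp

lemma nodesum_cong:
  assumes "\<And>u. u \<in> tree_ball K m \<Longrightarrow> W (u @ r) = W' (u @ r)"
  shows "nodesum K b z m W r = nodesum K b z m W' r"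
  unfolding nodesum_def by (rule sum.cong[OF refl], rule pathterm_cong) (use assms in auto)

text \<open>The automorphism of the rooted tree that adds \<open>a k mod K\<close> to the letter at distance \<open>k + 1\<close> from the root.
  It moves the path of zeros to any prescribed path.\<close>
fun twist :: "nat \<Rightarrow> (nat \<Rightarrow> nat) \<Rightarrow> nat list \<Rightarrow> nat list" where
  "twist K a [] = []"
| "twist K a (c # v) = ((c + a (length v)) mod K) # twist K a v"

lemma length_twist [simp]: "length (twist K a v) = length v"
  by (induction v) auto

lemma set_twist: "K > 0 \<Longrightarrow> set (twist K a v) \<subseteq> {..<K}"
  by (induction v) auto

lemma add_mod_inj:
  assumes "c < K" "c' < K" "(c + s) mod K = (c' + s) mod (K::nat)"
  shows "c = c'"
proof -
  have "(c + s) mod K = (c' + s) mod K \<longleftrightarrow> c mod K = c' mod K"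
    by (metis (no_types, lifting) cong_add_rcancel_nat cong_def)
  then show ?thesis using assms by simp
qed

lemma twist_inj: "inj_on (twist K a) (tree_ball K m)"
proof (rule inj_onI)
  fix v v' assume "v \<in> tree_ball K m" "v' \<in> tree_ball K m" "twist K a v = twist K a v'"
  then show "v = v'"
  proof (induction v arbitrary: v')
    case Nil
    then show ?case by (cases v') auto
  next
    case (Cons c v)
    then obtain c' u where v': "v' = c' # u" by (cases v') auto
    have eq: "twist K a v = twist K a u" using Cons.prems(3) v' by simp
    then have l: "length v = length u" using length_twist by metis
    have vu: "v = u"
      using Cons.IH[OF _ _ eq] Cons.prems(1,2) v' unfolding tree_ball_def by auto
    moreover have "c = c'"
      using Cons.prems v' l by (intro add_mod_inj[of c K c' "a (length v)"]) (auto simp: tree_ball_def)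
    ultimately show ?case using v' by simp
  qed
qed

lemma sum_shift_mod:
  fixes f :: "nat \<Rightarrow> 'b::comm_monoid_add"
  assumes K: "K > 0"
  shows "(\<Sum>c<K. f ((c + s) mod K)) = (\<Sum>c<K. f c)"
proof -
  have inj: "inj_on (\<lambda>c. (c + s) mod K) {..<K}" by (rule inj_onI) (auto intro: add_mod_inj)
  have "(\<lambda>c. (c + s) mod K) ` {..<K} = {..<K}"
    by (rule endo_inj_surj[OF _ _ inj]) (use K in auto)
  then show ?thesis using sum.reindex[OF inj, of f] by (simp add: comp_def)
qed

text \<open>The automorphism only permutes the children of each vertex, and \<Gamma> depends on them
  through a sum.\<close>

lemma gam_twist:
  assumes K: "K > 0"
  shows "gam K b z d (\<lambda>u. W (twist K a u)) v = gam K b z d W (twist K a v)"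
proof (induction d arbitrary: v)
  case (Suc d)
  have "(\<Sum>c<K. gam K b z d W (twist K a (c # v))) = (\<Sum>c<K. gam K b z d W (c # twist K a v))"
    using sum_shift_mod[OF K, of "\<lambda>c. gam K b z d W (c # twist K a v)" "a (length v)"] by simp
  then show ?case using Suc by simp
qed simp

lemma pathprod_twist:
  assumes K: "K > 0"
  shows "pathprod K b z m (\<lambda>u. W (twist K a u)) [] v = pathprod K b z m W [] (twist K a v)"
proof (induction v)
  case (Cons c v)
  have "gam K b z (m - Suc (length v)) (\<lambda>u. W (twist K a u)) (c # v) = gam K b z (m - Suc (length v)) W (twist K a (c # v))"
    by (rule gam_twist[OF K])
  then show ?case using Cons by simp
qed simp

lemma pathterm_twist:
  assumes K: "K > 0"
  shows "pathterm K b z m (\<lambda>u. W (twist K a u)) [] v = pathterm K b z m W [] (twist K a v)"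
  unfolding pathterm_def pathprod_twist[OF K] gam_twist[OF K] by simp

lemma twist_replicate_0:
  assumes "set u \<subseteq> {..<K}"
  shows "twist K (\<lambda>k. rev u ! k) (replicate (length u) 0) = u"
proof -
  \<comment> \<open>The induction runs over suffixes of \<open>u\<close>, since the shifts are
    prescribed by the whole of \<open>u\<close>; \<open>rev u ! k\<close> is its letter at distance
    \<open>k + 1\<close> from the root.\<close>
  have "twist K (\<lambda>k. rev u ! k) (replicate (length v) 0) = v" if "\<exists>p. u = p @ v" for v
    using that
  proof (induction v)
    case (Cons c v)
    then obtain p where p: "u = p @ c # v" by blast
    then have "twist K (\<lambda>k. rev u ! k) (replicate (length v) 0) = v"
      by (intro Cons.IH exI[of _ "p @ [c]"]) simp
    moreover have "rev u ! length v = c" unfolding p by (simp add: nth_append)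
    moreover have "c < K" using assms p by auto
    ultimately show ?case by simp
  qed simp
  then show ?thesis by simp
qed

section \<open>Means of path terms and of node sums\<close>

locale iid_law =
  fixes K :: nat and b :: real and \<nu> :: "real measure"
  assumes K2: "K \<ge> 2" and nu: "prob_space \<nu>" and sets_nu: "sets \<nu> = sets borel"
begin

definition Q :: "nat \<Rightarrow> (nat list \<Rightarrow> real) measure" where
  "Q m = PiM (tree_ball K m) (\<lambda>_. \<nu>)"

lemma measurable_nu: "measurable N \<nu> = measurable N borel"
  by (rule measurable_cong_sets[OF refl sets_nu])

lemma prob_space_Q: "prob_space (Q m)"
  unfolding Q_def by (rule prob_space_PiM) (rule nu)

lemma prob_space_PiM_nu: "prob_space (PiM V (\<lambda>_. \<nu>))"
  by (rule prob_space_PiM) (rule nu)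

lemma component_measurable:
  assumes "i \<in> V"
  shows "(\<lambda>W. W i) \<in> borel_measurable (PiM V (\<lambda>_. \<nu>))"
  using measurable_component_singleton[OF assms, of "\<lambda>_. \<nu>"] unfolding measurable_nu .

lemma pathterm_Q_measurable:
  assumes "v \<in> tree_ball K m"
  shows "(\<lambda>W. pathterm K b z m W [] v) \<in> borel_measurable (Q m)"
  unfolding Q_def by (rule pathterm_measurable[OF _ _ assms]) (auto intro: component_measurable)

lemma nodesum_Q_measurable: "(\<lambda>W. nodesum K b z m W []) \<in> borel_measurable (Q m)"
  unfolding Q_def by (rule nodesum_measurable) (auto intro: component_measurable)

text \<open>A functional of the potential on a tree of height \<open>m\<close> has the same mean
  wherever the tree is embedded injectively. It is applied to automorphisms, to the tree below a
  canopy vertex and to the subtree of a vertex of the random tree.\<close>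

lemma reindex_integral:
  fixes F :: "(nat list \<Rightarrow> real) \<Rightarrow> complex"
  assumes f: "inj_on f (tree_ball K m)" "f \<in> tree_ball K m \<rightarrow> V"
    and F: "F \<in> borel_measurable (Q m)"
    and cong: "\<And>W W'. (\<And>u. u \<in> tree_ball K m \<Longrightarrow> W u = W' u) \<Longrightarrow> F W = F W'"
  shows "(\<integral>\<omega>. F (\<lambda>u. \<omega> (f u)) \<partial>PiM V (\<lambda>_. \<nu>)) = integral\<^sup>L (Q m) F"
proof -
  let ?t = "\<lambda>\<omega>. \<lambda>u\<in>tree_ball K m. \<omega> (f u)"
  have d: "distr (PiM V (\<lambda>_. \<nu>)) (Q m) ?t = Q m"
    unfolding Q_def by (rule distr_PiM_reindex[OF nu f])
  have t: "?t \<in> measurable (PiM V (\<lambda>_. \<nu>)) (Q m)"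
    unfolding Q_def using f(2) by (intro measurable_restrict measurable_component_singleton) auto
  have "integral\<^sup>L (Q m) F = (\<integral>\<omega>. F (?t \<omega>) \<partial>PiM V (\<lambda>_. \<nu>))"
    by (subst d[symmetric], rule integral_distr[OF t F])
  also have "\<dots> = (\<integral>\<omega>. F (\<lambda>u. \<omega> (f u)) \<partial>PiM V (\<lambda>_. \<nu>))"
    by (intro Bochner_Integration.integral_cong refl cong) simp
  finally show ?thesis by simp
qed

definition meanterm :: "complex \<Rightarrow> nat \<Rightarrow> nat \<Rightarrow> complex" where
  "meanterm z m d = (\<integral>W. pathterm K b z m W [] (replicate d 0) \<partial>Q m)"

definition meannode :: "complex \<Rightarrow> nat \<Rightarrow> complex" where
  "meannode z m = (\<integral>W. nodesum K b z m W [] \<partial>Q m)"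

lemma K_pos: "K > 0" using K2 by simp

text \<open>An automorphism carries the path of zeros to \<open>v\<close> and preserves the product
  law.\<close>

lemma mean_pathterm:
  assumes v: "v \<in> tree_ball K m"
  shows "(\<integral>W. pathterm K b z m W [] v \<partial>Q m) = meanterm z m (length v)"
proof -
  let ?a = "\<lambda>k. rev v ! k"
  have r: "replicate (length v) 0 \<in> tree_ball K m" using v K_pos unfolding tree_ball_def by auto
  have "meanterm z m (length v) = (\<integral>W. pathterm K b z m (\<lambda>u. W (twist K ?a u)) [] (replicate (length v) 0) \<partial>PiM (tree_ball K m) (\<lambda>_. \<nu>))"
    unfolding meanterm_def
  proof (rule reindex_integral[symmetric])
    show "twist K ?a \<in> tree_ball K m \<rightarrow> tree_ball K m"
      using set_twist[OF K_pos] by (auto simp: tree_ball_def)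
    show "pathterm K b z m W [] (replicate (length v) 0) = pathterm K b z m W' [] (replicate (length v) 0)"
      if "\<And>u. u \<in> tree_ball K m \<Longrightarrow> W u = W' u" for W W'
      by (rule pathterm_cong[OF _ r]) (use that in simp)
  qed (rule twist_inj pathterm_Q_measurable r)+
  also have "\<dots> = (\<integral>W. pathterm K b z m W [] v \<partial>Q m)"
    unfolding pathterm_twist[OF K_pos] Q_def[symmetric]
    using twist_replicate_0[of v K] v unfolding tree_ball_def by simp
  finally show ?thesis by simp
qed

context
  fixes z :: complex
  assumes z: "Im z > 0"
begin

interpretation upper_half K b z by unfold_locales (rule z)

lemma integrable_pathterm:
  assumes v: "v \<in> tree_ball K m"
  shows "integrable (Q m) (\<lambda>W. pathterm K b z m W [] v)"
proof -
  interpret prob_space "Q m" by (rule prob_space_Q)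
  show ?thesis
    by (rule integrable_const_bound[OF AE_I2 pathterm_Q_measurable[OF v]]) (rule norm_pathterm_le[OF v])
qed

lemma norm_meanterm_le:
  assumes "d \<le> m"
  shows "norm (meanterm z m d) \<le> q ^ d / Im z"
proof -
  interpret prob_space "Q m" by (rule prob_space_Q)
  have r: "replicate d 0 \<in> tree_ball K m" using assms K_pos unfolding tree_ball_def by auto
  have "norm (meanterm z m d) \<le> (\<integral>W. norm (pathterm K b z m W [] (replicate d 0)) \<partial>Q m)"
    unfolding meanterm_def by (rule integral_norm_bound)
  also have "\<dots> \<le> (\<integral>W. q ^ d / Im z \<partial>Q m)"
    using norm_pathterm_le[OF r] by (intro integral_mono integrable_norm integrable_pathterm r) auto
  finally show ?thesis using prob_space by simp
qed

lemma meannode_eq: "meannode z m = (\<Sum>d\<le>m. of_nat (K ^ d) * meanterm z m d)"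
proof -
  have "meannode z m = (\<Sum>v\<in>tree_ball K m. meanterm z m (length v))"
    unfolding meannode_def nodesum_def
    by (simp add: Bochner_Integration.integral_sum integrable_pathterm mean_pathterm)
  also have "\<dots> = (\<Sum>d\<le>m. \<Sum>v | v \<in> tree_ball K m \<and> length v = d. meanterm z m (length v))"
    by (rule sum.group[symmetric, OF finite_tree_ball]) (auto simp: tree_ball_def)
  also have "\<dots> = (\<Sum>d\<le>m. of_nat (K ^ d) * meanterm z m d)"
  proof (rule sum.cong[OF refl])
    fix d assume "d \<in> {..m}"
    then have "{v. v \<in> tree_ball K m \<and> length v = d} = {v. set v \<subseteq> {..<K} \<and> length v = d}"
      unfolding tree_ball_def by auto
    then have "card {v. v \<in> tree_ball K m \<and> length v = d} = K ^ d"
      by (simp add: card_lists_length_eq)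
    then show "(\<Sum>v | v \<in> tree_ball K m \<and> length v = d. meanterm z m (length v)) = of_nat (K ^ d) * meanterm z m d"
      by simp
  qed
  finally show ?thesis .
qed

lemma canopy_green_gterm_bound: "norm (pathterm K b z (n + i) (canopy_pot K w (n + i)) [] (replicate i 0)) \<le> q ^ i / Im z"
proof -
  interpret canopy K b z w n by unfold_locales (rule K2)
  show ?thesis using norm_gterm_le unfolding gterm_def .
qed

lemma inj_canopy_pos: "inj_on (\<lambda>u. (m - length u, dval K u)) (tree_ball K m)"
proof (rule inj_onI)
  fix u v assume uv: "u \<in> tree_ball K m" "v \<in> tree_ball K m" "(m - length u, dval K u) = (m - length v, dval K v)"
  then have l: "length u = length v" unfolding tree_ball_def by auto
  have "u = dig K (length u) (dval K u)" using uv(1) by (simp add: tree_ball_def dig_dval)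
  also have "\<dots> = dig K (length v) (dval K v)" using l uv(3) by simp
  also have "\<dots> = v" using uv(2) by (simp add: tree_ball_def dig_dval)
  finally show "u = v" .
qed

text \<open>The geometric bound on path terms is uniform in the potential, so series and expectation
  may be exchanged.\<close>

lemma expectation_canopy_green:
  "(\<integral>w. canopy_green K b w n z \<partial>PiM UNIV (\<lambda>_. \<nu>)) = (\<Sum>i. meanterm z (n + i) i)"
proof -
  let ?f = "\<lambda>i w. pathterm K b z (n + i) (canopy_pot K w (n + i)) [] (replicate i 0)"
  interpret prob_space "PiM UNIV (\<lambda>_. \<nu>) :: (nat \<times> nat \<Rightarrow> real) measure" by (rule prob_space_PiM_nu)
  have r: "replicate i 0 \<in> tree_ball K (n + i)" for i using K_pos unfolding tree_ball_def by auto
  have m: "?f i \<in> borel_measurable (PiM UNIV (\<lambda>_. \<nu>))" for i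
    by (rule pathterm_measurable[OF _ _ r]) (auto simp: canopy_pot_def intro: component_measurable)
  have i: "integrable (PiM UNIV (\<lambda>_. \<nu>)) (?f i)" for i
    by (rule integrable_const_bound[OF AE_I2 m]) (rule canopy_green_gterm_bound)
  have s: "summable (\<lambda>i. q ^ i / Im z)"
    using q_pos q_less_1 by (intro summable_divide summable_geometric) auto
  have "(\<integral>w. canopy_green K b w n z \<partial>PiM UNIV (\<lambda>_. \<nu>)) = (\<Sum>i. integral\<^sup>L (PiM UNIV (\<lambda>_. \<nu>)) (?f i))"
    unfolding canopy_green_def
  proof (rule integral_suminf[OF i])
    show "AE w in PiM UNIV (\<lambda>_. \<nu>). summable (\<lambda>i. norm (?f i w))"
      by (rule AE_I2, rule summable_comparison_test'[OF s]) (simp add: canopy_green_gterm_bound)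
    show "summable (\<lambda>i. \<integral>w. norm (?f i w) \<partial>PiM UNIV (\<lambda>_. \<nu>))"
    proof (rule summable_comparison_test'[OF s])
      fix j
      have "(\<integral>w. norm (?f j w) \<partial>PiM UNIV (\<lambda>_. \<nu>)) \<le> q ^ j / Im z"
        by (rule integral_le_const[OF integrable_norm[OF i] AE_I2]) (rule canopy_green_gterm_bound)
      then show "norm (\<integral>w. norm (?f j w) \<partial>PiM UNIV (\<lambda>_. \<nu>)) \<le> q ^ j / Im z" by simp
    qed
  qed
  also have "\<dots> = (\<Sum>i. meanterm z (n + i) i)"
    unfolding meanterm_def canopy_pot_def
  proof (rule suminf_cong, rule reindex_integral[OF inj_canopy_pos _ pathterm_Q_measurable[OF r]])
    fix i
    show "pathterm K b z (n + i) W [] (replicate i 0) = pathterm K b z (n + i) W' [] (replicate i 0)"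
      if "\<And>u. u \<in> tree_ball K (n + i) \<Longrightarrow> W u = W' u" for W W'
      by (rule pathterm_cong[OF _ r]) (use that in simp)
  qed simp
  finally show ?thesis .
qed

lemma norm_expectation_canopy_green: "norm (\<Sum>i. meanterm z (n + i) i) \<le> (\<Sum>i. q ^ i / Im z)"
proof (rule norm_suminf_le)
  show "norm (meanterm z (n + i) i) \<le> q ^ i / Im z" for i by (rule norm_meanterm_le) simp
  show "summable (\<lambda>i. q ^ i / Im z)"
    using q_pos q_less_1 by (intro summable_divide summable_geometric) auto
qed

text \<open>Summation over the height \<open>m\<close> of the top vertex of a path against summation over the
  height \<open>n\<close> of its bottom vertex.\<close>
lemma sum_meannode:
  "(\<lambda>M. \<Sum>m\<le>M. meannode z m / of_nat (K ^ m)) \<longlonglongrightarrow> (\<Sum>n. (\<Sum>i. meanterm z (n + i) i) / of_nat (K ^ n))"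
proof -
  let ?g = "\<lambda>n i. meanterm z (n + i) i / of_nat (K ^ n)"
  \<comment> \<open>A pair \<open>(m, d)\<close> of top height and path length becomes the pair
    \<open>(m - d, d)\<close> of bottom height and path length. The sum over \<open>n\<close> is
    written as a series in preparation for dominated convergence.\<close>
  have tri: "(\<Sum>m\<le>M. meannode z m / of_nat (K ^ m)) = (\<Sum>n. if n \<le> M then \<Sum>i\<le>M - n. ?g n i else 0)" for M
  proof -
    have "(\<Sum>m\<le>M. meannode z m / of_nat (K ^ m)) = (\<Sum>m\<le>M. \<Sum>d\<le>m. ?g (m - d) d)"
    proof (intro sum.cong refl)
      fix m
      \<comment> \<open>The number of paths of length \<open>d\<close> turns the weight of the top
        layer into that of the bottom layer.\<close>
      have ratio: "of_nat (K ^ d) / of_nat (K ^ m) = (1 / of_nat (K ^ (m - d)) :: complex)" if "d \<le> m" for d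
      proof -
        have "K ^ m = K ^ d * K ^ (m - d)" using that by (simp add: power_add[symmetric])
        then show ?thesis using K_pos by (simp add: of_nat_mult)
      qed
      then show "meannode z m / of_nat (K ^ m) = (\<Sum>d\<le>m. ?g (m - d) d)"
        unfolding meannode_eq sum_divide_distrib
      proof (intro sum.cong refl)
        fix d assume "d \<in> {..m}"
        then have d: "d \<le> m" by simp
        have "of_nat (K ^ d) * meanterm z m d / of_nat (K ^ m) = meanterm z m d * (of_nat (K ^ d) / of_nat (K ^ m))"
          by simp
        then show "of_nat (K ^ d) * meanterm z m d / of_nat (K ^ m) = ?g (m - d) d"
          unfolding ratio[OF d] using d by simp
      qed
    qed
    also have "\<dots> = (\<Sum>(m, d)\<in>Sigma {..M} (\<lambda>m. {..m}). ?g (m - d) d)"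
      by (rule sum.Sigma) auto
    also have "\<dots> = (\<Sum>(n, i)\<in>Sigma {..M} (\<lambda>n. {..M - n}). ?g n i)"
      by (rule sum.reindex_bij_witness[where i="\<lambda>(n, i). (n + i, i)" and j="\<lambda>(m, d). (m - d, d)"]) auto
    also have "\<dots> = (\<Sum>n\<le>M. \<Sum>i\<le>M - n. ?g n i)"
      by (rule sum.Sigma[symmetric]) auto
    also have "\<dots> = (\<Sum>n\<le>M. if n \<le> M then \<Sum>i\<le>M - n. ?g n i else 0)" by simp
    also have "\<dots> = (\<Sum>n. if n \<le> M then \<Sum>i\<le>M - n. ?g n i else 0)"
      by (rule suminf_finite[symmetric]) auto
    finally show ?thesis .
  qed
  have s: "summable (\<lambda>i. q ^ i / Im z)"
    using q_pos q_less_1 by (intro summable_divide summable_geometric) auto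
  have sg: "summable (\<lambda>i. meanterm z (n + i) i)" for n
    by (rule summable_comparison_test'[OF s]) (rule norm_meanterm_le, simp)
  define C where "C = (\<Sum>i. q ^ i / Im z)"
  have part: "norm (\<Sum>i\<le>j. ?g n i) \<le> C / real (K ^ n)" for n j
  proof -
    have "norm (\<Sum>i\<le>j. meanterm z (n + i) i) \<le> (\<Sum>i\<le>j. q ^ i / Im z)"
      by (rule sum_norm_le) (rule norm_meanterm_le, simp)
    also have "\<dots> \<le> C"
      unfolding C_def by (rule sum_le_suminf[OF s]) (use q_pos z in auto)
    finally have "norm (\<Sum>i\<le>j. meanterm z (n + i) i) / real (K ^ n) \<le> C / real (K ^ n)"
      by (rule divide_right_mono) simp
    then show ?thesis unfolding sum_divide_distrib[symmetric] by (simp add: norm_divide norm_power)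
  qed
  have C0: "0 \<le> C" unfolding C_def by (rule suminf_nonneg[OF s]) (use q_pos z in auto)
  have "(\<lambda>M. \<Sum>n. if n \<le> M then \<Sum>i\<le>M - n. ?g n i else 0) \<longlonglongrightarrow> (\<Sum>n. (\<Sum>i. meanterm z (n + i) i) / of_nat (K ^ n))"
  proof (rule tannerys_theorem[where M="\<lambda>n. C / real (K ^ n)", THEN conjunct2, THEN conjunct2])
    fix n
    have "(\<lambda>j. \<Sum>i\<le>j. ?g n i) \<longlonglongrightarrow> (\<Sum>i. meanterm z (n + i) i) / of_nat (K ^ n)"
      unfolding sum_divide_distrib[symmetric]
      using summable_LIMSEQ'[OF sg[of n]] K_pos by (intro tendsto_divide tendsto_const) auto
    then have "(\<lambda>M. \<Sum>i\<le>M - n. ?g n i) \<longlonglongrightarrow> (\<Sum>i. meanterm z (n + i) i) / of_nat (K ^ n)"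
      using LIMSEQ_offset[of "\<lambda>M. \<Sum>i\<le>M - n. ?g n i" n] by simp
    moreover have "eventually (\<lambda>M. (\<Sum>i\<le>M - n. ?g n i) = (if n \<le> M then \<Sum>i\<le>M - n. ?g n i else 0)) sequentially"
      by (rule eventually_sequentiallyI[of n]) simp
    ultimately show "(\<lambda>M. if n \<le> M then \<Sum>i\<le>M - n. ?g n i else 0) \<longlonglongrightarrow> (\<Sum>i. meanterm z (n + i) i) / of_nat (K ^ n)"
      by (rule Lim_transform_eventually)
  next
    have "norm (if n \<le> M then \<Sum>i\<le>M - n. ?g n i else 0) \<le> C / real (K ^ n)" for n M
      using part[of n "M - n"] C0 by simp
    then show "eventually (\<lambda>(n, M). norm (if n \<le> M then \<Sum>i\<le>M - n. ?g n i else 0) \<le> C / real (K ^ n)) (at_top \<times>\<^sub>F sequentially)"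
      by (intro always_eventually) auto
    have "summable (\<lambda>n. C * (1 / real K) ^ n)"
      using K2 by (intro summable_mult summable_geometric) simp
    then show "summable (\<lambda>n. C / real (K ^ n))" by (simp add: power_divide)
  qed simp
  then show ?thesis unfolding tri .
qed

end

end

section \<open>The canopy density of states\<close>

context iid_law
begin

abbreviation "CS \<equiv> (PiM UNIV (\<lambda>_. \<nu>) :: (nat \<times> nat \<Rightarrow> real) measure)"

lemma canopy_green_measurable:
  assumes Z: "Z \<in> borel_measurable N" and Wf: "\<And>y. (\<lambda>p. Wf p y) \<in> borel_measurable N"
  shows "(\<lambda>p. canopy_green K b (Wf p) n (Z p)) \<in> borel_measurable N"
  unfolding canopy_green_def
proof (rule borel_measurable_suminf)
  fix i
  show "(\<lambda>p. pathterm K b (Z p) (n + i) (canopy_pot K (Wf p) (n + i)) [] (replicate i 0)) \<in> borel_measurable N"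
  proof (rule pathterm_measurable[OF Z])
    show "replicate i 0 \<in> tree_ball K (n + i)" using K_pos unfolding tree_ball_def by auto
    show "(\<lambda>p. canopy_pot K (Wf p) (n + i) (u @ [])) \<in> borel_measurable N" for u
      unfolding canopy_pot_def by (rule Wf)
  qed
qed

text \<open>The spectral measure comes from a definite description; the inversion formula exhibits
  its distribution function as a limit of integrals of jointly measurable functions.\<close>

lemma cdf_canopy_spec_meas_measurable:
  "(\<lambda>w. cdf (canopy_spec_meas K b w (n, 0)) c) \<in> borel_measurable CS"
proof (rule borel_measurable_LIMSEQ_real)
  let ?J = "\<lambda>k w. enn2real (\<integral>\<^sup>+x\<in>{- real (Suc k)..c + 1 / real (Suc k)}.
        ennreal (Im (canopy_green K b w n (Complex x (1 / (real (Suc k))\<^sup>2)))) \<partial>lborel) / pi"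
  fix w :: "nat \<times> nat \<Rightarrow> real"
  show "(\<lambda>k. ?J k w) \<longlonglongrightarrow> cdf (canopy_spec_meas K b w (n, 0)) c"
    using real_distribution.stieltjes_inversion[OF canopy_spec_meas_real_distribution[OF K2, of b w n], of c]
    by (simp add: canopy_spec_meas_stieltjes[OF K2])
next
  fix k
  have [measurable]: "(\<lambda>p. canopy_green K b (fst p) n (Complex (snd p) (1 / (real (Suc k))\<^sup>2))) \<in> borel_measurable (CS \<Otimes>\<^sub>M lborel)"
  proof (rule canopy_green_measurable)
    show "(\<lambda>p. fst p y) \<in> borel_measurable (CS \<Otimes>\<^sub>M lborel)" for y
      by (rule measurable_compose[OF measurable_fst component_measurable]) simp
    have "(\<lambda>p. complex_of_real (snd p) + \<i> * complex_of_real (1 / (real (Suc k))\<^sup>2)) \<in> borel_measurable (CS \<Otimes>\<^sub>M lborel)"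
      by measurable
    then show "(\<lambda>p. Complex (snd p) (1 / (real (Suc k))\<^sup>2)) \<in> borel_measurable (CS \<Otimes>\<^sub>M lborel)"
      unfolding Complex_eq .
  qed
  have "(\<lambda>w. \<integral>\<^sup>+x. ennreal (Im (canopy_green K b w n (Complex x (1 / (real (Suc k))\<^sup>2))))
      * indicator {- real (Suc k)..c + 1 / real (Suc k)} x \<partial>lborel) \<in> borel_measurable CS"
  proof (rule lborel.borel_measurable_nn_integral)
    show "(\<lambda>(w, x). ennreal (Im (canopy_green K b w n (Complex x (1 / (real (Suc k))\<^sup>2))))
      * indicator {- real (Suc k)..c + 1 / real (Suc k)} x) \<in> borel_measurable (CS \<Otimes>\<^sub>M lborel)"
      unfolding case_prod_beta by measurable
  qed
  then show "(\<lambda>w. enn2real (\<integral>\<^sup>+x\<in>{- real (Suc k)..c + 1 / real (Suc k)}.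
        ennreal (Im (canopy_green K b w n (Complex x (1 / (real (Suc k))\<^sup>2)))) \<partial>lborel) / pi) \<in> borel_measurable CS"
    by measurable
qed

lemma canopy_spec_meas_measurable:
  "(\<lambda>w. canopy_spec_meas K b w (n, 0)) \<in> measurable CS (prob_algebra borel)"
proof (rule measurable_prob_algebra_generated)
  show "sets borel = sigma_sets UNIV (range (\<lambda>a::real. {..a}))"
    by (simp add: borel_eq_atMost sets_measure_of)
  show "Int_stable (range (\<lambda>a::real. {..a}))"
    by (auto simp: Int_stable_def)
  show "range (\<lambda>a::real. {..a}) \<subseteq> Pow UNIV" by simp
  fix w
  interpret real_distribution "canopy_spec_meas K b w (n, 0)" by (rule canopy_spec_meas_real_distribution[OF K2])
  show "prob_space (canopy_spec_meas K b w (n, 0))" by unfold_locales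
  show "sets (canopy_spec_meas K b w (n, 0)) = sets borel" by simp
next
  fix A assume "A \<in> range (\<lambda>a::real. {..a})"
  then obtain a where A: "A = {..a}" by auto
  have "emeasure (canopy_spec_meas K b w (n, 0)) A = ennreal (cdf (canopy_spec_meas K b w (n, 0)) a)" for w
  proof -
    interpret real_distribution "canopy_spec_meas K b w (n, 0)" by (rule canopy_spec_meas_real_distribution[OF K2])
    show ?thesis unfolding A cdf_def by (rule emeasure_eq_measure)
  qed
  then show "(\<lambda>w. emeasure (canopy_spec_meas K b w (n, 0)) A) \<in> borel_measurable CS"
    using cdf_canopy_spec_meas_measurable by simp
qed

definition layer_meas :: "nat \<Rightarrow> real measure" where
  "layer_meas n = CS \<bind> (\<lambda>w. canopy_spec_meas K b w (n, 0))"

text \<open>The layer weights of the canopy density of states form a geometric law, so that measure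
  is a mixture of probability measures.\<close>

definition layer_weight :: "nat pmf" where
  "layer_weight = geometric_pmf ((real K - 1) / real K)"

lemma pmf_layer_weight: "pmf layer_weight n = (real K - 1) / real K * (1 / real K ^ n)"
proof -
  have p: "0 < (real K - 1) / real K" "(real K - 1) / real K \<le> 1" using K2 by auto
  have "1 - (real K - 1) / real K = 1 / real K" using K2 by (simp add: field_simps)
  then show ?thesis unfolding layer_weight_def by (subst pmf_geometric[OF p]) (simp add: power_divide)
qed

lemma CS_in_prob_algebra: "CS \<in> space (prob_algebra CS)"
  by (simp add: space_prob_algebra prob_space_PiM_nu)

lemma layer_meas_prob: "layer_meas n \<in> space (prob_algebra borel)"
  using prob_space_bind'[OF CS_in_prob_algebra canopy_spec_meas_measurable]
    sets_bind'[OF CS_in_prob_algebra canopy_spec_meas_measurable]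
  unfolding layer_meas_def space_prob_algebra by simp

lemma layer_meas_measurable: "layer_meas \<in> measurable (measure_pmf layer_weight) (prob_algebra borel)"
  by (rule measurableI) (auto intro: layer_meas_prob)

definition dos :: "real measure" where
  "dos = measure_pmf layer_weight \<bind> layer_meas"

lemma pmf_in_prob_algebra: "measure_pmf p \<in> space (prob_algebra (measure_pmf p))"
  by (simp add: space_prob_algebra measure_pmf.prob_space_axioms)

lemma dos_real_distribution: "real_distribution dos"
proof -
  have "prob_space dos" "sets dos = sets borel"
    unfolding dos_def using prob_space_bind'[OF pmf_in_prob_algebra layer_meas_measurable]
      sets_bind'[OF pmf_in_prob_algebra layer_meas_measurable] by auto
  then show ?thesis unfolding real_distribution_def real_distribution_axioms_def by simp
qed

lemma emeasure_dos:
  assumes I: "I \<in> sets borel"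
  shows "emeasure dos I = ennreal ((real K - 1) / real K) *
        (\<Sum>n. ennreal (1 / real K ^ n) * (\<integral>\<^sup>+ w. emeasure (canopy_spec_meas K b w (n, 0)) I \<partial>CS))"
proof -
  interpret prob_space CS by (rule prob_space_PiM_nu)
  have layer: "emeasure (layer_meas n) I = (\<integral>\<^sup>+ w. emeasure (canopy_spec_meas K b w (n, 0)) I \<partial>CS)" for n
    unfolding layer_meas_def
    by (rule emeasure_bind[OF not_empty measurable_prob_algebraD[OF canopy_spec_meas_measurable] I])
  have weight: "ennreal (pmf layer_weight n) = ennreal ((real K - 1) / real K) * ennreal (1 / real K ^ n)" for n
    unfolding pmf_layer_weight using K2 by (intro ennreal_mult) auto
  have "emeasure dos I = (\<integral>\<^sup>+n. emeasure (layer_meas n) I \<partial>measure_pmf layer_weight)"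
    unfolding dos_def by (rule emeasure_bind[OF _ measurable_prob_algebraD[OF layer_meas_measurable] I]) simp
  also have "\<dots> = (\<Sum>n. ennreal (pmf layer_weight n) * emeasure (layer_meas n) I)"
    unfolding nn_integral_measure_pmf by (rule nn_integral_count_space_nat)
  finally show ?thesis unfolding layer weight by (simp add: mult.assoc ennreal_suminf_cmult)
qed

text \<open>Reduction to the real and imaginary parts; the bound on \<open>f\<close> supplies
  integrability at both stages.\<close>

lemma integral_bind_complex:
  fixes f :: "real \<Rightarrow> complex"
  assumes M: "prob_space M" and N: "N \<in> measurable M (prob_algebra borel)"
    and f: "f \<in> borel_measurable borel" and B: "\<And>x. norm (f x) \<le> B"
  shows "integral\<^sup>L (M \<bind> N) f = (\<integral>x. integral\<^sup>L (N x) f \<partial>M)"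
proof -
  interpret prob_space M by (rule M)
  have Np: "prob_space (N x)" "sets (N x) = sets borel" if "x \<in> space M" for x
    using measurable_space[OF N that] by (auto simp: space_prob_algebra)
  have ae: "AE x in M. emeasure (N x) (space (N x)) \<le> ennreal 1"
    by (rule AE_I2) (simp add: prob_space.emeasure_space_1[OF Np(1)])
  have real: "integral\<^sup>L (M \<bind> N) g = (\<integral>x. integral\<^sup>L (N x) g \<partial>M)"
    if g: "g \<in> borel_measurable borel" "\<And>x. \<bar>g x\<bar> \<le> B" for g :: "real \<Rightarrow> real"
    by (rule integral_bind[OF g(1) g(2) measurable_prob_algebraD[OF N] finite_measure_axioms ae])
  have re: "(\<lambda>x. Re (f x)) \<in> borel_measurable borel" "\<And>x. \<bar>Re (f x)\<bar> \<le> B"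
    using f B abs_Re_le_cmod order_trans by (auto, blast)
  have im: "(\<lambda>x. Im (f x)) \<in> borel_measurable borel" "\<And>x. \<bar>Im (f x)\<bar> \<le> B"
    using f B abs_Im_le_cmod order_trans by (auto, blast)
  have itf: "integrable (N x) f" "norm (integral\<^sup>L (N x) f) \<le> B" if x: "x \<in> space M" for x
  proof -
    interpret N: prob_space "N x" by (rule Np[OF x])
    have "f \<in> borel_measurable (N x)" using f measurable_cong_sets[OF Np(2)[OF x] refl] by blast
    then show i: "integrable (N x) f"
      by (intro N.integrable_const_bound[where B=B]) (auto simp: B)
    have "norm (integral\<^sup>L (N x) f) \<le> (\<integral>y. norm (f y) \<partial>N x)" by (rule integral_norm_bound)
    also have "\<dots> \<le> B" by (rule N.integral_le_const[OF integrable_norm[OF i]]) (simp add: B)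
    finally show "norm (integral\<^sup>L (N x) f) \<le> B" .
  qed
  have ReN: "Re (integral\<^sup>L (N x) f) = (\<integral>y. Re (f y) \<partial>N x)" and ImN: "Im (integral\<^sup>L (N x) f) = (\<integral>y. Im (f y) \<partial>N x)"
    if "x \<in> space M" for x
    using itf(1)[OF that] by simp_all
  have m: "(\<lambda>x. integral\<^sup>L (N x) f) \<in> borel_measurable M"
    by (rule measurable_compose[OF measurable_prob_algebraD[OF N] integral_measurable_subprob_algebra[OF f]])
  have iM: "integrable M (\<lambda>x. integral\<^sup>L (N x) f)"
    by (rule integrable_const_bound[OF AE_I2 m]) (rule itf(2))
  have bs: "prob_space (M \<bind> N)" "sets (M \<bind> N) = sets borel"
    using prob_space_bind'[of M M N borel] sets_bind'[of M M N borel] N M by (auto simp: space_prob_algebra)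
  interpret B: prob_space "M \<bind> N" by (rule bs)
  have "f \<in> borel_measurable (M \<bind> N)" using f measurable_cong_sets[OF bs(2) refl] by blast
  then have iB: "integrable (M \<bind> N) f" by (intro B.integrable_const_bound[where B=B]) (auto simp: B)
  show ?thesis
  proof (rule complex_eqI)
    have "Re (integral\<^sup>L (M \<bind> N) f) = (\<integral>x. \<integral>y. Re (f y) \<partial>N x \<partial>M)"
      using iB real[OF re] by simp
    also have "\<dots> = (\<integral>x. Re (integral\<^sup>L (N x) f) \<partial>M)"
      by (rule Bochner_Integration.integral_cong) (simp_all add: ReN)
    finally show "Re (integral\<^sup>L (M \<bind> N) f) = Re (\<integral>x. integral\<^sup>L (N x) f \<partial>M)" using iM by simp
    have "Im (integral\<^sup>L (M \<bind> N) f) = (\<integral>x. \<integral>y. Im (f y) \<partial>N x \<partial>M)"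
      using iB real[OF im] by simp
    also have "\<dots> = (\<integral>x. Im (integral\<^sup>L (N x) f) \<partial>M)"
      by (rule Bochner_Integration.integral_cong) (simp_all add: ImN)
    finally show "Im (integral\<^sup>L (M \<bind> N) f) = Im (\<integral>x. integral\<^sup>L (N x) f \<partial>M)" using iM by simp
  qed
qed

text \<open>The transform passes through both mixtures, over the potential and over the layers,
  because its kernel is bounded.\<close>

lemma stieltjes_dos:
  assumes z: "Im z > 0"
  shows "stieltjes dos z = of_real ((real K - 1) / real K) * (\<Sum>n. (\<Sum>i. meanterm z (n + i) i) / of_nat (K ^ n))"
proof -
  interpret upper_half K b z by unfold_locales (rule z)
  have z0: "Im z \<noteq> 0" using z by simp
  have B: "norm (1 / (complex_of_real x - z)) \<le> 1 / \<bar>Im z\<bar>" for x by (rule norm_cauchy_kernel_le[OF z0])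
  let ?e = "\<lambda>n. \<Sum>i. meanterm z (n + i) i"
  have layer: "stieltjes (layer_meas n) z = ?e n" for n
  proof -
    have "stieltjes (layer_meas n) z = (\<integral>w. stieltjes (canopy_spec_meas K b w (n, 0)) z \<partial>CS)"
      unfolding stieltjes_def layer_meas_def
      by (rule integral_bind_complex[OF prob_space_PiM_nu canopy_spec_meas_measurable _ B]) measurable
    also have "\<dots> = (\<integral>w. canopy_green K b w n z \<partial>CS)"
      by (simp add: canopy_spec_meas_stieltjes[OF K2 z])
    finally show ?thesis unfolding expectation_canopy_green[OF z] .
  qed
  have s: "summable (\<lambda>n. norm (pmf layer_weight n *\<^sub>R ?e n))"
  proof (rule summable_comparison_test')
    show "summable (\<lambda>n. (real K - 1) / real K * ((1 / real K) ^ n * (\<Sum>i. q ^ i / Im z)))"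
      using K2 by (intro summable_mult summable_mult2 summable_geometric) simp
    fix n
    have "(real K - 1) / real K * (1 / real K) ^ n * norm (?e n) \<le> (real K - 1) / real K * (1 / real K) ^ n * (\<Sum>i. q ^ i / Im z)"
      using K2 by (intro mult_left_mono norm_expectation_canopy_green[OF z]) auto
    then show "norm (norm (pmf layer_weight n *\<^sub>R ?e n)) \<le> (real K - 1) / real K * ((1 / real K) ^ n * (\<Sum>i. q ^ i / Im z))"
      using K2 by (simp add: pmf_layer_weight power_divide)
  qed
  have "stieltjes dos z = (\<integral>n. stieltjes (layer_meas n) z \<partial>measure_pmf layer_weight)"
    unfolding stieltjes_def dos_def
    by (rule integral_bind_complex[OF measure_pmf.prob_space_axioms layer_meas_measurable _ B]) measurable
  also have "\<dots> = (\<integral>n. pmf layer_weight n *\<^sub>R ?e n \<partial>count_space UNIV)"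
    unfolding layer measure_pmf_eq_density by (rule integral_density) auto
  also have "\<dots> = (\<Sum>n. pmf layer_weight n *\<^sub>R ?e n)"
    by (rule integral_count_space_nat) (use s in \<open>simp add: integrable_count_space_nat_iff\<close>)
  also have "\<dots> = (\<Sum>n. of_real ((real K - 1) / real K) * (?e n / of_nat (K ^ n)))"
    by (rule suminf_cong) (simp add: pmf_layer_weight scaleR_conv_of_real)
  also have "\<dots> = of_real ((real K - 1) / real K) * (\<Sum>n. ?e n / of_nat (K ^ n))"
  proof (rule suminf_mult)
    have "norm (?e n / of_nat (K ^ n)) = norm (pmf layer_weight n *\<^sub>R ?e n) * (real K / (real K - 1))" for n
      using K2 by (simp add: pmf_layer_weight norm_divide norm_power)
    then have "summable (\<lambda>n. norm (?e n / of_nat (K ^ n)))"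
      using summable_mult2[OF s, of "real K / (real K - 1)"] by (simp only:)
    then show "summable (\<lambda>n. ?e n / of_nat (K ^ n))" by (rule summable_norm_cancel)
  qed
  finally show ?thesis .
qed

end

text \<open>The defining set function agrees on Borel sets with the mixture \<open>dos\<close>;
  being that of a measure, it is returned unchanged by \<open>measure_of\<close>.\<close>

lemma canopy_dos_eq:
  assumes "iid_law K (density lborel (\<lambda>t. ennreal (\<rho> t)))"
  shows "canopy_dos K b \<rho> = iid_law.dos K b (density lborel (\<lambda>t. ennreal (\<rho> t)))"
proof -
  interpret iid_law K b "density lborel (\<lambda>t. ennreal (\<rho> t))" by (rule assms)
  have s: "sets dos = sets borel" "space dos = UNIV"
    using dos_real_distribution unfolding real_distribution_def real_distribution_axioms_def
    by (auto dest: sets_eq_imp_space_eq)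
  have "canopy_dos K b \<rho> = measure_of UNIV (sets borel) (emeasure dos)"
    unfolding canopy_dos_def
  proof (rule measure_of_eq)
    fix I :: "real set" assume "I \<in> sigma_sets UNIV (sets borel)"
    then have "I \<in> sets borel" using sets.sigma_sets_eq[of "borel :: real measure"] by simp
    then show "ennreal ((real K - 1) / real K) *
        (\<Sum>n. ennreal (1 / real K ^ n) *
           (\<integral>\<^sup>+ w. emeasure (canopy_spec_meas K b w (n, 0)) I \<partial>canopy_space \<rho>)) = emeasure dos I"
      unfolding canopy_space_def by (rule emeasure_dos[symmetric])
  qed simp
  also have "\<dots> = dos" using measure_of_of_measure[of dos] unfolding s .
  finally show ?thesis .
qed

section \<open>Convergence of the eigenvalue distributions\<close>

text \<open>Only the diagonal terms contribute to the variance, which is therefore of order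
  \<open>1 / card (R j)\<close>. Summability over \<open>j\<close> makes the series of squared
  deviations almost surely finite, so its terms tend to zero.\<close>

lemma (in prob_space) uncorrelated_averages_converge:
  fixes X :: "nat \<Rightarrow> 'i \<Rightarrow> 'a \<Rightarrow> real"
  assumes fin: "\<And>j. finite (R j)" and ne: "\<And>j. R j \<noteq> {}"
    and meas: "\<And>j r. r \<in> R j \<Longrightarrow> X j r \<in> borel_measurable M"
    and bd: "\<And>j r s. r \<in> R j \<Longrightarrow> \<bar>X j r s\<bar> \<le> C"
    and mean: "\<And>j r. r \<in> R j \<Longrightarrow> expectation (X j r) = t"
    and unc: "\<And>j r r'. r \<in> R j \<Longrightarrow> r' \<in> R j \<Longrightarrow> r \<noteq> r' \<Longrightarrow> expectation (\<lambda>s. X j r s * X j r' s) = t * t"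
    and summ: "summable (\<lambda>j. 1 / real (card (R j)))"
  shows "AE s in M. (\<lambda>j. (\<Sum>r\<in>R j. X j r s) / real (card (R j))) \<longlonglongrightarrow> t"
proof -
  define n where "n j = real (card (R j))" for j
  have n: "n j > 0" for j unfolding n_def using fin ne by (simp add: card_gt_0_iff)
  define A where "A j s = ((\<Sum>r\<in>R j. X j r s - t) / n j)\<^sup>2" for j s
  have int: "integrable M (X j r)" if "r \<in> R j" for j r
    by (rule integrable_const_bound[where B=C, OF AE_I2 meas[OF that]]) (simp add: bd that)
  have tC: "\<bar>t\<bar> \<le> C"
  proof -
    obtain r where r: "r \<in> R 0" using ne by blast
    have "\<bar>expectation (X 0 r)\<bar> \<le> expectation (\<lambda>s. \<bar>X 0 r s\<bar>)" by (rule integral_abs_bound)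
    also have "\<dots> \<le> C" by (rule integral_le_const[OF integrable_abs[OF int[OF r]] AE_I2]) (rule bd[OF r])
    finally show ?thesis unfolding mean[OF r] .
  qed
  have Yb: "\<bar>(X j r s - t) * (X j r' s - t)\<bar> \<le> 2 * C * (2 * C)" if "r \<in> R j" "r' \<in> R j" for j r r' s
    unfolding abs_mult using bd[OF that(1), of s] bd[OF that(2), of s] tC by (intro mult_mono) linarith+
  have Ym: "(\<lambda>s. (X j r s - t) * (X j r' s - t)) \<in> borel_measurable M" if "r \<in> R j" "r' \<in> R j" for j r r'
    using meas[OF that(1)] meas[OF that(2)] by measurable
  have Yi: "integrable M (\<lambda>s. (X j r s - t) * (X j r' s - t))" if "r \<in> R j" "r' \<in> R j" for j r r'
    by (rule integrable_const_bound[where B="2 * C * (2 * C)", OF AE_I2 Ym[OF that]]) (simp only: real_norm_def Yb that)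
  have cov: "expectation (\<lambda>s. (X j r s - t) * (X j r' s - t)) \<le> (if r' = r then 2 * C * (2 * C) else 0)"
    if rr: "r \<in> R j" "r' \<in> R j" for j r r'
  proof (cases "r' = r")
    case True
    have "expectation (\<lambda>s. (X j r s - t) * (X j r' s - t)) \<le> 2 * C * (2 * C)"
      by (rule integral_le_const[OF Yi[OF rr] AE_I2]) (use Yb[OF rr] in \<open>simp add: abs_le_iff\<close>)
    then show ?thesis using True by simp
  next
    case False
    have XX: "integrable M (\<lambda>s. X j r s * X j r' s)"
    proof (rule integrable_const_bound[where B="C * C", OF AE_I2])
      show "norm (X j r s * X j r' s) \<le> C * C" for s
        using bd[OF rr(1), of s] bd[OF rr(2), of s] by (simp add: abs_mult) (intro mult_mono; linarith)
      show "(\<lambda>s. X j r s * X j r' s) \<in> borel_measurable M" using meas rr by measurable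
    qed
    have "expectation (\<lambda>s. (X j r s - t) * (X j r' s - t))
      = expectation (\<lambda>s. X j r s * X j r' s - t * X j r s - t * X j r' s + t * t)"
      by (rule Bochner_Integration.integral_cong) (auto simp: algebra_simps)
    also have "\<dots> = 0"
      using XX int[OF rr(1)] int[OF rr(2)] False
      by (simp add: unc[OF rr] mean rr prob_space)
    finally show ?thesis using False by simp
  qed
  have Aeq: "A j s = (\<Sum>r\<in>R j. \<Sum>r'\<in>R j. (X j r s - t) * (X j r' s - t)) / (n j)\<^sup>2" for j s
    unfolding A_def power_divide by (simp add: power2_eq_square sum_product)
  have Ai: "integrable M (A j)" for j
    unfolding Aeq[abs_def] using Yi by (intro integrable_divide Bochner_Integration.integrable_sum) auto
  have EA: "expectation (A j) \<le> 2 * C * (2 * C) / n j" for j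
  proof -
    have "expectation (A j) = (\<Sum>r\<in>R j. \<Sum>r'\<in>R j. expectation (\<lambda>s. (X j r s - t) * (X j r' s - t))) / (n j)\<^sup>2"
      unfolding Aeq using Yi by (simp add: Bochner_Integration.integral_sum Bochner_Integration.integrable_sum)
    also have "\<dots> \<le> (\<Sum>r\<in>R j. \<Sum>r'\<in>R j. if r' = r then 2 * C * (2 * C) else 0) / (n j)\<^sup>2"
      by (intro divide_right_mono sum_mono cov) auto
    also have "\<dots> = 2 * C * (2 * C) / n j"
      using fin n[of j] by (simp add: n_def power2_eq_square)
    finally show ?thesis .
  qed
  have "(\<integral>\<^sup>+s. (\<Sum>j. ennreal (A j s)) \<partial>M) = (\<Sum>j. \<integral>\<^sup>+s. ennreal (A j s) \<partial>M)"
    using Ai by (intro nn_integral_suminf) auto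
  also have "\<dots> = (\<Sum>j. ennreal (expectation (A j)))"
    by (intro suminf_cong nn_integral_eq_integral Ai) (simp add: A_def)
  also have "\<dots> \<noteq> \<infinity>"
  proof -
    have nonneg: "0 \<le> expectation (A j)" for j by (rule integral_nonneg_AE) (auto simp: A_def)
    have "summable (\<lambda>j. expectation (A j))"
    proof (rule summable_comparison_test')
      show "summable (\<lambda>j. 2 * C * (2 * C) * (1 / real (card (R j))))" using summ by (rule summable_mult)
      show "norm (expectation (A j)) \<le> 2 * C * (2 * C) * (1 / real (card (R j)))" for j
        using EA[of j] nonneg[of j] by (simp add: n_def)
    qed
    then show ?thesis using ennreal_suminf_neq_top nonneg by auto
  qed
  finally have "AE s in M. (\<Sum>j. ennreal (A j s)) \<noteq> \<infinity>"
    using Ai by (intro nn_integral_PInf_AE) auto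
  then show ?thesis
  proof eventually_elim
    case (elim s)
    have "summable (\<lambda>j. A j s)"
      by (rule summable_suminf_not_top) (use elim in \<open>auto simp: A_def\<close>)
    then have "(\<lambda>j. A j s) \<longlonglongrightarrow> 0" by (rule summable_LIMSEQ_zero)
    then have "(\<lambda>j. sqrt (A j s)) \<longlonglongrightarrow> sqrt 0" by (rule tendsto_real_sqrt)
    then have "(\<lambda>j. \<bar>(\<Sum>r\<in>R j. X j r s - t) / n j\<bar>) \<longlonglongrightarrow> 0" unfolding A_def by simp
    then have "(\<lambda>j. (\<Sum>r\<in>R j. X j r s - t) / n j) \<longlonglongrightarrow> 0" by (rule tendsto_rabs_zero_cancel)
    moreover have "(\<Sum>r\<in>R j. X j r s - t) / n j = (\<Sum>r\<in>R j. X j r s) / n j - t" for j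
      using n[of j] by (simp add: sum_subtractf n_def[symmetric] diff_divide_distrib)
    ultimately have "(\<lambda>j. (\<Sum>r\<in>R j. X j r s) / n j - t) \<longlonglongrightarrow> 0" by simp
    then show ?case unfolding n_def by (rule LIM_zero_cancel)
  qed
qed

section \<open>Levels of the tree and their sizes\<close>

definition tree_level :: "nat \<Rightarrow> nat \<Rightarrow> nat list set" where
  "tree_level K j = {v. set v \<subseteq> {..<K} \<and> length v = j}"

lemma finite_tree_level: "finite (tree_level K j)"
  unfolding tree_level_def by (rule finite_lists_length_eq) simp

lemma card_tree_level: "card (tree_level K j) = K ^ j"
  unfolding tree_level_def by (simp add: card_lists_length_eq)

lemma sum_tree_ball_levels:
  fixes f :: "nat list \<Rightarrow> 'b::comm_monoid_add"
  shows "(\<Sum>r\<in>tree_ball K L. f r) = (\<Sum>m\<le>L. \<Sum>r\<in>tree_level K (L - m). f r)"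
proof -
  have "(\<Sum>r\<in>tree_ball K L. f r) = (\<Sum>m\<le>L. \<Sum>r | r \<in> tree_ball K L \<and> L - length r = m. f r)"
    by (rule sum.group[symmetric, OF finite_tree_ball]) auto
  also have "\<dots> = (\<Sum>m\<le>L. \<Sum>r\<in>tree_level K (L - m). f r)"
    by (intro sum.cong refl) (auto simp: tree_ball_def tree_level_def)
  finally show ?thesis .
qed

lemma card_tree_ball: "card (tree_ball K L) = (\<Sum>j\<le>L. K ^ j)"
proof -
  have "card (tree_ball K L) = (\<Sum>m\<le>L. K ^ (L - m))"
    using sum_tree_ball_levels[of "\<lambda>_. 1::nat" K L] by (simp add: card_tree_level)
  also have "\<dots> = (\<Sum>j\<le>L. K ^ j)"
    by (rule sum.reindex_bij_witness[where i="\<lambda>j. L - j" and j="\<lambda>j. L - j"]) auto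
  finally show ?thesis .
qed

lemma card_tree_ball_ratio:
  assumes K: "K \<ge> 2"
  shows "real K ^ L / real (card (tree_ball K L)) = (real K - 1) / (real K - (1 / real K) ^ L)"
proof -
  have "(real K - 1) * real (card (tree_ball K L)) = real K ^ Suc L - 1"
    unfolding card_tree_ball using power_diff_1_eq[of "real K" "Suc L"]
    by (simp add: lessThan_Suc_atMost)
  moreover have "real (card (tree_ball K L)) > 0"
    unfolding of_nat_0_less_iff card_gt_0_iff using Nil_in_tree_ball finite_tree_ball by blast
  moreover have "real K - (1 / real K) ^ L = (real K ^ Suc L - 1) / real K ^ L"
    using K by (simp add: field_simps power_divide)
  ultimately have "real K - (1 / real K) ^ L = (real K - 1) * real (card (tree_ball K L)) / real K ^ L"
    by simp
  then show ?thesis using K by simp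
qed

section \<open>Almost sure convergence of the level averages\<close>

locale random_tree = iid_law K b \<nu> + P: prob_space M
  for K b \<nu> and M :: "'a measure" +
  fixes \<omega> :: "nat list \<Rightarrow> 'a \<Rightarrow> real"
  assumes indep: "P.indep_vars (\<lambda>_. borel) \<omega> (tree_vertices K)"
    and law: "\<And>x. x \<in> tree_vertices K \<Longrightarrow> distr M borel (\<omega> x) = \<nu>"
begin

lemma rv: "x \<in> tree_vertices K \<Longrightarrow> \<omega> x \<in> borel_measurable M"
  using indep unfolding P.indep_vars_def by blast

lemma append_in_tree_vertices: "u \<in> tree_ball K m \<Longrightarrow> r \<in> tree_vertices K \<Longrightarrow> u @ r \<in> tree_vertices K"
  unfolding tree_ball_def tree_vertices_def by auto

lemma joint_law:
  "distr M (PiM (tree_vertices K) (\<lambda>_. \<nu>)) (\<lambda>s. \<lambda>x\<in>tree_vertices K. \<omega> x s) = PiM (tree_vertices K) (\<lambda>_. \<nu>)"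
proof -
  let ?V = "tree_vertices K"
  have ne: "?V \<noteq> {}" unfolding tree_vertices_def by (auto intro: exI[of _ "[]"])
  have s: "sets (PiM ?V (\<lambda>_. \<nu>)) = sets (PiM ?V (\<lambda>_. borel))"
    by (rule sets_PiM_cong) (auto simp: sets_nu)
  have "distr M (PiM ?V (\<lambda>_. \<nu>)) (\<lambda>s. \<lambda>x\<in>?V. \<omega> x s) = distr M (PiM ?V (\<lambda>_. borel)) (\<lambda>s. \<lambda>x\<in>?V. \<omega> x s)"
    by (rule distr_cong) (auto simp: s)
  also have "\<dots> = PiM ?V (\<lambda>x. distr M borel (\<omega> x))"
    using indep P.indep_vars_iff_distr_eq_PiM'[OF ne, where M'="\<lambda>_. borel" and X=\<omega>] rv by blast
  also have "\<dots> = PiM ?V (\<lambda>_. \<nu>)"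
    by (rule PiM_cong) (auto simp: law)
  finally show ?thesis .
qed

lemma nodesum_rv:
  assumes r: "r \<in> tree_vertices K"
  shows "(\<lambda>s. nodesum K b z m (\<lambda>x. \<omega> x s) r) \<in> borel_measurable M"
  by (rule nodesum_measurable) (auto intro: rv append_in_tree_vertices r)

lemma expectation_nodesum:
  assumes r: "r \<in> tree_vertices K"
  shows "(\<integral>s. nodesum K b z m (\<lambda>x. \<omega> x s) r \<partial>M) = meannode z m"
proof -
  let ?V = "tree_vertices K"
  let ?t = "\<lambda>s. \<lambda>x\<in>?V. \<omega> x s"
  have t: "?t \<in> measurable M (PiM ?V (\<lambda>_. \<nu>))"
    by (rule measurable_restrict) (simp add: measurable_nu rv)
  have F: "(\<lambda>W. nodesum K b z m (\<lambda>u. W (u @ r)) []) \<in> borel_measurable (PiM ?V (\<lambda>_. \<nu>))"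
    by (rule nodesum_measurable) (auto intro: component_measurable append_in_tree_vertices r)
  have "(\<integral>s. nodesum K b z m (\<lambda>x. \<omega> x s) r \<partial>M) = (\<integral>s. nodesum K b z m (\<lambda>u. ?t s (u @ r)) [] \<partial>M)"
    unfolding nodesum_shift
    by (intro Bochner_Integration.integral_cong refl nodesum_cong) (simp add: append_in_tree_vertices r)
  also have "\<dots> = (\<integral>W. nodesum K b z m (\<lambda>u. W (u @ r)) [] \<partial>PiM ?V (\<lambda>_. \<nu>))"
    using integral_distr[OF t F] unfolding joint_law by simp
  also have "\<dots> = meannode z m"
    unfolding meannode_def
  proof (rule reindex_integral[OF _ _ nodesum_Q_measurable])
    show "inj_on (\<lambda>u. u @ r) (tree_ball K m)" by (auto simp: inj_on_def)
    show "(\<lambda>u. u @ r) \<in> tree_ball K m \<rightarrow> ?V" using append_in_tree_vertices r by blast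
    show "nodesum K b z m W [] = nodesum K b z m W' []" if "\<And>u. u \<in> tree_ball K m \<Longrightarrow> W u = W' u" for W W'
      by (rule nodesum_cong) (use that in simp)
  qed
  finally show ?thesis .
qed

text \<open>Subtrees hanging from distinct vertices of the same level are disjoint, and a node sum
  reads only the potential in its own subtree.\<close>

lemma nodesum_indep:
  assumes r: "r \<in> tree_level K j" "r' \<in> tree_level K j" "r \<noteq> r'" and \<phi>: "\<phi> \<in> borel_measurable borel"
  shows "P.indep_var borel (\<lambda>s. \<phi> (nodesum K b z m (\<lambda>x. \<omega> x s) r) :: real) borel (\<lambda>s. \<phi> (nodesum K b z m (\<lambda>x. \<omega> x s) r'))"
proof -
  let ?A = "\<lambda>r. (\<lambda>u. u @ r) ` tree_ball K m"
  have rV: "r \<in> tree_vertices K" "r' \<in> tree_vertices K" using r unfolding tree_level_def tree_vertices_def by auto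
  have "?A r \<inter> ?A r' = {}" using r unfolding tree_level_def by auto
  moreover have "?A r \<subseteq> tree_vertices K" "?A r' \<subseteq> tree_vertices K" using append_in_tree_vertices rV by auto
  ultimately have ind: "P.indep_var (PiM (?A r) (\<lambda>_. borel)) (\<lambda>s. restrict (\<lambda>x. \<omega> x s) (?A r))
      (PiM (?A r') (\<lambda>_. borel)) (\<lambda>s. restrict (\<lambda>x. \<omega> x s) (?A r'))"
    by (rule P.indep_var_restrict[OF indep])
  have m: "(\<lambda>W. \<phi> (nodesum K b z m W \<rho>)) \<in> borel_measurable (PiM (?A \<rho>) (\<lambda>_. borel))" for \<rho>
    by (rule measurable_compose[OF nodesum_measurable \<phi>]) (auto intro: measurable_component_singleton)
  have e: "(\<lambda>W. \<phi> (nodesum K b z m W \<rho>)) \<circ> (\<lambda>s. restrict (\<lambda>x. \<omega> x s) (?A \<rho>))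
      = (\<lambda>s. \<phi> (nodesum K b z m (\<lambda>x. \<omega> x s) \<rho>))" for \<rho>
    unfolding comp_def by (intro ext arg_cong[of _ _ \<phi>] nodesum_cong) simp
  show ?thesis using P.indep_var_compose[OF ind m m] unfolding e .
qed

lemma level_average_converges_real:
  assumes z: "Im z > 0" and \<phi>: "\<phi> = Re \<or> \<phi> = Im"
  shows "AE s in M. (\<lambda>j. (\<Sum>r\<in>tree_level K j. \<phi> (nodesum K b z m (\<lambda>x. \<omega> x s) r)) / real (card (tree_level K j))) \<longlonglongrightarrow> \<phi> (meannode z m)"
proof -
  interpret upper_half K b z by unfold_locales (rule z)
  have V: "r \<in> tree_vertices K" if "r \<in> tree_level K j" for r j
    using that unfolding tree_level_def tree_vertices_def by auto
  have \<phi>m: "\<phi> \<in> borel_measurable borel" using \<phi> by auto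
  have m: "(\<lambda>s. \<phi> (nodesum K b z m (\<lambda>x. \<omega> x s) r)) \<in> borel_measurable M" if "r \<in> tree_level K j" for r j
    by (rule measurable_compose[OF nodesum_rv[OF V[OF that]] \<phi>m])
  have bd: "\<bar>\<phi> (nodesum K b z m W r)\<bar> \<le> 1 / Im z" for W r
  proof -
    have "\<bar>\<phi> (nodesum K b z m W r)\<bar> \<le> norm (nodesum K b z m W r)"
      using \<phi> abs_Re_le_cmod abs_Im_le_cmod by auto
    then show ?thesis using norm_nodesum_le[of m W r] by linarith
  qed
  have ic: "integrable M (\<lambda>s. nodesum K b z m (\<lambda>x. \<omega> x s) r)" if "r \<in> tree_level K j" for r j
    by (rule P.integrable_const_bound[OF AE_I2 nodesum_rv[OF V[OF that]]]) (rule norm_nodesum_le)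
  have i: "integrable M (\<lambda>s. \<phi> (nodesum K b z m (\<lambda>x. \<omega> x s) r))" if "r \<in> tree_level K j" for r j
    by (rule P.integrable_const_bound[where B="1 / Im z", OF AE_I2 m[OF that]]) (simp only: real_norm_def bd)
  have e: "P.expectation (\<lambda>s. \<phi> (nodesum K b z m (\<lambda>x. \<omega> x s) r)) = \<phi> (meannode z m)" if "r \<in> tree_level K j" for r j
    using \<phi> ic[OF that] unfolding expectation_nodesum[OF V[OF that], symmetric] by auto
  show ?thesis
  proof (rule P.uncorrelated_averages_converge)
    show "finite (tree_level K j)" for j by (rule finite_tree_level)
    show "tree_level K j \<noteq> {}" for j
      using card_tree_level[of K j] K_pos by (metis card.empty power_not_zero not_gr0)
    show "summable (\<lambda>j. 1 / real (card (tree_level K j)))"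
      using summable_geometric[of "1 / real K"] K2 by (simp add: card_tree_level power_divide)
    show "P.expectation (\<lambda>s. \<phi> (nodesum K b z m (\<lambda>x. \<omega> x s) r) * \<phi> (nodesum K b z m (\<lambda>x. \<omega> x s) r')) = \<phi> (meannode z m) * \<phi> (meannode z m)"
      if r: "r \<in> tree_level K j" "r' \<in> tree_level K j" "r \<noteq> r'" for j r r'
      using P.indep_var_lebesgue_integral[OF nodesum_indep[OF r \<phi>m] i[OF r(1)] i[OF r(2)]] e[OF r(1)] e[OF r(2)] by simp
  qed (use m bd e in auto)
qed

lemma level_average_converges:
  assumes z: "Im z > 0"
  shows "AE s in M. (\<lambda>j. (\<Sum>r\<in>tree_level K j. nodesum K b z m (\<lambda>x. \<omega> x s) r) / of_nat (K ^ j)) \<longlonglongrightarrow> meannode z m"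
  using level_average_converges_real[OF z disjI1[OF refl], of m] level_average_converges_real[OF z disjI2[OF refl], of m]
proof eventually_elim
  case (elim s)
  then show ?case
    unfolding tendsto_complex_iff card_tree_level Re_divide_of_nat Im_divide_of_nat Re_sum Im_sum by blast
qed

end

section \<open>From level averages to spectral averages, for a fixed potential\<close>

context iid_law
begin

text \<open>Vertices at height \<open>m\<close> make up a share of at most \<open>1 / K ^ m\<close>
  of the ball, and node sums are bounded, so the limit may be taken height by height.\<close>

lemma trace_resolvent_converges:
  assumes z: "Im z > 0"
    and avg: "\<And>m. (\<lambda>j. (\<Sum>r\<in>tree_level K j. nodesum K b z m W r) / of_nat (K ^ j)) \<longlonglongrightarrow> meannode z m"
  shows "(\<lambda>L. stieltjes (ev_dist (tree_ball K L) (H_tree K b L W)) z) \<longlonglongrightarrow> stieltjes dos z"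
proof -
  interpret upper_half K b z by unfold_locales (rule z)
  have z0: "Im z \<noteq> 0" using z by simp
  define av where "av m j = (\<Sum>r\<in>tree_level K j. nodesum K b z m W r) / of_nat (K ^ j)" for m j
  define c where "c L = real (card (tree_ball K L))" for L
  define p where "p = (real K - 1) / real K"
  \<comment> \<open>The share of height \<open>m\<close> times its level average; the value 0 for
    \<open>m > L\<close> turns the finite sum into a series to which Tannery's theorem
    applies.\<close>
  define a where "a m L = (if m \<le> L then of_real (real K ^ L / c L / real K ^ m) * av m (L - m) else 0)" for m L
  have c: "c L \<ge> real K ^ L" "c L > 0" for L
  proof -
    have "K ^ L \<le> (\<Sum>j\<le>L. K ^ j)" by (rule member_le_sum) auto
    then show "c L \<ge> real K ^ L" unfolding c_def card_tree_ball by (metis of_nat_le_iff of_nat_power)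
    then show "c L > 0" using K_pos by (smt (verit) of_nat_0_less_iff zero_less_power)
  qed
  have st: "stieltjes (ev_dist (tree_ball K L) (H_tree K b L W)) z = (\<Sum>m. a m L)" for L
  proof -
    interpret S: symmetric_on "tree_ball K L" "H_tree K b L W"
      by unfold_locales (rule finite_tree_ball, rule H_tree_sym)
    interpret G: tree_green K b z L W "green (tree_ball K L) (H_tree K b L W) z"
      by unfold_locales (rule S.green_eq[OF z0], assumption+, rule S.green_sym)
    have ne: "tree_ball K L \<noteq> {}" using Nil_in_tree_ball by blast
    have "stieltjes (ev_dist (tree_ball K L) (H_tree K b L W)) z
      = (\<Sum>r\<in>tree_ball K L. nodesum K b z (L - length r) W r) / of_nat (card (tree_ball K L))"
      unfolding S.ev_dist_stieltjes[OF ne] G.g_trace ..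
    also have "\<dots> = (\<Sum>m\<le>L. \<Sum>r\<in>tree_level K (L - m). nodesum K b z (L - length r) W r) / of_real (c L)"
      unfolding sum_tree_ball_levels c_def by simp
    also have "\<dots> = (\<Sum>m\<le>L. a m L)"
    proof (subst sum_divide_distrib, rule sum.cong[OF refl])
      fix m assume "m \<in> {..L}"
      then have m: "m \<le> L" by simp
      have "(\<Sum>r\<in>tree_level K (L - m). nodesum K b z (L - length r) W r) = (\<Sum>r\<in>tree_level K (L - m). nodesum K b z m W r)"
        using m by (intro sum.cong refl) (simp add: tree_level_def)
      also have "\<dots> = of_nat (K ^ (L - m)) * av m (L - m)" unfolding av_def using K_pos by simp
      finally have "(\<Sum>r\<in>tree_level K (L - m). nodesum K b z (L - length r) W r) / of_real (c L)
          = of_real (real K ^ (L - m) / c L) * av m (L - m)" by simp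
      moreover have "real K ^ (L - m) / c L = real K ^ L / c L / real K ^ m"
        using m K_pos by (simp add: power_diff)
      ultimately show "(\<Sum>r\<in>tree_level K (L - m). nodesum K b z (L - length r) W r) / of_real (c L) = a m L"
        unfolding a_def using m by simp
    qed
    also have "\<dots> = (\<Sum>m. a m L)"
      by (rule suminf_finite[symmetric]) (auto simp: a_def)
    finally show ?thesis .
  qed
  have ratio: "(\<lambda>L. real K ^ L / c L) \<longlonglongrightarrow> p"
  proof -
    have "(\<lambda>L. (real K - 1) / (real K - (1 / real K) ^ L)) \<longlonglongrightarrow> (real K - 1) / (real K - 0)"
      using K2 by (intro tendsto_intros LIMSEQ_power_zero) auto
    then show ?thesis unfolding c_def card_tree_ball_ratio[OF K2] p_def by simp
  qed
  have avb: "norm (av m j) \<le> 1 / Im z" for m j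
  proof -
    have "norm (\<Sum>r\<in>tree_level K j. nodesum K b z m W r) \<le> real (card (tree_level K j)) * (1 / Im z)"
      by (rule sum_norm_bound) (rule norm_nodesum_le)
    then show ?thesis unfolding av_def card_tree_level using K_pos
      by (simp add: norm_divide norm_power divide_le_eq mult.commute)
  qed
  have geo: "summable (\<lambda>m. (1 / real K) ^ m * (1 / Im z))"
    using K2 by (intro summable_mult2 summable_geometric) simp
  have lim: "(\<lambda>L. a m L) \<longlonglongrightarrow> of_real (p / real K ^ m) * meannode z m" for m
  proof -
    have "(\<lambda>L. av m (L - m)) \<longlonglongrightarrow> meannode z m"
      using avg[of m] LIMSEQ_offset[of "\<lambda>L. av m (L - m)" m] unfolding av_def[symmetric] by simp
    then have "(\<lambda>L. of_real (real K ^ L / c L / real K ^ m) * av m (L - m)) \<longlonglongrightarrow> of_real (p / real K ^ m) * meannode z m"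
      using K_pos by (intro tendsto_intros ratio) auto
    moreover have "eventually (\<lambda>L. of_real (real K ^ L / c L / real K ^ m) * av m (L - m) = a m L) sequentially"
      by (rule eventually_sequentiallyI[of m]) (simp add: a_def)
    ultimately show ?thesis by (rule Lim_transform_eventually)
  qed
  have bound: "eventually (\<lambda>(m, L). norm (a m L) \<le> (1 / real K) ^ m * (1 / Im z)) (at_top \<times>\<^sub>F sequentially)"
  proof -
    have "norm (a m L) \<le> (1 / real K) ^ m * (1 / Im z)" for m L
    proof (cases "m \<le> L")
      case True
      have "norm (a m L) = (real K ^ L / c L) * ((1 / real K) ^ m * norm (av m (L - m)))"
        unfolding a_def using True c(2)[of L] by (simp add: norm_mult norm_divide norm_power power_divide)
      also have "\<dots> \<le> 1 * ((1 / real K) ^ m * (1 / Im z))"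
        using c[of L] avb z by (intro mult_mono mult_left_mono) auto
      finally show ?thesis by simp
    qed (use z in \<open>simp add: a_def\<close>)
    then show ?thesis by (intro always_eventually) auto
  qed
  have tan: "(\<lambda>L. \<Sum>m. a m L) \<longlonglongrightarrow> (\<Sum>m. of_real (p / real K ^ m) * meannode z m)"
    using tannerys_theorem[OF lim bound geo] by simp
  have "(\<lambda>M. of_real p * (\<Sum>m\<le>M. meannode z m / of_nat (K ^ m))) \<longlonglongrightarrow> stieltjes dos z"
    unfolding stieltjes_dos[OF z] p_def[symmetric] by (intro tendsto_mult tendsto_const sum_meannode[OF z])
  moreover have "of_real p * (\<Sum>m\<le>M. meannode z m / of_nat (K ^ m)) = (\<Sum>m\<le>M. of_real (p / real K ^ m) * meannode z m)" for M
    unfolding sum_distrib_left by (intro sum.cong refl) simp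
  ultimately have sums: "(\<lambda>m. of_real (p / real K ^ m) * meannode z m) sums stieltjes dos z"
    unfolding sums_def_le by simp
  from tan show ?thesis unfolding st sums_unique[OF sums, symmetric] .
qed

text \<open>The hypothesis does not mention \<open>F\<close>: weak convergence covers all test
  functions with the same exceptional set.\<close>

lemma spectral_averages_converge:
  assumes avg: "\<And>z m. z \<in> rat_upper_half_plane \<Longrightarrow>
      (\<lambda>j. (\<Sum>r\<in>tree_level K j. nodesum K b z m W r) / of_nat (K ^ j)) \<longlonglongrightarrow> meannode z m"
    and F: "continuous_on UNIV F" "bounded (range F)"
  shows "(\<lambda>L. trace_fun_on (tree_ball K L) F (H_tree K b L W) / real (card (tree_ball K L))) \<longlonglongrightarrow> integral\<^sup>L dos F"
proof -
  let ?\<mu> = "\<lambda>L. ev_dist (tree_ball K L) (H_tree K b L W)"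
  have S: "symmetric_on (tree_ball K L) (H_tree K b L W)" for L
    by unfold_locales (rule finite_tree_ball, rule H_tree_sym)
  have ne: "tree_ball K L \<noteq> {}" for L using Nil_in_tree_ball by blast
  have \<mu>: "real_distribution (?\<mu> L)" for L by (rule symmetric_on.ev_dist_real_distribution[OF S ne])
  have w: "weak_conv_m ?\<mu> dos"
  proof (rule stieltjes_continuity[OF \<mu> dos_real_distribution])
    fix z assume z: "z \<in> rat_upper_half_plane"
    then have "Im z > 0" unfolding rat_upper_half_plane_def by auto
    then show "(\<lambda>L. stieltjes (?\<mu> L) z) \<longlonglongrightarrow> stieltjes dos z"
      by (rule trace_resolvent_converges) (rule avg[OF z])
  qed
  obtain B where B: "\<And>x. norm (F x) \<le> B" using F(2) unfolding bounded_iff by auto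
  have "(\<lambda>L. integral\<^sup>L (?\<mu> L) F) \<longlonglongrightarrow> integral\<^sup>L dos F"
    by (rule weak_conv_imp_integral_bdd_continuous_conv[OF \<mu> dos_real_distribution w _ B])
      (use F(1) in \<open>simp add: continuous_on_eq_continuous_at\<close>)
  moreover have "F \<in> borel_measurable borel" using F(1) by (rule borel_measurable_continuous_onI)
  ultimately show ?thesis by (simp add: symmetric_on.ev_dist_integral[OF S ne])
qed

end

theorem theorem1p2:
  fixes K :: nat and b :: real and \<rho> :: "real \<Rightarrow> real" and \<tau> :: real
    and M :: "'a measure" and \<omega> :: "nat list \<Rightarrow> 'a \<Rightarrow> real"
  assumes K: "K \<ge> 2"
    and P: "prob_space M"
    and rho_meas: "\<rho> \<in> borel_measurable borel"
    and rho_nonneg: "\<And>t. \<rho> t \<ge> 0"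
    and rho_bdd: "\<exists>C. \<forall>t. \<rho> t \<le> C"
    and tau: "\<tau> > 0"
    and moment: "(\<integral>\<^sup>+ t. ennreal (\<bar>t\<bar> powr \<tau> * \<rho> t) \<partial>lborel) < \<infinity>"
    and indep: "prob_space.indep_vars M (\<lambda>_. borel) \<omega> (tree_vertices K)"
    and distr: "\<And>x. x \<in> tree_vertices K \<Longrightarrow>
                  distributed M lborel (\<omega> x) (\<lambda>t. ennreal (\<rho> t))"
  shows "AE w in M. \<forall>F :: real \<Rightarrow> real. continuous_on UNIV F \<longrightarrow> bounded (range F) \<longrightarrow>
           (\<lambda>L. trace_fun_on (tree_ball K L) F (H_tree K b L (\<lambda>x. \<omega> x w)) / real (card (tree_ball K L)))
             \<longlonglongrightarrow> integral\<^sup>L (canopy_dos K b \<rho>) F"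
proof -
  let ?\<nu> = "density lborel (\<lambda>t. ennreal (\<rho> t))"
  have law: "distr M borel (\<omega> x) = ?\<nu>" if "x \<in> tree_vertices K" for x
  proof -
    have "distr M borel (\<omega> x) = distr M lborel (\<omega> x)" by (rule distr_cong) auto
    then show ?thesis using distributed_distr_eq_density[OF distr[OF that]] by simp
  qed
  have root: "[] \<in> tree_vertices K" unfolding tree_vertices_def by simp
  \<comment> \<open>That the density has total mass one is read off from the law of the variable at
    the root.\<close>
  have "\<omega> [] \<in> borel_measurable M"
    using distributed_measurable[OF distr[OF root]] by simp
  then have "prob_space (distr M borel (\<omega> []))" by (rule prob_space.prob_space_distr[OF P])
  then have nu: "prob_space ?\<nu>" unfolding law[OF root] .
  have iid: "iid_law K ?\<nu>" by (rule iid_law.intro[OF K nu]) simp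
  interpret iid_law K b ?\<nu> by (rule iid)
  interpret random_tree K b ?\<nu> M \<omega>
  proof (rule random_tree.intro[OF iid P])
    show "random_tree_axioms K ?\<nu> M \<omega>"
      by (rule random_tree_axioms.intro[OF indep law])
  qed
  \<comment> \<open>A countable union of null sets, over \<open>z\<close> and \<open>m\<close>,
    fixed before any \<open>F\<close> is chosen.\<close>
  have "AE w in M. \<forall>z\<in>rat_upper_half_plane. \<forall>m.
     (\<lambda>j. (\<Sum>r\<in>tree_level K j. nodesum K b z m (\<lambda>x. \<omega> x w) r) / of_nat (K ^ j)) \<longlonglongrightarrow> meannode z m"
    unfolding AE_ball_countable[OF countable_rat_upper_half_plane] AE_all_countable
  proof (intro ballI allI level_average_converges)
    show "Im z > 0" if "z \<in> rat_upper_half_plane" for z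
      using that unfolding rat_upper_half_plane_def by auto
  qed
  then show ?thesis
    unfolding canopy_dos_eq[OF iid]
    by eventually_elim (intro allI impI spectral_averages_converge, blast+)
qed

end
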